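(* Let $\mathcal A=\{A_\alpha\}\subset\tilde{\mathcal A}$ be a null family. Then the following holds. (a) (Invariance of limit measures) If $V\in C^1(\mathcal U,\mathbb R^n)$ and $\varphi^t$ is a flow on $\mathcal U$, then any $\mathcal A$-limit measure is an invariant measure of $\varphi^t$. (b) (Stochastic LaSalle invariance principle) If the ODE $\dot x=V(x)$ admits an entire weak Lyapunov (resp. anti-Lyapunov) function $U_0$ in $\mathcal U$, then any $\mathcal A$-limit measure with compact support is concentrated on the set $S_0=\{x\in\mathcal U: V(x)\cdot\nabla U_0(x)=0\}$. (c) (Local concentration of limit measures) If $V\in C^1(\mathcal U,\mathbb R^n)$ and $\mathcal E_0$ is either a strong local attractor or a strong local repeller of $\varphi^t$, then there is a neighborhood $\mathcal W_0$ of $\mathcal E_0$ in $\mathcal U$ such that $\mu(\mathcal W_0\setminus\mathcal E_0)=0$ for any $\mathcal A$-limit measure $\mu$.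
   Context: Setting. $\mathcal U\subset\mathbb R^n$ is a connected open set (bounded, unbounded, or all of $\mathbb R^n$), $V=(V^i)\in C(\mathcal U,\mathbb R^n)$, and the ODE $\dot x=V(x)$ is assumed to generate a (continuous) local flow $\varphi^t$ on $\mathcal U$: for $\xi\in\mathcal U$, $\varphi^t(\xi)$ is the unique solution with $\varphi^0(\xi)=\xi$, defined for $t$ in its maximal interval $\mathcal I_\xi$ of existence in $\mathcal U$. $\varphi^t$ is a flow on $\mathcal U$ if $\mathcal I_\xi=\mathbb R$ for all $\xi\in\mathcal U$. Diffusion matrices. Fix an integer $m\ge n$ and a real $p>n$. $\tilde{\mathcal A}$ is the set of matrix functions $A=(a^{ij})\in W^{1,p}_{loc}(\mathcal U,GL(n,\mathbb R))$ of the form $A=\frac12GG^\top$, where $G=(g^{ij})$ is an $n\times m$ matrix function on $\mathcal U$ with $g^{ij}\in W^{1,2p}_{loc}(\mathcal U)$ and $\mathrm{Rank}(G)\equiv n$ (continuous representatives are used). With summation over repeated indices, $\mathcal L_A=a^{ij}\partial^2_{ij}+V^i\partial_i$. A stationary measure corresponding to $\mathcal L_A$ is a Borel probability measure $\mu$ on $\mathcal U$ with $\int_{\mathcal U}\mathcal L_Af\,d\mu=0$ for all $f\in C_0^\infty(\mathcal U)$ (smooth, compactly supported). Null families and limit measures. A null family is a directed net $\mathcal A=\{A_\alpha\}$ in $\tilde{\mathcal A}$ converging to the zero matrix in the (metrizable) topology of $W^{1,p}$-convergence on compact subsets of $\mathcal U$. $M(\mathcal U)$ is the space of Borel probability measures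 on $\mathcal U$ with the weak$^*$-topology ($\mu_k\to\mu$ iff $\int f\,d\mu_k\to\int f\,d\mu$ for all bounded continuous $f$). An $\mathcal A$-limit measure is a $\mu\in M(\mathcal U)$ for which there are a sequence $\{A_\ell\}\subset\mathcal A$ with $A_\ell\to0$ and stationary measures $\mu_\ell$ corresponding to $\mathcal L_{A_\ell}$ with $\mu_\ell\to\mu$ in $M(\mathcal U)$. "$\mu$ is concentrated on $S$" means $\mathrm{supp}(\mu)\subset S$. When $\varphi^t$ is a flow, $\mu$ is an invariant measure if $\mu(\varphi^{-t}(B))=\mu(B)$ for all Borel $B\subset\mathcal U$ and all $t\in\mathbb R$. Lyapunov functions. For a connected open $\Omega\subset\mathcal U$, a nonnegative $U\in C(\Omega)$ is a compact function if, with $\rho_M=\sup_\Omega U\in(0,\infty]$, $U<\rho_M$ on $\Omega$ and $U(x)\to\rho_M$ as $x\to\partial\Omega$ (i.e. as $x$ leaves every compact subset of $\Omega$, points at infinity counting as boundary points when $\Omega$ is unbounded). An entire weak Lyapunov (resp. anti-Lyapunov) function of the ODE in $\Omega$ is a compact function $U\in C^1(\Omega)$ with $V(x)\cdot\nabla U(x)\le0$ (resp. $\ge0$) for all $x\in\Omega$. Strong local attractors and repellers. A set $B\subset\mathcal U$ is an invariant set of $\varphi^t$ if $\mathcal I_\xi=\mathbb R$ for $\xi\in B$ and $\varphi^t(B)=B$ for all $t\in\mathbb R$; positively (resp. negatively) invariant if $\mathcal I_\xi\supset\mathbb R_+$ (resp. $\mathbb R_-$) for $\xi\in B$ and $\varphi^t(B)\subset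 B$ for all $t\ge0$ (resp. $t\le0$). For $B$ whose forward (resp. backward) orbit exists and is pre-compact in $\mathcal U$, $\omega(B)=\bigcap_{\tau\ge0}\overline{\bigcup_{t\ge\tau}\varphi^t(B)}$ (resp. $\alpha(B)=\bigcap_{\tau\le0}\overline{\bigcup_{t\le\tau}\varphi^t(B)}$). A compact invariant set $\mathcal E_0\subset\mathcal U$ is a strong local attractor (resp. strong local repeller) if it has a connected, positively (resp. negatively) invariant neighborhood $\mathcal W$ in $\mathcal U$, pre-compact in $\mathcal U$, with oriented $C^2$ boundary, such that $\mathcal E_0$ attracts (resp. repels) $\mathcal W$, i.e. $\omega(\mathcal W)\subset\mathcal E_0$ (resp. $\alpha(\mathcal W)\subset\mathcal E_0$), and $V(x)\cdot\nu(x)<0$ (resp. $>0$) for $x\in\partial\mathcal W$, where $\nu$ is the outward unit normal. *)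

theory Defs
  imports "HOL-Probability.Probability"
begin

section \<open>Differentiability classes and the generator\<close>

definition partial_deriv :: "'n::finite \<Rightarrow> (real^'n \<Rightarrow> real) \<Rightarrow> real^'n \<Rightarrow> real" where
  "partial_deriv i f x = frechet_derivative f (at x) (axis i 1)"

definition grad :: "(real^'n::finite \<Rightarrow> real) \<Rightarrow> real^'n \<Rightarrow> real^'n" where
  "grad f x = (\<chi> i. partial_deriv i f x)"

text \<open>The predicate below is the class \<open>C\<^sup>k(S)\<close>; it is only used for open \<open>S\<close>.\<close>

primrec Ck_on :: "nat \<Rightarrow> (real^'n::finite) set \<Rightarrow> (real^'n \<Rightarrow> real) \<Rightarrow> bool" where
  "Ck_on 0 S f \<longleftrightarrow> continuous_on S f"
| "Ck_on (Suc k) S f \<longleftrightarrow>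
     (\<forall>x\<in>S. f differentiable (at x)) \<and> (\<forall>i. Ck_on k S (partial_deriv i f))"

definition C1_field :: "(real^'n::finite) set \<Rightarrow> (real^'n \<Rightarrow> real^'n) \<Rightarrow> bool" where
  "C1_field S V \<longleftrightarrow> (\<forall>i. Ck_on 1 S (\<lambda>x. V x $ i))"

text \<open>\<open>C\<^sub>0\<^sup>\<infinity>(U)\<close>, each function being extended by zero to the whole space.\<close>

definition test_functions :: "(real^'n::finite) set \<Rightarrow> (real^'n \<Rightarrow> real) set" where
  "test_functions U =
     {f. (\<forall>k. Ck_on k UNIV f) \<and> compact (closure {x. f x \<noteq> 0}) \<and> closure {x. f x \<noteq> 0} \<subseteq> U}"

definition generator ::
  "(real^'n::finite \<Rightarrow> real^'n^'n) \<Rightarrow> (real^'n \<Rightarrow> real^'n) \<Rightarrow> (real^'n \<Rightarrow> real) \<Rightarrow> real^'n \<Rightarrow> real" where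
  "generator A V f x =
     (\<Sum>i\<in>UNIV. \<Sum>j\<in>UNIV. A x $ i $ j * partial_deriv i (partial_deriv j f) x)
     + (\<Sum>i\<in>UNIV. V x $ i * partial_deriv i f x)"

section \<open>Local Sobolev spaces\<close>

definition Lp_loc :: "real \<Rightarrow> (real^'n::finite) set \<Rightarrow> (real^'n \<Rightarrow> real) set" where
  "Lp_loc p U = {u. u \<in> borel_measurable (lebesgue_on U) \<and>
     (\<forall>K. compact K \<and> K \<subseteq> U \<longrightarrow> integrable (lebesgue_on K) (\<lambda>x. \<bar>u x\<bar> powr p))}"

definition is_weak_partial ::
  "(real^'n::finite) set \<Rightarrow> 'n \<Rightarrow> (real^'n \<Rightarrow> real) \<Rightarrow> (real^'n \<Rightarrow> real) \<Rightarrow> bool" where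
  "is_weak_partial U i u w \<longleftrightarrow> w \<in> Lp_loc 1 U \<and>
     (\<forall>\<psi>\<in>test_functions U.
        integral\<^sup>L (lebesgue_on U) (\<lambda>x. u x * partial_deriv i \<psi> x)
        = - integral\<^sup>L (lebesgue_on U) (\<lambda>x. w x * \<psi> x))"

definition W1p_loc :: "real \<Rightarrow> (real^'n::finite) set \<Rightarrow> (real^'n \<Rightarrow> real) set" where
  "W1p_loc p U = {u. u \<in> Lp_loc p U \<and> (\<forall>i. \<exists>w\<in>Lp_loc p U. is_weak_partial U i u w)}"

text \<open>Weak derivatives are unique up to null sets, so the choice does not affect the norms below.\<close>

definition weak_partial :: "(real^'n::finite) set \<Rightarrow> 'n \<Rightarrow> (real^'n \<Rightarrow> real) \<Rightarrow> real^'n \<Rightarrow> real" where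
  "weak_partial U i u = (SOME w. is_weak_partial U i u w)"

text \<open>The Bochner integral is 0 for non-integrable functions; the norms are only applied to
  members of \<^term>\<open>W1p_loc p U\<close> on compact \<open>K \<subseteq> U\<close>, where the integrals are finite.\<close>

definition Lp_norm_on :: "real \<Rightarrow> (real^'n::finite) set \<Rightarrow> (real^'n \<Rightarrow> real) \<Rightarrow> real" where
  "Lp_norm_on p K u = (integral\<^sup>L (lebesgue_on K) (\<lambda>x. \<bar>u x\<bar> powr p)) powr (1 / p)"

definition W1p_norm_on ::
  "real \<Rightarrow> (real^'n::finite) set \<Rightarrow> (real^'n) set \<Rightarrow> (real^'n \<Rightarrow> real) \<Rightarrow> real" where
  "W1p_norm_on p U K u = Lp_norm_on p K u + (\<Sum>k\<in>UNIV. Lp_norm_on p K (weak_partial U k u))"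

definition W1p_loc_tends_to_zero ::
  "real \<Rightarrow> (real^'n::finite) set \<Rightarrow> ('i \<Rightarrow> real^'n \<Rightarrow> real^'n^'n) \<Rightarrow> 'i filter \<Rightarrow> bool" where
  "W1p_loc_tends_to_zero p U A F \<longleftrightarrow>
     (\<forall>K. compact K \<and> K \<subseteq> U \<longrightarrow>
        (\<forall>i j. ((\<lambda>\<alpha>. W1p_norm_on p U K (\<lambda>x. A \<alpha> x $ i $ j)) \<longlongrightarrow> 0) F))"

section \<open>Diffusion matrices and null families\<close>

text \<open>The type \<open>'m\<close> indexes the columns of the factor \<open>G\<close>. Continuity on \<open>U\<close> selects the
  continuous representatives, so that the rank condition is meaningful at every point.\<close>

definition diffusion_class ::
  "'m::finite itself \<Rightarrow> real \<Rightarrow> (real^'n::finite) set \<Rightarrow> (real^'n \<Rightarrow> real^'n^'n) set" where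
  "diffusion_class _ p U = {A.
     continuous_on U A \<and> (\<forall>i j. (\<lambda>x. A x $ i $ j) \<in> W1p_loc p U) \<and> (\<forall>x\<in>U. invertible (A x)) \<and>
     (\<exists>G :: real^'n \<Rightarrow> real^'m^'n.
        continuous_on U G \<and> (\<forall>i j. (\<lambda>x. G x $ i $ j) \<in> W1p_loc (2 * p) U) \<and>
        (\<forall>x\<in>U. rank (G x) = CARD('n)) \<and>
        (\<forall>x\<in>U. A x = (1/2) *\<^sub>R (G x ** transpose (G x))))}"

definition directed_index :: "'i set \<Rightarrow> ('i \<Rightarrow> 'i \<Rightarrow> bool) \<Rightarrow> bool" where
  "directed_index D le \<longleftrightarrow> D \<noteq> {} \<and> (\<forall>a\<in>D. le a a) \<and>
     (\<forall>a\<in>D. \<forall>b\<in>D. \<forall>c\<in>D. le a b \<and> le b c \<longrightarrow> le a c) \<and>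
     (\<forall>a\<in>D. \<forall>b\<in>D. \<exists>c\<in>D. le a c \<and> le b c)"

definition net_filter :: "'i set \<Rightarrow> ('i \<Rightarrow> 'i \<Rightarrow> bool) \<Rightarrow> 'i filter" where
  "net_filter D le = (INF a\<in>D. principal {b\<in>D. le a b})"

lemma eventually_net_filter:
  assumes "directed_index D le"
  shows "eventually P (net_filter D le) \<longleftrightarrow> (\<exists>a\<in>D. \<forall>b\<in>D. le a b \<longrightarrow> P b)"
proof -
  have "eventually P (net_filter D le) \<longleftrightarrow> (\<exists>a\<in>D. eventually P (principal {b\<in>D. le a b}))"
    unfolding net_filter_def
  proof (rule eventually_INF_base)
    show "D \<noteq> {}" using assms by (simp add: directed_index_def)
  next
    fix a b assume ab: "a \<in> D" "b \<in> D"
    then obtain c where c: "c \<in> D" "le a c" "le b c"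
      using assms unfolding directed_index_def by blast
    have "le a d \<and> le b d" if "d \<in> D" "le c d" for d
      using assms ab c that unfolding directed_index_def by blast
    then show "\<exists>x\<in>D. principal {b\<in>D. le x b} \<le> inf (principal {b\<in>D. le a b}) (principal {c\<in>D. le b c})"
      using c(1) by (auto intro!: bexI[of _ c])
  qed
  then show ?thesis by (auto simp: eventually_principal)
qed

definition null_family ::
  "'m::finite itself \<Rightarrow> real \<Rightarrow> (real^'n::finite) set \<Rightarrow> 'i set \<Rightarrow> ('i \<Rightarrow> 'i \<Rightarrow> bool) \<Rightarrow>
   ('i \<Rightarrow> real^'n \<Rightarrow> real^'n^'n) \<Rightarrow> bool" where
  "null_family T p U D le A \<longleftrightarrow> directed_index D le \<and> (\<forall>\<alpha>\<in>D. A \<alpha> \<in> diffusion_class T p U) \<and>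
     W1p_loc_tends_to_zero p U A (net_filter D le)"

section \<open>Borel probability measures, stationary and limit measures\<close>

definition borel_prob_on :: "(real^'n::finite) set \<Rightarrow> (real^'n) measure set" where
  "borel_prob_on U = {\<mu>. prob_space \<mu> \<and> sets \<mu> = sets (restrict_space borel U)}"

definition weak_star_conv ::
  "(real^'n::finite) set \<Rightarrow> (nat \<Rightarrow> (real^'n) measure) \<Rightarrow> (real^'n) measure \<Rightarrow> bool" where
  "weak_star_conv U \<mu>s \<mu> \<longleftrightarrow>
     (\<forall>f :: real^'n \<Rightarrow> real. continuous_on U f \<and> bounded (f ` U) \<longrightarrow>
        (\<lambda>k. integral\<^sup>L (\<mu>s k) f) \<longlonglongrightarrow> integral\<^sup>L \<mu> f)"

definition measure_support :: "(real^'n::finite) set \<Rightarrow> (real^'n) measure \<Rightarrow> (real^'n) set" where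
  "measure_support U \<mu> = {x\<in>U. \<forall>N. open N \<and> x \<in> N \<longrightarrow> measure \<mu> (N \<inter> U) > 0}"

definition stationary_measure ::
  "(real^'n::finite) set \<Rightarrow> (real^'n \<Rightarrow> real^'n) \<Rightarrow> (real^'n \<Rightarrow> real^'n^'n) \<Rightarrow> (real^'n) measure \<Rightarrow> bool" where
  "stationary_measure U V A \<mu> \<longleftrightarrow> \<mu> \<in> borel_prob_on U \<and>
     (\<forall>f\<in>test_functions U. integral\<^sup>L \<mu> (generator A V f) = 0)"

definition limit_measure ::
  "real \<Rightarrow> (real^'n::finite) set \<Rightarrow> (real^'n \<Rightarrow> real^'n) \<Rightarrow> (real^'n \<Rightarrow> real^'n^'n) set \<Rightarrow>
   (real^'n) measure \<Rightarrow> bool" where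
  "limit_measure p U V \<A> \<mu> \<longleftrightarrow> \<mu> \<in> borel_prob_on U \<and>
     (\<exists>B \<mu>s. (\<forall>l. B l \<in> \<A>) \<and> W1p_loc_tends_to_zero p U B sequentially \<and>
        (\<forall>l. stationary_measure U V (B l) (\<mu>s l)) \<and> weak_star_conv U \<mu>s \<mu>)"

section \<open>The flow\<close>

definition solves_ode_in ::
  "(real^'n::finite) set \<Rightarrow> (real^'n \<Rightarrow> real^'n) \<Rightarrow> (real \<Rightarrow> real^'n) \<Rightarrow> real set \<Rightarrow> bool" where
  "solves_ode_in U V x J \<longleftrightarrow>
     (\<forall>t\<in>J. x t \<in> U \<and> (x has_vector_derivative V (x t)) (at t within J))"

text \<open>\<open>I \<xi>\<close> is the maximal interval of existence through \<open>\<xi>\<close>; the values \<open>\<phi> t \<xi>\<close> with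
  \<open>\<xi> \<notin> U\<close> or \<open>t \<notin> I \<xi>\<close> are unspecified. The quantification over \<open>J\<close> and \<open>x\<close> is maximality
  together with uniqueness.\<close>

definition local_flow ::
  "(real^'n::finite) set \<Rightarrow> (real^'n \<Rightarrow> real^'n) \<Rightarrow> (real^'n \<Rightarrow> real set) \<Rightarrow>
   (real \<Rightarrow> real^'n \<Rightarrow> real^'n) \<Rightarrow> bool" where
  "local_flow U V I \<phi> \<longleftrightarrow>
     (\<forall>\<xi>\<in>U. is_interval (I \<xi>) \<and> 0 \<in> I \<xi> \<and>
        (\<phi> 0 \<xi> = \<xi> \<and> solves_ode_in U V (\<lambda>t. \<phi> t \<xi>) (I \<xi>)) \<and>
        (\<forall>J x. is_interval J \<and> 0 \<in> J \<and> x 0 = \<xi> \<and> solves_ode_in U V x J \<longrightarrow>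
           J \<subseteq> I \<xi> \<and> (\<forall>t\<in>J. x t = \<phi> t \<xi>))) \<and>
     open {(t, \<xi>). \<xi> \<in> U \<and> t \<in> I \<xi>} \<and>
     continuous_on {(t, \<xi>). \<xi> \<in> U \<and> t \<in> I \<xi>} (\<lambda>(t, \<xi>). \<phi> t \<xi>)"

definition is_flow :: "(real^'n::finite) set \<Rightarrow> (real^'n \<Rightarrow> real set) \<Rightarrow> bool" where
  "is_flow U I \<longleftrightarrow> (\<forall>\<xi>\<in>U. I \<xi> = UNIV)"

definition invariant_measure ::
  "(real^'n::finite) set \<Rightarrow> (real \<Rightarrow> real^'n \<Rightarrow> real^'n) \<Rightarrow> (real^'n) measure \<Rightarrow> bool" where
  "invariant_measure U \<phi> \<mu> \<longleftrightarrow> \<mu> \<in> borel_prob_on U \<and>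
     (\<forall>t. \<forall>B\<in>sets borel. B \<subseteq> U \<longrightarrow> measure \<mu> (\<phi> (-t) ` B) = measure \<mu> B)"

definition invariant_set ::
  "(real^'n::finite) set \<Rightarrow> (real^'n \<Rightarrow> real set) \<Rightarrow> (real \<Rightarrow> real^'n \<Rightarrow> real^'n) \<Rightarrow> (real^'n) set \<Rightarrow> bool" where
  "invariant_set U I \<phi> B \<longleftrightarrow> B \<subseteq> U \<and> (\<forall>\<xi>\<in>B. I \<xi> = UNIV) \<and> (\<forall>t. \<phi> t ` B = B)"

definition positively_invariant ::
  "(real^'n::finite) set \<Rightarrow> (real^'n \<Rightarrow> real set) \<Rightarrow> (real \<Rightarrow> real^'n \<Rightarrow> real^'n) \<Rightarrow> (real^'n) set \<Rightarrow> bool" where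
  "positively_invariant U I \<phi> B \<longleftrightarrow> B \<subseteq> U \<and> (\<forall>\<xi>\<in>B. {0..} \<subseteq> I \<xi>) \<and> (\<forall>t\<ge>0. \<phi> t ` B \<subseteq> B)"

definition negatively_invariant ::
  "(real^'n::finite) set \<Rightarrow> (real^'n \<Rightarrow> real set) \<Rightarrow> (real \<Rightarrow> real^'n \<Rightarrow> real^'n) \<Rightarrow> (real^'n) set \<Rightarrow> bool" where
  "negatively_invariant U I \<phi> B \<longleftrightarrow> B \<subseteq> U \<and> (\<forall>\<xi>\<in>B. {..0} \<subseteq> I \<xi>) \<and> (\<forall>t\<le>0. \<phi> t ` B \<subseteq> B)"

text \<open>The closures are taken in the whole space, which agrees with the closure in \<open>U\<close> for
  orbits that are pre-compact in \<open>U\<close>.\<close>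

definition omega_limit :: "(real \<Rightarrow> real^'n::finite \<Rightarrow> real^'n) \<Rightarrow> (real^'n) set \<Rightarrow> (real^'n) set" where
  "omega_limit \<phi> B = (\<Inter>\<tau>\<in>{0..}. closure (\<Union>t\<in>{\<tau>..}. \<phi> t ` B))"

definition alpha_limit :: "(real \<Rightarrow> real^'n::finite \<Rightarrow> real^'n) \<Rightarrow> (real^'n) set \<Rightarrow> (real^'n) set" where
  "alpha_limit \<phi> B = (\<Inter>\<tau>\<in>{..0}. closure (\<Union>t\<in>{..\<tau>}. \<phi> t ` B))"

section \<open>Lyapunov functions\<close>

text \<open>The last conjunct is the convergence of \<open>f x\<close> to the supremum as \<open>x\<close> leaves every compact
  subset of \<open>\<Omega>\<close>.\<close>

definition compact_function :: "(real^'n::finite) set \<Rightarrow> (real^'n \<Rightarrow> real) \<Rightarrow> bool" where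
  "compact_function \<Omega> f \<longleftrightarrow> continuous_on \<Omega> f \<and> (\<forall>x\<in>\<Omega>. 0 \<le> f x) \<and>
     (let \<rho> = (SUP x\<in>\<Omega>. ereal (f x)) in
        0 < \<rho> \<and> (\<forall>x\<in>\<Omega>. ereal (f x) < \<rho>) \<and>
        (\<forall>c<\<rho>. \<exists>K. compact K \<and> K \<subseteq> \<Omega> \<and> (\<forall>x\<in>\<Omega> - K. c < ereal (f x))))"

definition entire_weak_Lyapunov ::
  "(real^'n::finite) set \<Rightarrow> (real^'n \<Rightarrow> real^'n) \<Rightarrow> (real^'n \<Rightarrow> real) \<Rightarrow> bool" where
  "entire_weak_Lyapunov \<Omega> V f \<longleftrightarrow>
     compact_function \<Omega> f \<and> Ck_on 1 \<Omega> f \<and> (\<forall>x\<in>\<Omega>. V x \<bullet> grad f x \<le> 0)"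

definition entire_weak_anti_Lyapunov ::
  "(real^'n::finite) set \<Rightarrow> (real^'n \<Rightarrow> real^'n) \<Rightarrow> (real^'n \<Rightarrow> real) \<Rightarrow> bool" where
  "entire_weak_anti_Lyapunov \<Omega> V f \<longleftrightarrow>
     compact_function \<Omega> f \<and> Ck_on 1 \<Omega> f \<and> (\<forall>x\<in>\<Omega>. V x \<bullet> grad f x \<ge> 0)"

section \<open>Strong local attractors and repellers\<close>

definition neighborhood_in :: "(real^'n::finite) set \<Rightarrow> (real^'n) set \<Rightarrow> (real^'n) set \<Rightarrow> bool" where
  "neighborhood_in U E W \<longleftrightarrow> W \<subseteq> U \<and> (\<exists>N. open N \<and> E \<subseteq> N \<and> N \<subseteq> W)"

definition precompact_in :: "(real^'n::finite) set \<Rightarrow> (real^'n) set \<Rightarrow> bool" where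
  "precompact_in U W \<longleftrightarrow> compact (closure W) \<and> closure W \<subseteq> U"

text \<open>Near a boundary point \<open>x\<close>, \<open>W\<close> lies on one side of its boundary, a regular level set of a
  \<open>C\<^sup>2\<close> function \<open>g\<close>. Phrasing this through the interior and the frontier leaves open whether \<open>W\<close>
  contains its boundary points. The normalized gradient of \<open>g\<close> is the outward unit normal and
  does not depend on \<open>g\<close>.\<close>

definition boundary_chart ::
  "(real^'n::finite) set \<Rightarrow> real^'n \<Rightarrow> (real^'n) set \<Rightarrow> (real^'n \<Rightarrow> real) \<Rightarrow> bool" where
  "boundary_chart W x N g \<longleftrightarrow> open N \<and> x \<in> N \<and> Ck_on 2 N g \<and> (\<forall>y\<in>N. grad g y \<noteq> 0) \<and>
     interior W \<inter> N = {y\<in>N. g y < 0} \<and> frontier W \<inter> N = {y\<in>N. g y = 0}"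

definition oriented_C2_boundary :: "(real^'n::finite) set \<Rightarrow> bool" where
  "oriented_C2_boundary W \<longleftrightarrow> (\<forall>x\<in>frontier W. \<exists>N g. boundary_chart W x N g)"

definition outward_unit_normal :: "(real^'n::finite) set \<Rightarrow> real^'n \<Rightarrow> real^'n \<Rightarrow> bool" where
  "outward_unit_normal W x \<nu> \<longleftrightarrow> (\<exists>N g. boundary_chart W x N g \<and> \<nu> = grad g x /\<^sub>R norm (grad g x))"

definition strong_local_attractor ::
  "(real^'n::finite) set \<Rightarrow> (real^'n \<Rightarrow> real^'n) \<Rightarrow> (real^'n \<Rightarrow> real set) \<Rightarrow>
   (real \<Rightarrow> real^'n \<Rightarrow> real^'n) \<Rightarrow> (real^'n) set \<Rightarrow> bool" where
  "strong_local_attractor U V I \<phi> E \<longleftrightarrow> compact E \<and> invariant_set U I \<phi> E \<and>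
     (\<exists>W. neighborhood_in U E W \<and> connected W \<and> positively_invariant U I \<phi> W \<and>
        precompact_in U W \<and> oriented_C2_boundary W \<and> omega_limit \<phi> W \<subseteq> E \<and>
        (\<forall>x\<in>frontier W. \<forall>\<nu>. outward_unit_normal W x \<nu> \<longrightarrow> V x \<bullet> \<nu> < 0))"

definition strong_local_repeller ::
  "(real^'n::finite) set \<Rightarrow> (real^'n \<Rightarrow> real^'n) \<Rightarrow> (real^'n \<Rightarrow> real set) \<Rightarrow>
   (real \<Rightarrow> real^'n \<Rightarrow> real^'n) \<Rightarrow> (real^'n) set \<Rightarrow> bool" where
  "strong_local_repeller U V I \<phi> E \<longleftrightarrow> compact E \<and> invariant_set U I \<phi> E \<and>
     (\<exists>W. neighborhood_in U E W \<and> connected W \<and> negatively_invariant U I \<phi> W \<and>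
        precompact_in U W \<and> oriented_C2_boundary W \<and> alpha_limit \<phi> W \<subseteq> E \<and>
        (\<forall>x\<in>frontier W. \<forall>\<nu>. outward_unit_normal W x \<nu> \<longrightarrow> V x \<bullet> \<nu> > 0))"

end

theory Submission
  imports Defs
begin

text \<open>
  A limit measure \<open>\<mu>\<close> is a weak limit of stationary measures of generators whose diffusion matrices tend to \<open>0\<close> in
  \<open>W\<^sup>1\<^sup>,\<^sup>p\<close> on compact sets. Since \<open>p\<close> exceeds the dimension, Morrey's inequality (\<open>morrey_sup_bound\<close>) turns
  this into locally uniform convergence. The second-order terms therefore disappear from the stationarity identity,
  and what remains is that \<open>V \<bullet> grad f\<close> has \<open>\<mu>\<close>-integral \<open>0\<close> for every test function \<open>f\<close>
  (\<open>limit_measure_drift_stationary\<close>). All three assertions are consequences of this property of \<open>\<mu>\<close> alone.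

  The identity extends, by mollification, to Lipschitz functions with compact support that have a continuous
  derivative along \<open>V\<close> (\<open>integral_directional_derivative_eq_0\<close>). Such functions arise by integrating a Lipschitz
  function \<open>\<theta>\<close> along orbits up to time \<open>T\<close>: the derivative along \<open>V\<close> is \<open>\<theta> \<circ> \<phi> T - \<theta>\<close>
  (\<open>orbit_integral_derivative\<close>), and the Lipschitz bound is Gronwall's inequality. Each assertion results from a
  suitable choice of the function.

  Invariance: if \<open>\<theta>\<close> has compact support and the flow is complete, the orbit integral has compact support as well,
  and the identity says that \<open>\<theta> \<circ> \<phi> T\<close> and \<open>\<theta>\<close> have the same integral.

  LaSalle principle: composing the Lyapunov function with a nonincreasing function that is \<open>0\<close> above a level gives
  a function with compact support, whose derivative along \<open>V\<close> has a constant sign. As the integral of the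
  derivative is \<open>0\<close>, the derivative vanishes on the support of \<open>\<mu>\<close>.

  Attractors: the weighted time that an orbit spends near the attractor is a Lyapunov function there, nondecreasing
  along \<open>V\<close>. Cut off at a level that is only exceeded well inside the basin, it gives a compactly supported function
  with nonnegative derivative along \<open>V\<close>. That derivative is zero almost everywhere, which leaves no mass near the
  attractor but off it. A repeller is an attractor in reversed time.
\<close>

section \<open>Smooth functions\<close>

definition smooth :: "(real^'n::finite \<Rightarrow> real) \<Rightarrow> bool" where
  "smooth f \<longleftrightarrow> (\<forall>k. Ck_on k UNIV f)"

lemma partial_deriv_eqI:
  assumes "(f has_derivative f') (at x)"
  shows "partial_deriv i f x = f' (axis i 1)"
  using frechet_derivative_at[OF assms] by (simp add: partial_deriv_def)

lemma has_derivative_grad: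
  fixes f :: "real^'n::finite \<Rightarrow> real"
  assumes "f differentiable (at x)"
  shows "(f has_derivative (\<lambda>h. h \<bullet> grad f x)) (at x)"
proof -
  let ?D = "frechet_derivative f (at x)"
  have D: "(f has_derivative ?D) (at x)" using assms frechet_derivative_works by blast
  then have lin: "linear ?D" using has_derivative_bounded_linear bounded_linear.linear by blast
  have "?D h = h \<bullet> grad f x" for h
  proof -
    have "?D h = ?D (\<Sum>i\<in>UNIV. (h $ i) *\<^sub>R axis i 1)"
      using basis_expansion[of h] by (simp add: scalar_mult_eq_scaleR)
    also have "\<dots> = (\<Sum>i\<in>UNIV. (h $ i) * ?D (axis i 1))"
      by (simp add: linear_sum[OF lin] linear_cmul[OF lin])
    finally show ?thesis by (simp add: inner_vec_def grad_def partial_deriv_def)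
  qed
  then have "?D = (\<lambda>h. h \<bullet> grad f x)" by blast
  then show ?thesis using D by metis
qed

lemma Ck_on_continuous: "Ck_on k S f \<Longrightarrow> continuous_on S f"
  by (cases k) (auto intro!: continuous_at_imp_continuous_on differentiable_imp_continuous_within)

lemma Ck_on_Suc_imp: "Ck_on (Suc k) S f \<Longrightarrow> Ck_on k S f"
proof (induction k arbitrary: f)
  case 0 then show ?case using Ck_on_continuous by fastforce
next
  case (Suc k) then show ?case by (metis Ck_on.simps(2))
qed

lemma smooth_differentiable: "smooth f \<Longrightarrow> f differentiable (at x)"
  unfolding smooth_def by (metis Ck_on.simps(2) UNIV_I)

lemma smooth_partial_deriv: "smooth f \<Longrightarrow> smooth (partial_deriv i f)"
  unfolding smooth_def by (metis Ck_on.simps(2))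

lemma smooth_continuous: "smooth f \<Longrightarrow> continuous_on S f"
  unfolding smooth_def using Ck_on.simps(1) continuous_on_subset by blast

lemma smooth_grad_continuous: "smooth f \<Longrightarrow> continuous_on S (grad f)"
  unfolding grad_def
  by (intro continuous_on_vec_lambda smooth_continuous smooth_partial_deriv)

lemma Ck_on_const: "Ck_on k UNIV (\<lambda>x. c)"
proof (induction k arbitrary: c)
  case (Suc k)
  have "partial_deriv i (\<lambda>x. c) = (\<lambda>x. 0)" for i :: 'a
    by (rule ext, subst partial_deriv_eqI[where f'="\<lambda>h. 0"]) auto
  with Suc show ?case by auto
qed auto

lemma Ck_on_nth: "Ck_on k UNIV (\<lambda>x::real^'n::finite. x $ j)"
proof (cases k)
  case (Suc k)
  have "partial_deriv i (\<lambda>x. x $ j) = (\<lambda>x. axis i 1 $ j)" for i :: 'n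
    by (rule ext, rule partial_deriv_eqI) (auto intro!: derivative_eq_intros bounded_linear_imp_has_derivative bounded_linear_vec_nth)
  then show ?thesis
    using Suc by (auto simp: Ck_on_const bounded_linear_imp_differentiable bounded_linear_vec_nth)
qed (auto intro!: continuous_intros)

lemma partial_deriv_add:
  assumes "f differentiable (at x)" "g differentiable (at x)"
  shows "partial_deriv i (\<lambda>x. f x + g x) x = partial_deriv i f x + partial_deriv i g x"
proof -
  have "(f has_derivative frechet_derivative f (at x)) (at x)"
       "(g has_derivative frechet_derivative g (at x)) (at x)"
    using assms frechet_derivative_works by blast+
  from has_derivative_add[OF this] show ?thesis
    by (subst partial_deriv_eqI) (auto simp: partial_deriv_def)
qed

lemma partial_deriv_mult:
  fixes f g :: "real^'n::finite \<Rightarrow> real"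
  assumes "f differentiable (at x)" "g differentiable (at x)"
  shows "partial_deriv i (\<lambda>x. f x * g x) x = f x * partial_deriv i g x + partial_deriv i f x * g x"
proof -
  have "(f has_derivative frechet_derivative f (at x)) (at x)"
       "(g has_derivative frechet_derivative g (at x)) (at x)"
    using assms frechet_derivative_works by blast+
  from has_derivative_mult[OF this] show ?thesis
    by (subst partial_deriv_eqI) (auto simp: partial_deriv_def)
qed

lemma Ck_on_add: "Ck_on k UNIV f \<Longrightarrow> Ck_on k UNIV g \<Longrightarrow> Ck_on k UNIV (\<lambda>x. f x + g x)"
proof (induction k arbitrary: f g)
  case 0 then show ?case by (auto intro: continuous_intros)
next
  case (Suc k)
  then have "partial_deriv i (\<lambda>x. f x + g x) = (\<lambda>x. partial_deriv i f x + partial_deriv i g x)" for i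
    by (auto intro!: ext partial_deriv_add)
  with Suc show ?case by (auto intro: differentiable_add)
qed

lemma Ck_on_mult:
  fixes f g :: "real^'n::finite \<Rightarrow> real"
  shows "Ck_on k UNIV f \<Longrightarrow> Ck_on k UNIV g \<Longrightarrow> Ck_on k UNIV (\<lambda>x. f x * g x)"
proof (induction k arbitrary: f g)
  case 0 then show ?case by (auto intro: continuous_intros)
next
  case (Suc k)
  then have eq: "partial_deriv i (\<lambda>x. f x * g x) = (\<lambda>x. f x * partial_deriv i g x + partial_deriv i f x * g x)" for i
    by (auto intro!: ext partial_deriv_mult)
  have "Ck_on k UNIV f" "Ck_on k UNIV g" using Suc.prems Ck_on_Suc_imp by blast+
  then have "Ck_on k UNIV (\<lambda>x. f x * partial_deriv i g x + partial_deriv i f x * g x)" for i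
    using Suc.prems by (intro Ck_on_add Suc.IH) simp_all
  then show ?case using Suc.prems unfolding Ck_on.simps eq by (blast intro: differentiable_mult)
qed

lemma smooth_const: "smooth (\<lambda>x. c)"
  and smooth_nth: "smooth (\<lambda>x. x $ j)"
  by (auto simp: smooth_def Ck_on_const Ck_on_nth)

lemma smooth_add: "smooth f \<Longrightarrow> smooth g \<Longrightarrow> smooth (\<lambda>x. f x + g x)"
  and smooth_mult: "smooth f \<Longrightarrow> smooth g \<Longrightarrow> smooth (\<lambda>x. f x * g x)"
  by (auto simp: smooth_def Ck_on_add Ck_on_mult)

lemma smooth_cmult: "smooth f \<Longrightarrow> smooth (\<lambda>x. c * f x)"
  by (intro smooth_mult smooth_const)

lemma smooth_diff: "smooth f \<Longrightarrow> smooth g \<Longrightarrow> smooth (\<lambda>x. f x - g x)"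
  using smooth_add[of f "\<lambda>x. (-1) * g x"] smooth_cmult[of g "-1"] by simp

lemma smooth_sum: "(\<And>i. i \<in> A \<Longrightarrow> smooth (f i)) \<Longrightarrow> smooth (\<lambda>x. \<Sum>i\<in>A. f i x)"
  by (induction A rule: infinite_finite_induct) (auto intro: smooth_const smooth_add)

lemma smooth_prod: "(\<And>i. i \<in> A \<Longrightarrow> smooth (f i)) \<Longrightarrow> smooth (\<lambda>x. \<Prod>i\<in>A. f i x)"
  by (induction A rule: infinite_finite_induct) (auto intro: smooth_const smooth_mult)

lemmas smooth_intros = smooth_const smooth_nth smooth_add smooth_diff smooth_mult smooth_sum smooth_prod

text \<open>The functions \<open>x\<^sup>-\<^sup>m e\<^sup>-\<^sup>1\<^sup>/\<^sup>x\<close> on \<open>x > 0\<close>. The derivative of each is a linear combination of two others, so the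
  smoothness of all of them comes from one induction on the order, general in \<open>m\<close>.\<close>

definition expinv :: "nat \<Rightarrow> real \<Rightarrow> real" where
  "expinv m x = (if x > 0 then exp (- 1 / x) / x ^ m else 0)"

lemma expinv_nonneg: "0 \<le> expinv m x" by (simp add: expinv_def)

lemma expinv_0_pos: "x > 0 \<Longrightarrow> 0 < expinv 0 x" by (simp add: expinv_def)
lemma expinv_0_le_1: "expinv 0 x \<le> 1" by (simp add: expinv_def)

text \<open>A single term of the exponential series at \<open>1 / x\<close> beats the pole of order \<open>m\<close> by two further powers of
  \<open>x\<close>. The quadratic bound is what makes the derivative at the origin vanish.\<close>

lemma expinv_le: "expinv m x \<le> fact (m + 2) * x\<^sup>2"
proof (cases "x > 0")
  case True
  have "(1 / x) ^ (m + 2) / fact (m + 2) \<le> exp (1 / x)"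
  proof -
    have "(\<lambda>n. (1 / x) ^ n /\<^sub>R fact n) sums exp (1 / x)" by (rule exp_converges)
    then have "sum (\<lambda>n. (1 / x) ^ n /\<^sub>R fact n) {m + 2} \<le> exp (1 / x)"
      unfolding sums_iff using True sum_le_suminf[of "\<lambda>n. (1 / x) ^ n /\<^sub>R fact n" "{m + 2}"] by simp
    then show ?thesis by (simp add: divide_inverse mult.commute)
  qed
  then have le: "(1 / x) ^ (m + 2) \<le> c * exp (1 / x)" if "c = fact (m + 2)" for c
    using that pos_divide_le_eq[of "fact (m + 2)" "(1 / x) ^ (m + 2)" "exp (1 / x)"]
    by (metis fact_gt_zero mult.commute)
  define c :: real where "c = fact (m + 2)"
  have "expinv m x = exp (- (1 / x)) * (1 / x) ^ (m + 2) * x\<^sup>2"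
    using True by (simp add: expinv_def power_add power_divide power2_eq_square)
  also have "\<dots> \<le> exp (- (1 / x)) * (c * exp (1 / x)) * x\<^sup>2"
    by (intro mult_right_mono mult_left_mono le c_def) auto
  also have "\<dots> = c * x\<^sup>2" by (simp add: exp_minus)
  finally show ?thesis by (simp add: c_def)
qed (auto simp: expinv_def)

lemma expinv_has_derivative:
  "(expinv m has_real_derivative (expinv (m + 2) x - m * expinv (m + 1) x)) (at x)"
proof -
  consider "x < 0" | "x > 0" | "x = 0" by linarith
  then show ?thesis
  proof cases
    case 1
    have "((\<lambda>x. 0) has_real_derivative 0) (at x)" by simp
    then have "(expinv m has_real_derivative 0) (at x)"
      by (rule has_field_derivative_transform_within_open[of _ _ _ "{..<0}"])
         (use 1 in \<open>auto simp: expinv_def\<close>)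
    then show ?thesis using 1 by (simp add: expinv_def)
  next
    case 2
    have "((\<lambda>x. exp (- 1 / x)) has_real_derivative exp (-1/x) / x^2) (at x)"
      using 2 by (auto intro!: derivative_eq_intros simp: power2_eq_square)
    moreover have "((\<lambda>x. x ^ m) has_real_derivative (m * x ^ (m - 1))) (at x)"
      using DERIV_pow[of m x UNIV] by simp
    ultimately have "((\<lambda>x. exp (- 1 / x) / x ^ m) has_real_derivative
        ((exp (-1/x) / x^2 * x ^ m - exp (-1/x) * (m * x ^ (m - 1))) / (x ^ m * x ^ m))) (at x)"
      by (rule DERIV_divide) (use 2 in auto)
    also have "(exp (-1/x) / x^2 * x ^ m - exp (-1/x) * (m * x ^ (m - 1))) / (x ^ m * x ^ m)
       = exp (-1/x) / x^(m+2) - m * (exp (-1/x) / x^(m+1))"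
      using 2 by (cases m) (simp_all add: divide_simps power2_eq_square, simp add: algebra_simps)
    finally have "(expinv m has_real_derivative (exp (-1/x) / x^(m+2) - m * (exp (-1/x) / x^(m+1)))) (at x)"
      by (rule has_field_derivative_transform_within_open[of _ _ _ "{0<..}"])
         (use 2 in \<open>auto simp: expinv_def\<close>)
    then show ?thesis using 2 by (simp add: expinv_def)
  next
    case 3
    have "((\<lambda>h. (expinv m (0 + h) - expinv m 0) / h) \<longlongrightarrow> 0) (at 0)"
    proof (rule Lim_null_comparison)
      show "\<forall>\<^sub>F h in at 0. norm ((expinv m (0 + h) - expinv m 0) / h) \<le> fact (m + 2) * \<bar>h\<bar>"
        using expinv_le[of m] expinv_nonneg[of m]
        by (auto simp: eventually_at_filter expinv_def[of m 0] abs_mult divide_simps power2_eq_square mult.assoc)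
      show "((\<lambda>h::real. fact (m + 2) * \<bar>h\<bar>) \<longlongrightarrow> 0) (at 0)"
        by (intro tendsto_eq_intros) auto
    qed
    then show ?thesis using 3 by (simp add: DERIV_def expinv_def)
  qed
qed

lemma Ck_on_expinv:
  fixes g :: "real^'n::finite \<Rightarrow> real"
  assumes "smooth g"
  shows "Ck_on k UNIV (\<lambda>x. expinv m (g x))"
proof (induction k arbitrary: m)
  case 0
  have "continuous_on UNIV (expinv m)"
    using expinv_has_derivative DERIV_isCont continuous_at_imp_continuous_on by blast
  from continuous_on_compose2[OF this smooth_continuous[OF assms]] show ?case by simp
next
  case (Suc k)
  have d: "((\<lambda>x. expinv m (g x)) has_derivative
      (\<lambda>h. (expinv (m + 2) (g x) - m * expinv (m + 1) (g x)) * frechet_derivative g (at x) h)) (at x)" for x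
    using smooth_differentiable[OF assms, of x] frechet_derivative_works
      DERIV_compose_FDERIV[OF expinv_has_derivative] by (fastforce simp: mult.commute)
  have eq: "partial_deriv i (\<lambda>x. expinv m (g x)) =
    (\<lambda>x. (expinv (m + 2) (g x) + (- real m) * expinv (m + 1) (g x)) * partial_deriv i g x)" for i
    by (rule ext, subst partial_deriv_eqI[OF d]) (simp add: partial_deriv_def)
  have "Ck_on k UNIV (partial_deriv i g)" for i
    using smooth_partial_deriv[OF assms] smooth_def by blast
  then have "Ck_on k UNIV (\<lambda>x. (expinv (m + 2) (g x) + (- real m) * expinv (m + 1) (g x)) * partial_deriv i g x)" for i
    by (intro Ck_on_mult Ck_on_add Suc Ck_on_const)
  then show ?case unfolding Ck_on.simps eq using d differentiable_def by blast
qed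

lemma smooth_expinv: "smooth g \<Longrightarrow> smooth (\<lambda>x. expinv m (g x))"
  by (simp add: smooth_def Ck_on_expinv[unfolded smooth_def])

lemma smooth_norm_sq: "smooth (\<lambda>x::real^'n::finite. (norm (x - a))\<^sup>2)"
proof -
  have "smooth (\<lambda>x::real^'n. \<Sum>i\<in>UNIV. (x $ i - a $ i) * (x $ i - a $ i))"
    by (intro smooth_intros)
  then show ?thesis by (simp add: power2_norm_eq_inner inner_vec_def)
qed

lemma test_functionsI:
  assumes "smooth f" "compact K" "K \<subseteq> U" "\<And>x. x \<notin> K \<Longrightarrow> f x = 0"
  shows "f \<in> test_functions U"
proof -
  have "closure {x. f x \<noteq> 0} \<subseteq> K"
    using assms by (intro closure_minimal compact_imp_closed) auto
  moreover from this have "compact (closure {x. f x \<noteq> 0})"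
    using assms(2) by (metis closed_closure compact_Int_closed inf.absorb_iff2)
  ultimately show ?thesis using assms by (auto simp: test_functions_def smooth_def)
qed

section \<open>Convolution and bump functions\<close>

lemma integrable_on_lborel_compact_support:
  fixes f :: "real^'n::finite \<Rightarrow> real"
  assumes "continuous_on UNIV f" "compact K" "\<And>x. x \<notin> K \<Longrightarrow> f x = 0"
  shows "integrable lborel f"
proof -
  have "integrable lborel (\<lambda>x. indicator K x *\<^sub>R f x)"
    using borel_integrable_compact[OF assms(2) continuous_on_subset[OF assms(1)]] by simp
  moreover have "(\<lambda>x. indicator K x *\<^sub>R f x) = f"
    using assms(3) by (intro ext) (auto simp: indicator_def)
  ultimately show ?thesis by simp
qed

lemma lborel_integral_eq_integral_cbox:
  fixes f :: "real^'n::finite \<Rightarrow> real"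
  assumes "continuous_on UNIV f" "\<And>x. x \<notin> cbox a b \<Longrightarrow> f x = 0"
  shows "integral\<^sup>L lborel f = integral (cbox a b) f"
proof -
  have "integrable lborel f"
    by (rule integrable_on_lborel_compact_support[OF assms(1) compact_cbox assms(2)])
  then have "(f has_integral integral\<^sup>L lborel f) UNIV" by (rule has_integral_integral_lborel)
  then have "((\<lambda>x. if x \<in> cbox a b then f x else 0) has_integral integral\<^sup>L lborel f) UNIV"
    by (rule has_integral_eq[rotated]) (use assms(2) in auto)
  then show ?thesis using has_integral_restrict_UNIV[of "cbox a b" f] by (auto dest: integral_unique)
qed

text \<open>The derivative falls on the smooth factor \<open>g\<close> alone, so continuity of \<open>f\<close> is enough, and the argument can be
  repeated for all partial derivatives of \<open>g\<close>.\<close>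

lemma has_derivative_convolution:
  fixes f g :: "real^'n::finite \<Rightarrow> real"
  assumes f: "continuous_on UNIV f" and g: "smooth g"
  shows "((\<lambda>x. integral (cbox a b) (\<lambda>y. f y * g (x - y))) has_derivative
     (\<lambda>h. integral (cbox a b) (\<lambda>y. f y * (h \<bullet> grad g (x - y))))) (at x)"
proof -
  let ?D = "\<lambda>x y. f y *\<^sub>R blinfun_inner_left (grad g (x - y))"
  have gc: "continuous_on S g" "continuous_on S (grad g)" for S
    using g by (rule smooth_continuous smooth_grad_continuous)+
  have contD: "continuous_on T (\<lambda>(x, y). ?D x y)" for T
    unfolding split_beta
    by (intro continuous_intros bounded_linear.continuous_on[OF bounded_linear_blinfun_inner_left]
        continuous_on_compose2[OF gc(2)[of UNIV]] continuous_on_compose2[OF f]) auto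
  have "((\<lambda>x. integral (cbox a b) (\<lambda>y. f y * g (x - y))) has_derivative
      integral (cbox a b) (?D x)) (at x within UNIV)"
  proof (rule leibniz_rule)
    fix x y :: "real^'n"
    have "((\<lambda>x. g (x - y)) has_derivative (\<lambda>h. h \<bullet> grad g (x - y))) (at x)"
      using has_derivative_compose[OF _ has_derivative_grad[OF smooth_differentiable[OF g]],
          of "\<lambda>x. x - y" "\<lambda>h. h" x UNIV] has_derivative_diff[OF has_derivative_ident has_derivative_const]
      by force
    note has_derivative_mult_right[OF this, of "f y"]
    moreover have "blinfun_apply (?D x y) = (\<lambda>h. f y * (h \<bullet> grad g (x - y)))"
      by (simp add: fun_eq_iff blinfun.scaleR_left)
    ultimately show "((\<lambda>x. f y * g (x - y)) has_derivative blinfun_apply (?D x y)) (at x within UNIV)"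
      by simp
  next
    fix x
    show "(\<lambda>y. f y * g (x - y)) integrable_on cbox a b"
      by (intro integrable_continuous continuous_intros continuous_on_subset[OF f]
         continuous_on_compose2[OF gc(1)[of UNIV]]) auto
    show "continuous_on (UNIV \<times> cbox a b) (\<lambda>(x, y). ?D x y)" by (rule contD)
  qed simp_all
  moreover have "blinfun_apply (integral (cbox a b) (?D x)) =
      (\<lambda>h. integral (cbox a b) (\<lambda>y. f y * (h \<bullet> grad g (x - y))))"
  proof
    fix h
    have "continuous_on (cbox a b) (?D x)"
      by (intro continuous_intros bounded_linear.continuous_on[OF bounded_linear_blinfun_inner_left]
        continuous_on_compose2[OF gc(2)[of UNIV]] continuous_on_subset[OF f]) auto
    then have int: "?D x integrable_on cbox a b" by (rule integrable_continuous)
    show "blinfun_apply (integral (cbox a b) (?D x)) h =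
      integral (cbox a b) (\<lambda>y. f y * (h \<bullet> grad g (x - y)))"
      using integral_linear[OF int, of "\<lambda>D. blinfun_apply D h"]
      by (simp add: o_def blinfun.scaleR_left blinfun.bounded_linear_left)
  qed
  ultimately show ?thesis by simp
qed

lemma smooth_convolution:
  fixes f g :: "real^'n::finite \<Rightarrow> real"
  assumes f: "continuous_on UNIV f" and g: "smooth g"
  shows "smooth (\<lambda>x. integral (cbox a b) (\<lambda>y. f y * g (x - y)))"
proof -
  have "Ck_on k UNIV (\<lambda>x. integral (cbox a b) (\<lambda>y. f y * g (x - y)))" if "smooth g" for k and g :: "real^'n \<Rightarrow> real"
    using that
  proof (induction k arbitrary: g)
    case 0
    show ?case using has_derivative_convolution[OF f 0]
      by (auto intro!: continuous_at_imp_continuous_on has_derivative_continuous)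
  next
    case (Suc k)
    have "partial_deriv i (\<lambda>x. integral (cbox a b) (\<lambda>y. f y * g (x - y))) =
       (\<lambda>x. integral (cbox a b) (\<lambda>y. f y * partial_deriv i g (x - y)))" for i
      by (rule ext, subst partial_deriv_eqI[OF has_derivative_convolution[OF f Suc.prems]])
         (simp add: inner_axis' grad_def)
    moreover have "(\<lambda>x. integral (cbox a b) (\<lambda>y. f y * g (x - y))) differentiable (at x)" for x
      using has_derivative_convolution[OF f Suc.prems] unfolding differentiable_def by blast
    ultimately show ?case using Suc smooth_partial_deriv[OF Suc.prems] by auto
  qed
  then show ?thesis using g by (simp add: smooth_def)
qed

text \<open>Supported in the ball of radius \<open>e\<close> and not normalized: as \<open>e\<close> enters only through \<open>z / e\<close>, the integral
  scales like the volume of that ball.\<close>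

definition bump :: "real \<Rightarrow> real^'n::finite \<Rightarrow> real" where
  "bump e z = expinv 0 (1 - (norm z)\<^sup>2 / e\<^sup>2)"

lemma smooth_bump: "smooth (bump e)"
proof -
  have "smooth (\<lambda>z. 1 - (1 / e\<^sup>2) * (norm (z - 0))\<^sup>2)"
    by (intro smooth_intros smooth_norm_sq)
  from smooth_expinv[OF this, of 0] show ?thesis by (simp add: bump_def[abs_def])
qed

lemma bump_nonneg: "0 \<le> bump e z" by (simp add: bump_def expinv_nonneg)
lemma bump_le_1: "bump e z \<le> 1" by (simp add: bump_def expinv_0_le_1)

lemma bump_eq_0: "e > 0 \<Longrightarrow> norm z \<ge> e \<Longrightarrow> bump e z = 0"
  using power_mono[of e "norm z" 2] by (auto simp: bump_def expinv_def not_less)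

lemma bump_pos:
  assumes "norm z < e" shows "0 < bump e z"
proof -
  have "(norm z)\<^sup>2 < e\<^sup>2" by (rule power_strict_mono[OF assms]) auto
  moreover have "0 < e\<^sup>2" using assms norm_ge_zero[of z] by (intro zero_less_power) linarith
  ultimately have "(norm z)\<^sup>2 / e\<^sup>2 < 1" by simp
  then show ?thesis unfolding bump_def by (intro expinv_0_pos) simp
qed

lemma continuous_on_bump: "continuous_on S (bump e)"
  by (intro smooth_continuous smooth_bump)

lemma integrable_bump:
  assumes "e > 0" shows "integrable lborel (bump e)"
  by (rule integrable_on_lborel_compact_support[of _ "cball 0 e"])
     (use assms in \<open>auto simp: continuous_on_bump dist_norm intro!: bump_eq_0\<close>)

lemma integral_bump_pos:
  assumes e: "e > 0" shows "0 < integral\<^sup>L lborel (bump e :: real^'n::finite \<Rightarrow> real)"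
proof -
  have "integral\<^sup>L lborel (bump e :: real^'n \<Rightarrow> real) \<noteq> 0"
  proof
    assume "integral\<^sup>L lborel (bump e :: real^'n \<Rightarrow> real) = 0"
    then have "AE x in lborel. bump e (x :: real^'n) = 0"
      using integral_nonneg_eq_0_iff_AE[OF integrable_bump[OF e]] bump_nonneg by blast
    then have "AE x in lborel. (x :: real^'n) \<notin> ball 0 e"
    proof (rule AE_mp, intro AE_I2 impI)
      fix x :: "real^'n" assume "bump e x = 0"
      then show "x \<notin> ball 0 e" using bump_pos[of x e] by (auto simp: dist_norm)
    qed
    then have "ball (0::real^'n) e \<in> null_sets lborel"
      using AE_iff_null_sets[of "ball (0::real^'n) e" lborel] by simp
    then have "measure lborel (ball (0::real^'n) e) = 0"
      by (simp add: measure_def null_setsD1)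
    then show False using content_ball_pos[OF e, of "0::real^'n"] by linarith
  qed
  moreover have "0 \<le> integral\<^sup>L lborel (bump e :: real^'n \<Rightarrow> real)"
    by (intro Bochner_Integration.integral_nonneg bump_nonneg)
  ultimately show ?thesis by linarith
qed

lemma integral_bump_scale:
  assumes "e > 0"
  shows "integral\<^sup>L lborel (bump e :: real^'n::finite \<Rightarrow> real) = e ^ CARD('n) * integral\<^sup>L lborel (bump 1 :: real^'n \<Rightarrow> real)"
proof -
  have bump1: "bump e (0 + e *\<^sub>R x) = bump 1 x" for x :: "real^'n"
    using assms by (simp add: bump_def power_mult_distrib)
  have [measurable]: "(bump e :: real^'n \<Rightarrow> real) \<in> borel_measurable borel"
    by (intro borel_measurable_continuous_onI continuous_on_bump)
  have eq: "(lborel :: (real^'n) measure) =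
      density (distr lborel borel (\<lambda>x. 0 + e *\<^sub>R x)) (\<lambda>_. ennreal (e ^ CARD('n)))"
    using lborel_affine[of e "0::real^'n"] assms by simp
  have "integral\<^sup>L lborel (bump e :: real^'n \<Rightarrow> real) =
     integral\<^sup>L (density (distr lborel borel (\<lambda>x. 0 + e *\<^sub>R x)) (\<lambda>_. ennreal (e ^ CARD('n)))) (bump e :: real^'n \<Rightarrow> real)"
    by (rule arg_cong[OF eq])
  also have "\<dots> = integral\<^sup>L (distr lborel borel (\<lambda>x. 0 + e *\<^sub>R x)) (\<lambda>x :: real^'n. e ^ CARD('n) *\<^sub>R bump e x)"
    by (rule integral_density) (use assms in auto)
  also have "\<dots> = integral\<^sup>L lborel (\<lambda>x :: real^'n. e ^ CARD('n) *\<^sub>R bump e (0 + e *\<^sub>R x))"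
    by (rule integral_distr) auto
  also have "\<dots> = e ^ CARD('n) * integral\<^sup>L lborel (bump 1 :: real^'n \<Rightarrow> real)"
    unfolding bump1 by simp
  finally show ?thesis .
qed

lemma lborel_integral_reflect_shift:
  fixes g :: "real^'n::finite \<Rightarrow> real"
  assumes [measurable]: "g \<in> borel_measurable borel"
  shows "integral\<^sup>L lborel (\<lambda>y. g (x - y)) = integral\<^sup>L lborel g"
proof -
  have eq: "(lborel :: (real^'n) measure) = density (distr lborel borel (\<lambda>y. x + (-1) *\<^sub>R y)) (\<lambda>_. ennreal 1)"
    using lborel_affine[of "-1" x] by simp
  have "integral\<^sup>L lborel g = integral\<^sup>L (density (distr lborel borel (\<lambda>y. x + (-1) *\<^sub>R y)) (\<lambda>_. ennreal 1)) g"
    by (rule arg_cong[OF eq])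
  also have "\<dots> = integral\<^sup>L (distr lborel borel (\<lambda>y. x + (-1) *\<^sub>R y)) (\<lambda>y. 1 *\<^sub>R g y)"
    by (rule integral_density) auto
  also have "\<dots> = integral\<^sup>L lborel (\<lambda>y. 1 *\<^sub>R g (x + (-1) *\<^sub>R y))"
    by (rule integral_distr) auto
  finally show ?thesis by simp
qed

section \<open>Measures that are stationary for the drift\<close>

lemma compact_neighbourhood:
  fixes U :: "(real^'n::finite) set"
  assumes "open U" "compact S" "S \<subseteq> U"
  obtains \<delta> K where "\<delta> > 0" "compact K" "K \<subseteq> U" "S \<subseteq> interior K"
    "\<And>x y. x \<in> S \<Longrightarrow> dist x y \<le> \<delta> \<Longrightarrow> y \<in> K"
proof -
  obtain e where e: "e > 0" "(\<Union>x\<in>S. ball x e) \<subseteq> U"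
    using compact_subset_open_imp_ball_epsilon_subset[OF assms(2,1,3)] by blast
  let ?K = "{x + z | x z. x \<in> S \<and> z \<in> cball 0 (e / 2)}"
  show ?thesis
  proof
    show "e / 2 > 0" using e by simp
    show "compact ?K" by (intro compact_sums assms compact_cball)
    show "?K \<subseteq> U" using e by (force simp: dist_norm)
    show near: "y \<in> ?K" if "x \<in> S" "dist x y \<le> e / 2" for x y
      unfolding mem_Collect_eq
      by (rule exI[of _ x], rule exI[of _ "y - x"]) (use that in \<open>simp add: dist_norm norm_minus_commute\<close>)
    show "S \<subseteq> interior ?K"
    proof
      fix x assume "x \<in> S"
      then have "ball x (e / 2) \<subseteq> ?K" using near by (meson less_imp_le mem_ball subsetI)
      then show "x \<in> interior ?K" using e(1) by (meson centre_in_ball half_gt_zero interior_maximal open_ball subsetD)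
    qed
  qed
qed

lemma borel_prob_on_space: "\<mu> \<in> borel_prob_on U \<Longrightarrow> space \<mu> = U"
  using sets_eq_imp_space_eq[of \<mu> "restrict_space borel U"] by (simp add: borel_prob_on_def space_restrict_space)

lemma borel_prob_on_sets:
  assumes "\<mu> \<in> borel_prob_on U" "open U" shows "A \<in> sets \<mu> \<longleftrightarrow> A \<in> sets borel \<and> A \<subseteq> U"
  using assms sets_restrict_space_iff[of U borel A] by (auto simp: borel_prob_on_def)

lemma borel_prob_on_measurable:
  assumes "\<mu> \<in> borel_prob_on U" "continuous_on U f" shows "f \<in> borel_measurable \<mu>"
proof -
  have "sets \<mu> = sets (restrict_space borel U)" using assms(1) by (simp add: borel_prob_on_def)
  then show ?thesis
    using borel_measurable_continuous_on_restrict[OF assms(2)] measurable_cong_sets[of \<mu> "restrict_space borel U" borel borel] by simp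
qed

lemma integrable_continuous_compact_support:
  fixes g :: "real^'n::finite \<Rightarrow> real"
  assumes "\<mu> \<in> borel_prob_on U" "open U" "continuous_on U g"
    and "compact K" "K \<subseteq> U" "\<And>x. x \<in> U \<Longrightarrow> x \<notin> K \<Longrightarrow> g x = 0"
  shows "integrable \<mu> g"
proof -
  interpret prob_space \<mu> using assms(1) by (simp add: borel_prob_on_def)
  have sp: "space \<mu> = U" by (rule borel_prob_on_space[OF assms(1)])
  have "g \<in> borel_measurable \<mu>" by (rule borel_prob_on_measurable[OF assms(1,3)])
  moreover obtain B where B: "\<And>x. x \<in> K \<Longrightarrow> \<bar>g x\<bar> \<le> B"
    using compact_imp_bounded[OF compact_continuous_image[OF continuous_on_subset[OF assms(3,5)] assms(4)]]
    by (auto simp: bounded_iff)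
  ultimately show ?thesis
    using assms(6) B sp
    by (intro integrable_const_bound[of _ "max B 0"]) (force intro!: AE_I2)+
qed

definition mollify :: "real \<Rightarrow> (real^'n::finite \<Rightarrow> real) \<Rightarrow> real^'n \<Rightarrow> real" where
  "mollify e f x = (\<integral>y. f y * bump e (x - y) \<partial>lborel) / (\<integral>y. bump e (y :: real^'n) \<partial>lborel)"

lemma mollify_eq_0:
  assumes "e > 0" "\<And>y. dist x y < e \<Longrightarrow> f y = 0"
  shows "mollify e f x = 0"
proof -
  have "(\<lambda>y. f y * bump e (x - y)) = (\<lambda>y. 0)"
    using assms bump_eq_0[of e] by (metis dist_norm mult_eq_0_iff not_less)
  then show ?thesis by (simp add: mollify_def)
qed

lemma smooth_mollify:
  fixes f :: "real^'n::finite \<Rightarrow> real"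
  assumes f: "continuous_on UNIV f" and S: "compact S" "\<And>x. x \<notin> S \<Longrightarrow> f x = 0"
  shows "smooth (mollify e f)"
proof -
  obtain a b where ab: "S \<subseteq> cbox a b" using bounded_subset_cbox_symmetric[OF compact_imp_bounded[OF S(1)]] by blast
  have "mollify e f = (\<lambda>x. (1 / (\<integral>y. bump e (y :: real^'n) \<partial>lborel)) * integral (cbox a b) (\<lambda>y. f y * bump e (x - y)))"
  proof
    fix x
    have "(\<integral>y. f y * bump e (x - y) \<partial>lborel) = integral (cbox a b) (\<lambda>y. f y * bump e (x - y))"
      using ab S(2)
      by (intro lborel_integral_eq_integral_cbox continuous_intros f
            continuous_on_compose2[OF continuous_on_bump[of UNIV]]) auto
    then show "mollify e f x = (1 / (\<integral>y. bump e (y :: real^'n) \<partial>lborel)) * integral (cbox a b) (\<lambda>y. f y * bump e (x - y))"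
      by (simp add: mollify_def)
  qed
  then show ?thesis by (simp only:) (rule smooth_cmult, rule smooth_convolution[OF f smooth_bump])
qed

lemma mollify_test_function:
  fixes f :: "real^'n::finite \<Rightarrow> real"
  assumes f: "continuous_on UNIV f" and S: "compact S" "\<And>x. x \<notin> S \<Longrightarrow> f x = 0"
    and e: "e > 0" and K: "compact K" "K \<subseteq> U" "\<And>x y. x \<in> S \<Longrightarrow> dist x y \<le> e \<Longrightarrow> y \<in> K"
  shows "mollify e f \<in> test_functions U"
proof (rule test_functionsI[OF smooth_mollify[OF f S] K(1,2)])
  fix x assume "x \<notin> K"
  then have "f y = 0" if "dist x y < e" for y
    using K(3)[of y x] S(2)[of y] that by (auto simp: dist_commute)
  then show "mollify e f x = 0" by (rule mollify_eq_0[OF e])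
qed

lemma grad_eq_0_off_support:
  fixes f :: "real^'n::finite \<Rightarrow> real"
  assumes "open T" "x \<in> T" "\<And>y. y \<in> T \<Longrightarrow> f y = 0"
  shows "grad f x = 0"
proof -
  have "((\<lambda>x. 0) has_derivative (\<lambda>h. 0)) (at x)" by simp
  then have "(f has_derivative (\<lambda>h. 0)) (at x)"
    by (rule has_derivative_transform_within_open[OF _ assms(1,2)]) (use assms(3) in auto)
  then show ?thesis by (simp add: grad_def vec_eq_iff partial_deriv_eqI)
qed

lemma has_derivative_along:
  fixes f :: "real^'n::finite \<Rightarrow> real"
  assumes "f differentiable (at x)"
  shows "((\<lambda>s. f (x + s *\<^sub>R v)) has_real_derivative v \<bullet> grad f x) (at 0)"
proof -
  have "((\<lambda>s. x + s *\<^sub>R v) has_derivative (\<lambda>s. s *\<^sub>R v)) (at 0)"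
    by (auto intro!: derivative_eq_intros)
  from has_derivative_compose[OF this, of f "\<lambda>h. h \<bullet> grad f x"] has_derivative_grad[OF assms]
  show ?thesis by (simp add: has_field_derivative_def mult_commute_abs)
qed

text \<open>A shift of the integration variable moves the difference quotient in the direction \<open>V x\<close> from the kernel onto
  \<open>f\<close>. At a point \<open>y\<close> of the ball, the quotient of \<open>f\<close> in the direction \<open>V x\<close> differs from the one in the
  direction \<open>V y\<close> by at most \<open>L * norm (V x - V y)\<close>, and the latter converges to \<open>w y\<close>; dominated convergence
  does the rest. The estimate holds for Lipschitz functions that are differentiable along \<open>V\<close> only.\<close>

lemma directional_derivative_mollify:
  fixes f :: "real^'n::finite \<Rightarrow> real" and V :: "real^'n \<Rightarrow> real^'n"
  assumes f: "L-lipschitz_on UNIV f" and S: "compact S" "\<And>x. x \<notin> S \<Longrightarrow> f x = 0"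
    and e: "e > 0" and V: "continuous_on (cball x e) V" and w: "continuous_on (cball x e) w"
    and D: "\<And>y. y \<in> cball x e \<Longrightarrow> ((\<lambda>s. f (y + s *\<^sub>R V y)) has_real_derivative w y) (at 0)"
    and \<eta>: "\<And>y. y \<in> cball x e \<Longrightarrow> L * norm (V x - V y) + \<bar>w y - w x\<bar> \<le> \<eta>"
  shows "\<bar>V x \<bullet> grad (mollify e f) x - w x\<bar> \<le> \<eta>"
proof -
  have fc: "continuous_on UNIV f" using f by (rule lipschitz_on_continuous_on)
  have L: "\<bar>f y - f z\<bar> \<le> L * norm (y - z)" for y z
    using lipschitz_onD[OF f, of y z] by (simp add: dist_norm)
  have L0: "0 \<le> L" using f by (rule lipschitz_on_nonneg)
  define c where "c = (\<integral>y. bump e (y :: real^'n) \<partial>lborel)"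
  have c: "c > 0" unfolding c_def by (rule integral_bump_pos[OF e])
  define \<rho> where "\<rho> y = bump e (x - y) / c" for y
  have \<rho>0: "0 \<le> \<rho> y" for y using c by (simp add: \<rho>_def bump_nonneg)
  have \<rho>_off: "\<rho> y = 0" if "y \<notin> cball x e" for y
    using that bump_eq_0[OF e, of "x - y"] by (simp add: \<rho>_def dist_norm)
  have \<rho>c: "continuous_on T \<rho>" for T
    unfolding \<rho>_def using c by (intro continuous_intros continuous_on_compose2[OF continuous_on_bump[of UNIV]]) auto
  have \<rho>_int: "integrable lborel \<rho>"
    by (rule integrable_on_lborel_compact_support[OF \<rho>c compact_cball \<rho>_off])
  have "(\<integral>y. bump e (x - y) \<partial>lborel) = c"
    unfolding c_def by (intro lborel_integral_reflect_shift borel_measurable_continuous_onI continuous_on_bump)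
  then have \<rho>1: "(\<integral>y. \<rho> y \<partial>lborel) = 1" using c by (simp add: \<rho>_def)
  define s where "s n = 1 / real (Suc n)" for n
  have s: "s n > 0" for n by (simp add: s_def)
  have s_lim: "filterlim s (at 0) sequentially"
    unfolding filterlim_at using s lim_inverse_n' LIMSEQ_Suc[OF lim_inverse_n'] by (auto simp: s_def[abs_def] intro!: always_eventually less_imp_neq[symmetric])
  (* q freezes the direction at x, r takes the direction of the field at the point itself *)
  define q where "q n y = (f (y + s n *\<^sub>R V x) - f y) / s n" for n y
  define r where "r n y = (f (y + s n *\<^sub>R V y) - f y) / s n" for n y
  have qc: "continuous_on T (q n)" for T n
    unfolding q_def using s[of n] by (intro continuous_intros continuous_on_compose2[OF fc]) auto
  have rc: "continuous_on (cball x e) (r n)" for n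
    unfolding r_def using s[of n] by (intro continuous_intros continuous_on_compose2[OF fc] V) auto
  have shift: "mollify e f (x + t *\<^sub>R V x) = (\<integral>y. f (y + t *\<^sub>R V x) * \<rho> y \<partial>lborel)" for t
  proof -
    have G: "(\<lambda>y. f (x + t *\<^sub>R V x - y) * bump e y) \<in> borel_measurable borel"
      by (intro borel_measurable_continuous_onI continuous_intros continuous_on_compose2[OF fc] continuous_on_bump) auto
    have "(\<integral>y. f y * bump e (x + t *\<^sub>R V x - y) \<partial>lborel)
        = (\<integral>y. f (x + t *\<^sub>R V x - y) * bump e y \<partial>lborel)"
      using lborel_integral_reflect_shift[OF G, of "x + t *\<^sub>R V x"] by simp
    also have "\<dots> = (\<integral>y. f (y + t *\<^sub>R V x) * bump e (x - y) \<partial>lborel)"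
      using lborel_integral_reflect_shift[OF G, of x] by (simp add: algebra_simps)
    finally show ?thesis by (simp add: mollify_def \<rho>_def c_def)
  qed
  have int\<rho>: "integrable lborel (\<lambda>y. g y * \<rho> y)" if "continuous_on UNIV g" for g
    by (rule integrable_on_lborel_compact_support[of _ "cball x e"])
       (auto intro!: continuous_intros that \<rho>c simp: \<rho>_off)
  have quot: "(mollify e f (x + s n *\<^sub>R V x) - mollify e f x) / s n = (\<integral>y. q n y * \<rho> y \<partial>lborel)" for n
  proof -
    have c1: "continuous_on UNIV (\<lambda>y. f (y + s n *\<^sub>R V x))"
      by (intro continuous_intros continuous_on_compose2[OF fc]) auto
    have "mollify e f (x + s n *\<^sub>R V x) - mollify e f x
      = (\<integral>y. f (y + s n *\<^sub>R V x) * \<rho> y - f y * \<rho> y \<partial>lborel)"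
      using shift[of "s n"] shift[of 0] int\<rho>[OF c1] int\<rho>[OF fc] by simp
    then show ?thesis
      by (simp add: q_def left_diff_distrib[symmetric] integral_divide_zero[symmetric] del: integral_divide_zero)
  qed
  have lim: "(\<lambda>n. \<integral>y. q n y * \<rho> y \<partial>lborel) \<longlonglongrightarrow> V x \<bullet> grad (mollify e f) x"
  proof -
    have "((\<lambda>t. mollify e f (x + t *\<^sub>R V x)) has_real_derivative V x \<bullet> grad (mollify e f) x) (at 0)"
      by (intro has_derivative_along smooth_differentiable smooth_mollify[OF fc S])
    then have "((\<lambda>t. (mollify e f (x + t *\<^sub>R V x) - mollify e f x) / t) \<longlongrightarrow> V x \<bullet> grad (mollify e f) x) (at 0)"
      by (simp add: DERIV_def)
    from filterlim_compose[OF this s_lim] show ?thesis by (simp add: quot)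
  qed
  let ?B = "indicator (cball x e) :: real^'n \<Rightarrow> real"
  let ?d = "\<lambda>n y. ?B y *\<^sub>R (\<bar>r n y - w y\<bar> * \<rho> y)"
  let ?b = "\<lambda>y. ?B y *\<^sub>R ((L * norm (V y) + \<bar>w y\<bar>) * \<rho> y)"
  have dint: "integrable lborel (?d n)" for n
    by (intro borel_integrable_compact compact_cball continuous_intros rc w \<rho>c)
  have bint: "integrable lborel ?b"
    by (intro borel_integrable_compact compact_cball continuous_intros V w \<rho>c)
  have rbound: "\<bar>r n y\<bar> \<le> L * norm (V y)" for n y
    using L[of "y + s n *\<^sub>R V y" y] s[of n] by (simp add: r_def field_simps)
  have "(\<lambda>n. integral\<^sup>L lborel (?d n)) \<longlonglongrightarrow> integral\<^sup>L lborel (\<lambda>y::real^'n. 0)"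
  proof (rule integral_dominated_convergence[where w = ?b])
    show "AE y in lborel. (\<lambda>n. ?d n y) \<longlonglongrightarrow> 0"
    proof (intro AE_I2)
      fix y
      show "(\<lambda>n. ?d n y) \<longlonglongrightarrow> 0"
      proof (cases "y \<in> cball x e")
        case True
        have "((\<lambda>t. (f (y + t *\<^sub>R V y) - f y) / t) \<longlongrightarrow> w y) (at 0)"
          using D[OF True] by (simp add: DERIV_def)
        from filterlim_compose[OF this s_lim] have "(\<lambda>n. r n y) \<longlonglongrightarrow> w y" by (simp add: r_def)
        then have "(\<lambda>n. \<bar>r n y - w y\<bar> * \<rho> y) \<longlonglongrightarrow> \<bar>w y - w y\<bar> * \<rho> y"
          by (intro tendsto_intros)
        then show ?thesis using True by simp
      qed simp
    qed
    show "AE y in lborel. norm (?d n y) \<le> ?b y" for n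
      using rbound[of n] \<rho>0
      by (intro AE_I2) (auto simp: indicator_def abs_mult intro!: mult_right_mono order_trans[OF abs_triangle_ineq4])
  qed (use dint bint in auto)
  then have dlim: "(\<lambda>n. integral\<^sup>L lborel (?d n) + \<eta>) \<longlonglongrightarrow> 0 + \<eta>"
    by (intro tendsto_intros) simp
  have est: "\<bar>(\<integral>y. q n y * \<rho> y \<partial>lborel) - w x\<bar> \<le> integral\<^sup>L lborel (?d n) + \<eta>" for n
  proof -
    have "(\<integral>y. q n y * \<rho> y \<partial>lborel) - w x = (\<integral>y. q n y * \<rho> y - w x * \<rho> y \<partial>lborel)"
      using int\<rho>[OF qc] \<rho>_int \<rho>1 by simp
    also have "\<bar>\<dots>\<bar> \<le> (\<integral>y. \<bar>q n y * \<rho> y - w x * \<rho> y\<bar> \<partial>lborel)"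
      by (rule integral_abs_bound)
    also have "\<dots> \<le> (\<integral>y. ?d n y + \<eta> * \<rho> y \<partial>lborel)"
    proof (rule integral_mono)
      show "integrable lborel (\<lambda>y. \<bar>q n y * \<rho> y - w x * \<rho> y\<bar>)"
        using int\<rho>[OF qc, of n] \<rho>_int by simp
      show "integrable lborel (\<lambda>y. ?d n y + \<eta> * \<rho> y)" using dint \<rho>_int by simp
      fix y
      show "\<bar>q n y * \<rho> y - w x * \<rho> y\<bar> \<le> ?d n y + \<eta> * \<rho> y"
      proof (cases "y \<in> cball x e")
        case True
        have "\<bar>q n y - r n y\<bar> = \<bar>f (y + s n *\<^sub>R V x) - f (y + s n *\<^sub>R V y)\<bar> / s n"
          using s[of n] by (simp add: q_def r_def diff_divide_distrib[symmetric])
        also have "\<dots> \<le> (L * norm (s n *\<^sub>R V x - s n *\<^sub>R V y)) / s n"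
          using L[of "y + s n *\<^sub>R V x" "y + s n *\<^sub>R V y"] s[of n] by (intro divide_right_mono) auto
        also have "\<dots> = L * norm (V x - V y)"
          using s[of n] by (simp add: scaleR_diff_right[symmetric])
        finally have "\<bar>q n y - w x\<bar> \<le> \<bar>r n y - w y\<bar> + \<eta>" using \<eta>[OF True] by linarith
        then have "\<bar>q n y - w x\<bar> * \<rho> y \<le> (\<bar>r n y - w y\<bar> + \<eta>) * \<rho> y" by (intro mult_right_mono \<rho>0)
        then show ?thesis using True \<rho>0[of y] by (simp add: left_diff_distrib[symmetric] abs_mult distrib_right)
      qed (simp add: \<rho>_off)
    qed
    also have "\<dots> = integral\<^sup>L lborel (?d n) + \<eta>" using dint \<rho>_int \<rho>1 by simp
    finally show ?thesis .
  qed
  have "\<bar>V x \<bullet> grad (mollify e f) x - w x\<bar> \<le> 0 + \<eta>"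
    by (rule LIMSEQ_le[OF tendsto_rabs[OF tendsto_diff[OF lim tendsto_const]] dlim]) (use est in blast)
  then show ?thesis by simp
qed

text \<open>Stationarity for the generator without its second-order part; this is all that survives in the limit of vanishing
  diffusion.\<close>

definition drift_stationary :: "(real^'n::finite) set \<Rightarrow> (real^'n \<Rightarrow> real^'n) \<Rightarrow> (real^'n) measure \<Rightarrow> bool" where
  "drift_stationary U V \<mu> \<longleftrightarrow> stationary_measure U V (\<lambda>x. 0) \<mu>"

lemma drift_stationary_iff:
  "drift_stationary U V \<mu> \<longleftrightarrow> \<mu> \<in> borel_prob_on U \<and>
     (\<forall>f\<in>test_functions U. integral\<^sup>L \<mu> (\<lambda>x. V x \<bullet> grad f x) = 0)"
proof -
  have "generator (\<lambda>x. 0) V f = (\<lambda>x. V x \<bullet> grad f x)" for f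
    by (simp add: generator_def fun_eq_iff inner_vec_def grad_def)
  then show ?thesis by (simp add: drift_stationary_def stationary_measure_def)
qed

lemma drift_stationaryD:
  assumes "drift_stationary U V \<mu>"
  shows "\<mu> \<in> borel_prob_on U"
    and "f \<in> test_functions U \<Longrightarrow> integral\<^sup>L \<mu> (\<lambda>x. V x \<bullet> grad f x) = 0"
  using assms by (simp_all add: drift_stationary_iff)

text \<open>Stationarity extends from test functions to Lipschitz functions with compact support. The mollifications of \<open>f\<close>
  are test functions, and their derivatives along \<open>V\<close> converge to \<open>w\<close> uniformly, since \<open>V\<close> and \<open>w\<close> are
  uniformly continuous near \<open>S\<close>. This is the form in which functions built from the flow can be used: they are
  Lipschitz, and their derivatives along \<open>V\<close> are explicit.\<close>

lemma integral_directional_derivative_eq_0: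
  fixes f w :: "real^'n::finite \<Rightarrow> real"
  assumes U: "open U" and V: "continuous_on U V" and st: "drift_stationary U V \<mu>"
    and f: "L-lipschitz_on UNIV f" and S: "compact S" "S \<subseteq> U" "\<And>x. x \<notin> S \<Longrightarrow> f x = 0"
    and D: "\<And>y. y \<in> U \<Longrightarrow> ((\<lambda>s. f (y + s *\<^sub>R V y)) has_real_derivative w y) (at 0)"
    and w: "continuous_on U w"
  shows "integral\<^sup>L \<mu> w = 0"
proof -
  note \<mu> = drift_stationaryD(1)[OF st]
  have fc: "continuous_on UNIV f" using f by (rule lipschitz_on_continuous_on)
  have L0: "0 \<le> L" using f by (rule lipschitz_on_nonneg)
  obtain \<delta> K where \<delta>: "\<delta> > 0" and K: "compact K" "K \<subseteq> U" "\<And>x y. x \<in> S \<Longrightarrow> dist x y \<le> \<delta> \<Longrightarrow> y \<in> K"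
    using compact_neighbourhood[OF U S(1,2)] by metis
  have w0: "w x = 0" if "x \<in> U" "x \<notin> S" for x
  proof -
    have "((\<lambda>s. x + s *\<^sub>R V x) \<longlongrightarrow> x + 0 *\<^sub>R V x) (nhds 0)"
      by (intro tendsto_intros filterlim_ident)
    moreover have "open (- S)" using S(1) by (simp add: compact_imp_closed open_Compl)
    ultimately have "\<forall>\<^sub>F s in nhds 0. x + s *\<^sub>R V x \<in> - S"
      using that by (intro topological_tendstoD) auto
    then have "\<forall>\<^sub>F s in nhds 0. f (x + s *\<^sub>R V x) = 0" by (rule eventually_mono) (use S(3) in auto)
    from DERIV_cong_ev[OF refl this refl] have "((\<lambda>s. f (x + s *\<^sub>R V x)) has_real_derivative 0) (at 0)"
      by simp
    then show ?thesis using D[OF that(1)] DERIV_unique by blast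
  qed
  interpret prob_space \<mu> using \<mu> by (simp add: borel_prob_on_def)
  have sp: "space \<mu> = U" by (rule borel_prob_on_space[OF \<mu>])
  have wint: "integrable \<mu> w"
    by (rule integrable_continuous_compact_support[OF \<mu> U w S(1,2)]) (use w0 in auto)
  have bound: "\<bar>integral\<^sup>L \<mu> w\<bar> \<le> \<eta>" if \<eta>: "\<eta> > 0" for \<eta>
  proof -
    have "uniformly_continuous_on K V" "uniformly_continuous_on K w"
      using compact_uniformly_continuous K(1) continuous_on_subset[OF V K(2)] continuous_on_subset[OF w K(2)] by blast+
    moreover have "\<eta> / 2 > 0" "\<eta> / (2 * (L + 1)) > 0" using \<eta> L0 by auto
    ultimately obtain d1 d2 where d: "d1 > 0" "d2 > 0"
      and d1: "\<And>x y. x \<in> K \<Longrightarrow> y \<in> K \<Longrightarrow> dist x y < d1 \<Longrightarrow> dist (V x) (V y) < \<eta> / (2 * (L + 1))"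
      and d2: "\<And>x y. x \<in> K \<Longrightarrow> y \<in> K \<Longrightarrow> dist x y < d2 \<Longrightarrow> dist (w x) (w y) < \<eta> / 2"
      unfolding uniformly_continuous_on_def by metis
    define e where "e = min (\<delta> / 2) (min (d1 / 2) (d2 / 2))"
    have e: "e > 0" "e \<le> \<delta> / 2" "e < d1" "e < d2" using d \<delta> by (auto simp: e_def)
    let ?F = "mollify e f"
    have F: "?F \<in> test_functions U"
      by (rule mollify_test_function[OF fc S(1,3) e(1) K(1,2)]) (use K(3) e(2) \<delta> in auto)
    have smF: "smooth ?F" by (rule smooth_mollify[OF fc S(1,3)])
    have gF: "continuous_on U (\<lambda>x. V x \<bullet> grad ?F x)"
      by (intro continuous_intros V smooth_grad_continuous smF)
    have Foff: "?F x = 0" if "x \<notin> K" for x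
      by (rule mollify_eq_0[OF e(1)]) (use that K(3)[of _ x] S(3) e(2) \<delta> in \<open>force simp: dist_commute\<close>)
    have gFint: "integrable \<mu> (\<lambda>x. V x \<bullet> grad ?F x)"
      by (rule integrable_continuous_compact_support[OF \<mu> U gF K(1,2)])
         (use Foff grad_eq_0_off_support[of "- K" _ ?F] compact_imp_closed[OF K(1)] in \<open>auto simp: open_Compl\<close>)
    have near: "\<bar>V x \<bullet> grad ?F x - w x\<bar> \<le> \<eta>" if x: "x \<in> U" for x
    proof (cases "\<exists>z\<in>S. dist z x \<le> e")
      case True
      then obtain z where z: "z \<in> S" "dist z x \<le> e" by blast
      have sub: "cball x e \<subseteq> K"
      proof
        fix y assume "y \<in> cball x e"
        then have "dist z y \<le> \<delta>" using z e(2) dist_triangle[of z y x] by (simp add: dist_commute)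
        then show "y \<in> K" using K(3) z(1) by blast
      qed
      have xK: "x \<in> K" using sub e(1) by auto
      show ?thesis
      proof (rule directional_derivative_mollify[OF f S(1,3) e(1)])
        show "continuous_on (cball x e) V" "continuous_on (cball x e) w"
          using continuous_on_subset[OF V] continuous_on_subset[OF w] sub K(2) by auto
        fix y assume y: "y \<in> cball x e"
        then show "((\<lambda>s. f (y + s *\<^sub>R V y)) has_real_derivative w y) (at 0)" using D sub K(2) by blast
        have yK: "y \<in> K" using y sub by blast
        have "norm (V x - V y) \<le> \<eta> / (2 * (L + 1))" "\<bar>w y - w x\<bar> \<le> \<eta> / 2"
          using d1[OF xK yK] d2[OF xK yK] y e by (auto simp: dist_norm abs_minus_commute)
        then have "L * norm (V x - V y) \<le> L * (\<eta> / (2 * (L + 1)))" by (intro mult_left_mono L0)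
        also have "\<dots> \<le> \<eta> / 2" using L0 \<eta> by (simp add: field_simps)
        finally show "L * norm (V x - V y) + \<bar>w y - w x\<bar> \<le> \<eta>" using \<open>\<bar>w y - w x\<bar> \<le> \<eta> / 2\<close> by linarith
      qed
    next
      case False
      let ?T = "- {a + b |a b. a \<in> S \<and> b \<in> cball 0 e}"
      have "closed {a + b |a b. a \<in> S \<and> b \<in> cball (0::real^'n) e}"
        by (intro compact_imp_closed compact_sums S(1) compact_cball)
      then have "open ?T" by (simp add: open_Compl)
      moreover have "x \<in> ?T" using False by (auto simp: dist_norm)
      moreover have "?F y = 0" if "y \<in> ?T" for y
      proof (rule mollify_eq_0[OF e(1)], rule S(3))
        fix z assume z: "dist y z < e"
        show "z \<notin> S"
        proof
          assume zS: "z \<in> S"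
          have "y \<in> {a + b |a b. a \<in> S \<and> b \<in> cball (0::real^'n) e}"
            unfolding mem_Collect_eq
            by (rule exI[of _ z], rule exI[of _ "y - z"]) (use z zS in \<open>simp add: dist_norm norm_minus_commute\<close>)
          then show False using that by blast
        qed
      qed
      ultimately have "grad ?F x = 0" by (rule grad_eq_0_off_support)
      moreover have "x \<notin> S" using False e(1) by force
      ultimately show ?thesis using w0[OF x] \<eta> by simp
    qed
    have "\<bar>integral\<^sup>L \<mu> w\<bar> = \<bar>\<integral>x. V x \<bullet> grad ?F x - w x \<partial>\<mu>\<bar>"
      using drift_stationaryD(2)[OF st F] wint gFint by simp
    also have "\<dots> \<le> (\<integral>x. \<bar>V x \<bullet> grad ?F x - w x\<bar> \<partial>\<mu>)" by (rule integral_abs_bound)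
    also have "\<dots> \<le> (\<integral>x. \<eta> \<partial>\<mu>)"
      by (rule integral_mono) (use near sp wint gFint in auto)
    finally show ?thesis by (simp add: prob_space)
  qed
  have "\<bar>integral\<^sup>L \<mu> w\<bar> \<le> 0"
    by (rule field_le_epsilon) (simp only: add_0 bound)
  then show ?thesis by simp
qed

section \<open>Uniqueness of weak derivatives\<close>

text \<open>Boxes form an intersection-stable generator of the Borel sets, so \<open>g\<close> has integral \<open>0\<close> over every Borel set.\<close>

lemma AE_zero_if_box_integrals_zero:
  fixes g :: "real^'n::finite \<Rightarrow> real"
  assumes g: "integrable lborel g" and box: "\<And>c d. (LINT x:box c d|lborel. g x) = 0"
  shows "AE x in lborel. g x = 0"
proof (rule sigma_finite_measure.density_zero[OF lborel.sigma_finite_measure_axioms g])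
  have si: "set_integrable lborel A g" if "A \<in> sets borel" for A
    unfolding set_integrable_def using that g by (intro integrable_mult_indicator) auto
  let ?G = "range (\<lambda>(a, b). box a b :: (real^'n) set)"
  have UN: "(\<Union>i::nat. box (- (real i *\<^sub>R One)) (real i *\<^sub>R One) :: (real^'n) set) = UNIV"
    by (rule UN_box_eq_UNIV)
  have inc: "incseq (\<lambda>i::nat. box (- (real i *\<^sub>R One)) (real i *\<^sub>R One) :: (real^'n) set)"
  proof (rule incseq_SucI)
    fix i :: nat
    show "box (- (real i *\<^sub>R One)) (real i *\<^sub>R One) \<subseteq> (box (- (real (Suc i) *\<^sub>R One)) (real (Suc i) *\<^sub>R One) :: (real^'n) set)"
      by (rule subset_box_imp) auto
  qed
  have "(\<lambda>i::nat. LINT x:box (- (real i *\<^sub>R One)) (real i *\<^sub>R One)|lborel. g x) \<longlonglongrightarrow>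
      (LINT x:(\<Union>i::nat. box (- (real i *\<^sub>R One)) (real i *\<^sub>R One))|lborel. g x)"
    by (rule set_integral_cont_up[OF _ inc]) (use si UN in auto)
  then have univ: "(LINT x:UNIV|lborel. g x) = 0"
    unfolding UN box by (simp add: LIMSEQ_const_iff)
  fix A :: "(real^'n) set" assume "A \<in> sets lborel"
  then have A: "A \<in> sigma_sets UNIV ?G" by (simp add: borel_eq_box)
  have "Int_stable ?G" by (auto simp: Int_stable_def box_Int_box)
  moreover have "?G \<subseteq> Pow UNIV" by simp
  moreover note A
  ultimately show "(LINT x:A|lborel. g x) = 0"
  proof (induction rule: sigma_sets_induct_disjoint)
    case (basic A) then show ?case using box by auto
  next
    case empty show ?case by (simp add: set_lebesgue_integral_def)
  next
    case (compl A)
    have A: "A \<in> sets borel" using compl.hyps by (simp add: borel_eq_box)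
    have "(LINT x:A \<union> (UNIV - A)|lborel. g x) = (LINT x:A|lborel. g x) + (LINT x:UNIV - A|lborel. g x)"
      by (rule set_integral_Un) (use si A in auto)
    then show ?case using compl.IH univ by (simp add: Un_Diff_cancel)
  next
    case (union F)
    have F: "F i \<in> sets borel" for i using union.hyps(2) by (auto simp: borel_eq_box)
    have "(LINT x:(\<Union>i. F i)|lborel. g x) = (\<Sum>i. LINT x:F i|lborel. g x)"
      using union.hyps(1) F
      by (intro lebesgue_integral_countable_add si) (auto simp: disjoint_family_on_def)
    then show ?case using union.IH by simp
  qed
qed

text \<open>Smooth functions with values in \<open>[0, 1]\<close> that tend to the indicator of the open box as \<open>k\<close> grows.\<close>

definition box_bump :: "real^'n \<Rightarrow> real^'n \<Rightarrow> nat \<Rightarrow> real^'n::finite \<Rightarrow> real" where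
  "box_bump c d k x = (\<Prod>i\<in>UNIV. expinv 0 (real k * (x $ i - c $ i)) * expinv 0 (real k * (d $ i - x $ i)))"

lemma box_bump_bounds: "0 \<le> box_bump c d k x" "box_bump c d k x \<le> 1"
  unfolding box_bump_def
  by (auto intro!: prod_nonneg prod_le_1 mult_nonneg_nonneg mult_le_one expinv_nonneg expinv_0_le_1)

lemma box_bump_eq_0: "x \<notin> box c d \<Longrightarrow> box_bump c d k x = 0"
proof -
  assume "x \<notin> box c d"
  then obtain i where "x $ i - c $ i \<le> 0 \<or> d $ i - x $ i \<le> 0"
    by (auto simp: mem_box_cart not_less)
  then have "real k * (x $ i - c $ i) \<le> 0 \<or> real k * (d $ i - x $ i) \<le> 0"
    by (auto simp: mult_nonneg_nonpos)
  then have "expinv 0 (real k * (x $ i - c $ i)) * expinv 0 (real k * (d $ i - x $ i)) = 0"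
    by (auto simp: expinv_def)
  then show ?thesis unfolding box_bump_def by (intro prod_zero) auto
qed

lemma smooth_box_bump: "smooth (box_bump c d k)"
  unfolding box_bump_def[abs_def] by (intro smooth_prod smooth_mult smooth_expinv smooth_intros)

lemma box_bump_test_function: "cbox c d \<subseteq> U \<Longrightarrow> box_bump c d k \<in> test_functions U"
  using box_subset_cbox[of c d]
  by (intro test_functionsI[OF smooth_box_bump compact_cbox, of c d]) (auto intro!: box_bump_eq_0)

lemma expinv_0_tendsto_1:
  assumes "s > 0" shows "(\<lambda>k. expinv 0 (real k * s)) \<longlonglongrightarrow> 1"
proof -
  have "(\<lambda>k. exp (- (inverse (real k) * inverse s))) \<longlonglongrightarrow> exp (- (0 * inverse s))"
    by (intro tendsto_intros lim_inverse_n)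
  moreover have "\<forall>\<^sub>F k in sequentially. exp (- (inverse (real k) * inverse s)) = expinv 0 (real k * s)"
    using eventually_gt_at_top[of 0]
    by eventually_elim (use assms in \<open>auto simp: expinv_def divide_inverse\<close>)
  ultimately show ?thesis by (simp add: tendsto_cong)
qed

lemma box_bump_tendsto:
  fixes x :: "real^'n::finite"
  shows "(\<lambda>k. box_bump c d k x) \<longlonglongrightarrow> indicator (box c d) x"
proof (cases "x \<in> box c d")
  case True
  have "(\<lambda>k. box_bump c d k x) \<longlonglongrightarrow> (\<Prod>i\<in>(UNIV::'n set). 1 * 1)"
    unfolding box_bump_def
  proof (rule tendsto_prod)
    fix i
    have "x $ i - c $ i > 0" "d $ i - x $ i > 0" using True by (simp_all add: mem_box_cart)
    from tendsto_mult[OF this[THEN expinv_0_tendsto_1]]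
    show "(\<lambda>k. expinv 0 (real k * (x $ i - c $ i)) * expinv 0 (real k * (d $ i - x $ i))) \<longlonglongrightarrow> 1 * 1" .
  qed
  then show ?thesis using True by simp
next
  case False
  then show ?thesis using box_bump_eq_0[OF False] by simp
qed

lemma Lp_loc_measurable:
  assumes "g \<in> Lp_loc p U" "K \<subseteq> U"
  shows "g \<in> borel_measurable (lebesgue_on K)"
proof -
  have "g \<in> borel_measurable (lebesgue_on U)" using assms(1) unfolding Lp_loc_def by blast
  then show ?thesis using assms(2) by (rule measurable_restrict_mono)
qed

lemma Lp_loc_integrable_powr:
  assumes "g \<in> Lp_loc p U" "compact K" "K \<subseteq> U"
  shows "integrable (lebesgue_on K) (\<lambda>x. \<bar>g x\<bar> powr p)"
  using assms unfolding Lp_loc_def by blast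

lemma Lp_loc_1_integrable:
  assumes "g \<in> Lp_loc 1 U" "compact K" "K \<subseteq> U"
  shows "integrable (lebesgue_on K) g"
proof (rule integrable_norm_cancel)
  show "integrable (lebesgue_on K) (\<lambda>x. norm (g x))"
    using Lp_loc_integrable_powr[OF assms] by (simp only: real_norm_def powr_one abs_ge_zero)
qed (rule Lp_loc_measurable[OF assms(1,3)])

lemma compact_lebesgue: "compact K \<Longrightarrow> K \<in> sets lebesgue" for K :: "(real^'n::finite) set"
  by (simp add: borel_compact)

lemma Lp_loc_1_integrable':
  fixes g :: "real^'n::finite \<Rightarrow> real"
  assumes "g \<in> Lp_loc 1 U" "compact K" "K \<subseteq> U"
  shows "integrable lebesgue (\<lambda>x. indicator K x * g x)"
  using Lp_loc_1_integrable[OF assms] compact_lebesgue[OF assms(2)] by (simp add: integrable_restrict_space)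

lemma integrable_mult_bounded_lebesgue:
  fixes G \<phi> :: "real^'n::finite \<Rightarrow> real"
  assumes G: "integrable lebesgue G" and \<phi>: "\<phi> \<in> borel_measurable lebesgue" "\<And>x. \<bar>\<phi> x\<bar> \<le> C"
  shows "integrable lebesgue (\<lambda>x. G x * \<phi> x)"
proof (rule Bochner_Integration.integrable_bound)
  show "integrable lebesgue (\<lambda>x. C * \<bar>G x\<bar>)" using G by simp
  show "(\<lambda>x. G x * \<phi> x) \<in> borel_measurable lebesgue"
    using G \<phi>(1) by (intro borel_measurable_times) auto
  have "\<bar>G x\<bar> * \<bar>\<phi> x\<bar> \<le> \<bar>C * \<bar>G x\<bar>\<bar>" for x
    using mult_left_mono[OF \<phi>(2), of "\<bar>G x\<bar>" x] by (simp add: mult.commute)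
  then show "AE x in lebesgue. norm (G x * \<phi> x) \<le> norm (C * \<bar>G x\<bar>)"
    by (simp add: abs_mult)
qed

lemma lebesgue_on_integral_eq:
  fixes g \<phi> :: "real^'n::finite \<Rightarrow> real"
  assumes "open U" "K \<subseteq> U" "\<And>x. x \<notin> K \<Longrightarrow> \<phi> x = 0"
  shows "integral\<^sup>L (lebesgue_on U) (\<lambda>x. g x * \<phi> x) = integral\<^sup>L lebesgue (\<lambda>x. (indicator K x * g x) * \<phi> x)"
    and "integrable (lebesgue_on U) (\<lambda>x. g x * \<phi> x) \<longleftrightarrow> integrable lebesgue (\<lambda>x. (indicator K x * g x) * \<phi> x)"
proof -
  have U: "U \<inter> space lebesgue \<in> sets lebesgue" using assms(1) by simp
  have eq: "(\<lambda>x. indicator U x *\<^sub>R (g x * \<phi> x)) = (\<lambda>x. (indicator K x * g x) * \<phi> x)"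
    using assms(2,3) by (auto simp: indicator_def fun_eq_iff)
  show "integral\<^sup>L (lebesgue_on U) (\<lambda>x. g x * \<phi> x) = integral\<^sup>L lebesgue (\<lambda>x. (indicator K x * g x) * \<phi> x)"
    by (subst integral_restrict_space[OF U]) (simp only: eq)
  show "integrable (lebesgue_on U) (\<lambda>x. g x * \<phi> x) \<longleftrightarrow> integrable lebesgue (\<lambda>x. (indicator K x * g x) * \<phi> x)"
    by (subst integrable_restrict_space[OF U]) (simp only: eq)
qed

lemma test_function_integrable:
  fixes g :: "real^'n::finite \<Rightarrow> real"
  assumes U: "open U" and g: "g \<in> Lp_loc 1 U" and \<psi>: "\<psi> \<in> test_functions U"
  shows "integrable (lebesgue_on U) (\<lambda>x. g x * \<psi> x)"
proof -
  let ?K = "closure {x. \<psi> x \<noteq> 0}"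
  have K: "compact ?K" "?K \<subseteq> U" and c: "continuous_on UNIV \<psi>"
    using \<psi> by (auto simp: test_functions_def intro: smooth_continuous simp: smooth_def)
  have off: "\<psi> x = 0" if "x \<notin> ?K" for x
    using that subsetD[OF closure_subset, of x "{x. \<psi> x \<noteq> 0}"] by auto
  obtain C where C: "\<And>x. x \<in> ?K \<Longrightarrow> \<bar>\<psi> x\<bar> \<le> C"
    using compact_imp_bounded[OF compact_continuous_image[OF continuous_on_subset[OF c] K(1)]]
    by (auto simp: bounded_iff)
  have "\<bar>\<psi> x\<bar> \<le> max C 0" for x using C[of x] off[of x] by (cases "x \<in> ?K") auto
  then have "integrable lebesgue (\<lambda>x. (indicator ?K x * g x) * \<psi> x)"
    by (intro integrable_mult_bounded_lebesgue Lp_loc_1_integrable'[OF g K])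
       (simp_all add: measurable_completion borel_measurable_continuous_onI c)
  then show ?thesis using lebesgue_on_integral_eq(2)[OF U K(2), of \<psi> g] off by blast
qed

text \<open>The fundamental lemma of the calculus of variations: boxes inside \<open>U\<close> have indicators that are bounded limits of
  test functions, so \<open>g\<close> has integral \<open>0\<close> over each of them. Since \<open>g\<close> is only locally integrable and
  Lebesgue measurable, a Borel version of \<open>g\<close> is considered on one box at a time, and countably many boxes
  exhaust \<open>U\<close>.\<close>

lemma AE_zero_if_test_integrals_zero:
  fixes g :: "real^'n::finite \<Rightarrow> real"
  assumes U: "open U" and g: "g \<in> Lp_loc 1 U"
    and test: "\<And>\<psi>. \<psi> \<in> test_functions U \<Longrightarrow> integral\<^sup>L (lebesgue_on U) (\<lambda>x. g x * \<psi> x) = 0"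
  shows "AE x in lebesgue. x \<in> U \<longrightarrow> g x = 0"
proof -
  have AEbox: "AE x in lebesgue. x \<in> box a b \<longrightarrow> g x = 0" if ab: "cbox a b \<subseteq> U" for a b
  proof -
    define G where "G x = indicator (box a b) x * g x" for x
    have box0: "integral\<^sup>L lebesgue (\<lambda>x. G x * indicator (box c d) x) = 0" for c d
    proof -
      obtain c' d' where cd: "box a b \<inter> box c d = box c' d'"
        using box_Int_box[of a b c d] by blast
      show ?thesis
      proof (cases "box c' d' = {}")
        case True
        have "(\<lambda>x. G x * indicator (box c d) x) = (\<lambda>x. 0)"
          using cd True by (auto simp: fun_eq_iff G_def indicator_def)
        then show ?thesis by simp
      next
        case False
        have sub: "cbox c' d' \<subseteq> U"
        proof -
          have "closure (box c' d') \<subseteq> closure (box a b)" using cd by (intro closure_mono) auto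
          moreover have "box a b \<noteq> {}" using False cd by auto
          ultimately show ?thesis using False ab closure_box by (metis order_trans)
        qed
        let ?K = "cbox c' d'"
        have int: "integrable lebesgue (\<lambda>x. indicator ?K x * g x)"
          by (rule Lp_loc_1_integrable'[OF g compact_cbox sub])
        have meas: "box_bump c' d' k \<in> borel_measurable lebesgue" for k
          by (intro measurable_completion borel_measurable_continuous_onI smooth_continuous smooth_box_bump)
             (simp_all add: borel_measurable_continuous_onI smooth_continuous smooth_box_bump)
        have "(\<lambda>k. integral\<^sup>L lebesgue (\<lambda>x. (indicator ?K x * g x) * box_bump c' d' k x)) \<longlonglongrightarrow>
            integral\<^sup>L lebesgue (\<lambda>x. (indicator ?K x * g x) * indicator (box c' d') x)"
        proof (rule integral_dominated_convergence[where w = "\<lambda>x. \<bar>indicator ?K x * g x\<bar>"])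
          show "AE x in lebesgue. norm ((indicator ?K x * g x) * box_bump c' d' k x) \<le> \<bar>indicator ?K x * g x\<bar>" for k
            using box_bump_bounds[of c' d' k] by (intro AE_I2) (auto simp: abs_mult mult_left_le)
          show "AE x in lebesgue. (\<lambda>k. (indicator ?K x * g x) * box_bump c' d' k x) \<longlonglongrightarrow>
              (indicator ?K x * g x) * indicator (box c' d') x"
            by (intro AE_I2 tendsto_mult tendsto_const box_bump_tendsto)
          show "(\<lambda>x. (indicator ?K x * g x) * box_bump c' d' k x) \<in> borel_measurable lebesgue" for k
            by (rule borel_measurable_times[OF borel_measurable_integrable[OF int] meas])
          show "(\<lambda>x. (indicator ?K x * g x) * indicator (box c' d') x) \<in> borel_measurable lebesgue"
            by (rule borel_measurable_times[OF borel_measurable_integrable[OF int] borel_measurable_indicator]) simp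
        qed (use int in simp)
        moreover have "integral\<^sup>L lebesgue (\<lambda>x. (indicator ?K x * g x) * box_bump c' d' k x) = 0" for k
        proof -
          have "box_bump c' d' k x = 0" if "x \<notin> ?K" for x
            using that box_subset_cbox[of c' d'] by (intro box_bump_eq_0) auto
          from lebesgue_on_integral_eq(1)[OF U sub, of "box_bump c' d' k" g] this test[OF box_bump_test_function[OF sub]]
          show ?thesis by simp
        qed
        ultimately have "integral\<^sup>L lebesgue (\<lambda>x. (indicator ?K x * g x) * indicator (box c' d') x) = 0"
          by (simp add: LIMSEQ_const_iff)
        also have "(\<lambda>x. (indicator ?K x * g x) * indicator (box c' d') x) = (\<lambda>x. G x * indicator (box c d) x)"
          using cd box_subset_cbox[of c' d'] by (auto simp: fun_eq_iff G_def indicator_def)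
        finally show ?thesis .
      qed
    qed
    have Gint: "integrable lebesgue G"
    proof -
      have "integrable lebesgue (\<lambda>x. (indicator (cbox a b) x * g x) * indicator (box a b) x)"
        by (rule integrable_mult_bounded_lebesgue[OF Lp_loc_1_integrable'[OF g compact_cbox ab] borel_measurable_indicator, of _ 1])
           (simp_all add: indicator_def)
      also have "(\<lambda>x. (indicator (cbox a b) x * g x) * indicator (box a b) x) = G"
        using box_subset_cbox[of a b] by (auto simp: fun_eq_iff G_def indicator_def)
      finally show ?thesis .
    qed
    then obtain G' where G': "G' \<in> borel_measurable lborel" "AE x in lborel. G x = G' x"
      using completion_ex_borel_measurable_real[of G lborel] by auto
    have AE': "AE x in lebesgue. G x = G' x" using G'(2) by (rule AE_completion)
    have G'l: "G' \<in> borel_measurable lebesgue" using G'(1) by (rule measurable_completion)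
    have "integrable lebesgue G'"
      using Gint integrable_cong_AE[OF _ G'l AE'] by auto
    then have G'int: "integrable lborel G'" using integrable_completion[OF G'(1)] by simp
    have "AE x in lborel. G' x = 0"
    proof (rule AE_zero_if_box_integrals_zero[OF G'int])
      fix c d
      have "(LINT x:box c d|lborel. G' x) = integral\<^sup>L lebesgue (\<lambda>x. indicator (box c d) x *\<^sub>R G' x)"
        unfolding set_lebesgue_integral_def
        by (rule integral_completion[symmetric]) (use G'(1) in measurable)
      also have "\<dots> = integral\<^sup>L lebesgue (\<lambda>x. G x * indicator (box c d) x)"
      proof (rule integral_cong_AE)
        show "AE x in lebesgue. indicator (box c d) x *\<^sub>R G' x = G x * indicator (box c d) x"
          using AE' by eventually_elim simp
        show "(\<lambda>x. indicator (box c d) x *\<^sub>R G' x) \<in> borel_measurable lebesgue"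
          using G'l by (intro borel_measurable_scaleR borel_measurable_indicator) auto
        show "(\<lambda>x. G x * indicator (box c d) x) \<in> borel_measurable lebesgue"
          by (rule borel_measurable_times[OF borel_measurable_integrable[OF Gint] borel_measurable_indicator]) simp
      qed
      finally show "(LINT x:box c d|lborel. G' x) = 0" using box0 by simp
    qed
    then have "AE x in lebesgue. G' x = 0" by (rule AE_completion)
    with AE' show ?thesis by eventually_elim (auto simp: G_def)
  qed
  obtain \<D> where \<D>: "countable \<D>" "\<D> \<subseteq> Pow U" "\<And>X. X \<in> \<D> \<Longrightarrow> \<exists>a b. X = cbox a b" "\<Union>\<D> = U"
    using open_countable_Union_open_cbox[OF U] by metis
  have "AE x in lebesgue. x \<in> X \<longrightarrow> g x = 0" if XD: "X \<in> \<D>" for X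
  proof -
    obtain a b where X: "X = cbox a b" using \<D>(3)[OF XD] by blast
    have "AE x in lebesgue. x \<notin> cbox a b - box a b"
      using negligible_frontier_interval[of a b] AE_not_in unfolding negligible_iff_null_sets by blast
    moreover have "AE x in lebesgue. x \<in> box a b \<longrightarrow> g x = 0"
      using AEbox X XD \<D>(2) by blast
    ultimately show ?thesis by eventually_elim (use X in auto)
  qed
  then have "AE x in lebesgue. \<forall>X\<in>\<D>. x \<in> X \<longrightarrow> g x = 0"
    by (subst AE_ball_countable[OF \<D>(1)]) blast
  then show ?thesis by eventually_elim (use \<D>(4) in auto)
qed

text \<open>By its definition \<open>weak_partial\<close> is some weak derivative, locally integrable at first. It agrees almost
  everywhere with the weak derivative in \<open>Lp_loc p U\<close> whose existence membership in the Sobolev space asserts.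
  This rules out that the Sobolev norm is small merely because an integral in it diverges and has the default value
  \<open>0\<close>.\<close>

lemma weak_partial_in_Lp_loc:
  fixes u :: "real^'n::finite \<Rightarrow> real"
  assumes U: "open U" and u: "u \<in> W1p_loc p U"
  shows "is_weak_partial U i u (weak_partial U i u)" "weak_partial U i u \<in> Lp_loc p U"
proof -
  obtain w where w: "w \<in> Lp_loc p U" "is_weak_partial U i u w" using u by (auto simp: W1p_loc_def)
  let ?v = "weak_partial U i u"
  show v: "is_weak_partial U i u ?v" unfolding weak_partial_def
    by (rule someI[where P = "is_weak_partial U i u", OF w(2)])
  have w1: "w \<in> Lp_loc 1 U" and v1: "?v \<in> Lp_loc 1 U" using v w(2) by (auto simp: is_weak_partial_def)
  have "(\<lambda>x. w x - ?v x) \<in> Lp_loc 1 U"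
    unfolding Lp_loc_def
  proof (intro CollectI conjI allI impI)
    show "(\<lambda>x. w x - ?v x) \<in> borel_measurable (lebesgue_on U)"
      using w1 v1 by (auto simp: Lp_loc_def)
    fix K assume "compact K \<and> K \<subseteq> U"
    then have "integrable (lebesgue_on K) (\<lambda>x. w x - ?v x)"
      using Lp_loc_1_integrable[OF w1] Lp_loc_1_integrable[OF v1] by auto
    then show "integrable (lebesgue_on K) (\<lambda>x. \<bar>w x - ?v x\<bar> powr 1)" by simp
  qed
  moreover have "integral\<^sup>L (lebesgue_on U) (\<lambda>x. (w x - ?v x) * \<psi> x) = 0" if \<psi>: "\<psi> \<in> test_functions U" for \<psi>
  proof -
    have "integral\<^sup>L (lebesgue_on U) (\<lambda>x. w x * \<psi> x) = integral\<^sup>L (lebesgue_on U) (\<lambda>x. ?v x * \<psi> x)"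
      using v w(2) \<psi> by (auto simp: is_weak_partial_def)
    then show ?thesis
      using test_function_integrable[OF U w1 \<psi>] test_function_integrable[OF U v1 \<psi>]
      by (simp add: left_diff_distrib)
  qed
  ultimately have "AE x in lebesgue. x \<in> U \<longrightarrow> w x - ?v x = 0"
    by (rule AE_zero_if_test_integrals_zero[OF U])
  then have AE: "AE x in lebesgue_on K. w x = ?v x" if "compact K" "K \<subseteq> U" for K
    using that compact_lebesgue[OF that(1)] by (subst AE_restrict_space_iff) (auto elim!: eventually_mono)
  have vm: "?v \<in> borel_measurable (lebesgue_on K)" and wm: "w \<in> borel_measurable (lebesgue_on K)" if "K \<subseteq> U" for K
    using v1 w1 that measurable_restrict_mono[of _ lebesgue U borel K] by (auto simp: Lp_loc_def)
  show "?v \<in> Lp_loc p U"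
    unfolding Lp_loc_def
  proof (intro CollectI conjI allI impI)
    show "?v \<in> borel_measurable (lebesgue_on U)" using v1 by (simp add: Lp_loc_def)
    fix K assume K: "compact K \<and> K \<subseteq> U"
    then have "integrable (lebesgue_on K) (\<lambda>x. \<bar>w x\<bar> powr p)" using w(1) by (simp add: Lp_loc_def)
    moreover have "AE x in lebesgue_on K. \<bar>w x\<bar> powr p = \<bar>?v x\<bar> powr p"
      using AE[of K] K by (auto elim!: eventually_mono)
    ultimately show "integrable (lebesgue_on K) (\<lambda>x. \<bar>?v x\<bar> powr p)"
      using vm[of K] wm[of K] K
      by (subst integrable_cong_AE[symmetric, of "\<lambda>x. \<bar>w x\<bar> powr p"]) auto
  qed
qed

section \<open>Morrey's inequality\<close>

text \<open>Hoelder's inequality against the constant function \<open>1\<close>, up to the factor \<open>2\<close>: integrate the elementary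
  inequality \<open>t \<le> \<tau> + \<tau>\<^sup>1\<^sup>-\<^sup>p t\<^sup>p\<close>.\<close>

lemma integral_abs_le_Lp:
  fixes w :: "real^'n::finite \<Rightarrow> real"
  assumes p: "p \<ge> 1" and w: "w \<in> borel_measurable (lebesgue_on K)"
    and int: "integrable (lebesgue_on K) (\<lambda>x. \<bar>w x\<bar> powr p)"
    and \<eta>: "\<eta> > 0" "integral\<^sup>L (lebesgue_on K) (\<lambda>x. \<bar>w x\<bar> powr p) \<le> \<eta> powr p"
    and K: "compact K" and B: "compact B" "B \<subseteq> K" and m: "measure lebesgue B \<le> m" "m > 0"
  shows "integrable lebesgue (\<lambda>x. indicator B x * \<bar>w x\<bar>)"
    and "integral\<^sup>L lebesgue (\<lambda>x. indicator B x * \<bar>w x\<bar>) \<le> 2 * \<eta> * m powr (1 - 1 / p)"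
proof -
  (* this value balances the two terms after integration over B *)
  define \<tau> where "\<tau> = \<eta> * m powr (- 1 / p)"
  have \<tau>: "\<tau> > 0" using \<eta>(1) m(2) by (simp add: \<tau>_def)
  have pw: "t \<le> \<tau> + \<tau> powr (1 - p) * t powr p" if "t \<ge> 0" for t
  proof (cases "t \<le> \<tau>")
    case True then show ?thesis using \<tau> by (simp add: add_increasing2)
  next
    case False
    then have t: "t > 0" using \<tau> by linarith
    have "t = t powr (1 - p) * t powr p" using t by (simp add: powr_add[symmetric])
    also have "\<dots> \<le> \<tau> powr (1 - p) * t powr p"
      using False p \<tau> by (intro mult_right_mono powr_mono2') auto
    finally show ?thesis using \<tau> by linarith
  qed
  have KL: "K \<inter> space lebesgue \<in> sets lebesgue" and BL: "B \<in> sets lebesgue"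
    using compact_lebesgue K B(1) by auto
  have wp: "integrable lebesgue (\<lambda>x. indicator K x * \<bar>w x\<bar> powr p)"
    using int integrable_restrict_space[OF KL, of "\<lambda>x. \<bar>w x\<bar> powr p"] by simp
  have wp_le: "integral\<^sup>L lebesgue (\<lambda>x. indicator K x * \<bar>w x\<bar> powr p) \<le> \<eta> powr p"
    using \<eta>(2) integral_restrict_space[OF KL, of "\<lambda>x. \<bar>w x\<bar> powr p"] by simp
  have Bi: "integrable lebesgue (indicator B :: real^'n \<Rightarrow> real)"
    using B(1) by (intro integrable_real_indicator BL) (use lmeasurable_compact[OF B(1)] in \<open>simp add: fmeasurable_def del: emeasure_completion\<close>)
  have wm: "(\<lambda>x. indicator B x * \<bar>w x\<bar>) \<in> borel_measurable lebesgue"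
  proof -
    have "(\<lambda>x. \<bar>w x\<bar>) \<in> borel_measurable (lebesgue_on B)"
      using measurable_restrict_mono[OF w B(2)] by (rule borel_measurable_abs)
    then show ?thesis using borel_measurable_restrict_space_iff[of B lebesgue "\<lambda>x. \<bar>w x\<bar>"] BL by simp
  qed
  have dom: "indicator B x * \<bar>w x\<bar> \<le> \<tau> * indicator B x + \<tau> powr (1 - p) * (indicator K x * \<bar>w x\<bar> powr p)" for x
    using pw[of "\<bar>w x\<bar>"] B(2) by (auto simp: indicator_def)
  have domi: "integrable lebesgue (\<lambda>x. \<tau> * indicator B x + \<tau> powr (1 - p) * (indicator K x * \<bar>w x\<bar> powr p))"
    using Bi wp by (intro Bochner_Integration.integrable_add integrable_mult_right) auto
  show 1: "integrable lebesgue (\<lambda>x. indicator B x * \<bar>w x\<bar>)"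
  proof (rule Bochner_Integration.integrable_bound[OF domi wm], intro AE_I2)
    fix x
    have "0 \<le> indicator B x * \<bar>w x\<bar>" by simp
    then show "norm (indicator B x * \<bar>w x\<bar>) \<le> norm (\<tau> * indicator B x + \<tau> powr (1 - p) * (indicator K x * \<bar>w x\<bar> powr p))"
      using dom[of x] by simp
  qed
  have "integral\<^sup>L lebesgue (\<lambda>x. indicator B x * \<bar>w x\<bar>)
      \<le> integral\<^sup>L lebesgue (\<lambda>x. \<tau> * indicator B x + \<tau> powr (1 - p) * (indicator K x * \<bar>w x\<bar> powr p))"
    by (rule integral_mono[OF 1 domi]) (rule dom)
  also have "\<dots> = \<tau> * measure lebesgue B + \<tau> powr (1 - p) * integral\<^sup>L lebesgue (\<lambda>x. indicator K x * \<bar>w x\<bar> powr p)"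
    using Bi wp BL by simp
  also have "\<dots> \<le> \<tau> * m + \<tau> powr (1 - p) * \<eta> powr p"
    using \<tau> m wp_le by (intro add_mono mult_left_mono) auto
  also have "\<tau> * m = \<eta> * m powr (1 - 1 / p)"
    using m(2) powr_add[of m "- 1 / p" 1] by (simp add: \<tau>_def)
  also have "\<tau> powr (1 - p) * \<eta> powr p = \<eta> * m powr (1 - 1 / p)"
  proof -
    have "\<tau> powr (1 - p) = \<eta> powr (1 - p) * m powr (- 1 / p * (1 - p))"
      using \<eta>(1) m(2) by (simp add: \<tau>_def powr_mult powr_powr)
    moreover have "- 1 / p * (1 - p) = 1 - 1 / p" using p by (simp add: field_simps)
    moreover have "\<eta> powr (1 - p) * \<eta> powr p = \<eta>" using \<eta>(1) by (simp add: powr_add[symmetric])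
    ultimately show ?thesis by (simp add: mult.assoc mult.commute[of "m powr _"])
  qed
  finally show "integral\<^sup>L lebesgue (\<lambda>x. indicator B x * \<bar>w x\<bar>) \<le> 2 * \<eta> * m powr (1 - 1 / p)" by simp
qed

lemma cball_subset_cbox_cart: "cball x e \<subseteq> cbox (x - (\<chi> i. e)) (x + (\<chi> i. e))" for x :: "real^'n::finite"
proof
  fix y assume "y \<in> cball x e"
  then have "\<bar>(y - x) $ i\<bar> \<le> e" for i
    using component_le_norm_cart[of "y - x" i] by (simp add: dist_norm norm_minus_commute)
  then show "y \<in> cbox (x - (\<chi> i. e)) (x + (\<chi> i. e))"
    by (auto simp: mem_box_cart abs_le_iff algebra_simps)
qed

lemma cbox_subset_cball_cart:
  fixes x :: "real^'n::finite"
  assumes "real CARD('n) * r \<le> \<delta>"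
  shows "cbox (x - (\<chi> i. r)) (x + (\<chi> i. r)) \<subseteq> cball x \<delta>"
proof
  fix y assume y: "y \<in> cbox (x - (\<chi> i. r)) (x + (\<chi> i. r))"
  have "\<bar>(y - x) $ i\<bar> \<le> r" for i
    using y by (auto simp: mem_box_cart abs_le_iff algebra_simps)
  then have "norm (y - x) \<le> (\<Sum>i\<in>(UNIV :: 'n set). r)"
    using norm_le_l1_cart[of "y - x"] sum_mono[of UNIV "\<lambda>i. \<bar>(y - x) $ i\<bar>" "\<lambda>i. r"] by fastforce
  then show "y \<in> cball x \<delta>" using assms by (simp add: dist_norm norm_minus_commute)
qed

lemma measure_cball_le:
  fixes x :: "real^'n::finite"
  assumes "e > 0" shows "measure lebesgue (cball x e) \<le> (2 * e) ^ CARD('n)"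
proof -
  have "measure lebesgue (cball x e) \<le> measure lebesgue (cbox (x - (\<chi> i. e)) (x + (\<chi> i. e)))"
    by (rule measure_mono_fmeasurable[OF cball_subset_cbox_cart]) auto
  also have "\<dots> = (\<Prod>i\<in>(UNIV::'n set). 2 * e)"
  proof -
    have "x \<in> cbox (x - (\<chi> i. e)) (x + (\<chi> i. e))" using assms by (simp add: mem_box_cart)
    then have "cbox (x - (\<chi> i. e)) (x + (\<chi> i. e)) \<noteq> {}" by blast
    from content_cbox_cart[OF this] show ?thesis by simp
  qed
  finally show ?thesis by simp
qed

lemma integral_mult_kernel_le:
  fixes w \<phi> :: "real^'n::finite \<Rightarrow> real"
  assumes U: "open U" and p: "p \<ge> 1" and w: "w \<in> Lp_loc p U" and K: "compact K" "K \<subseteq> U"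
    and \<eta>: "\<eta> > 0" "integral\<^sup>L (lebesgue_on K) (\<lambda>x. \<bar>w x\<bar> powr p) \<le> \<eta> powr p"
    and e: "e > 0" "cball x e \<subseteq> K"
    and \<phi>: "\<And>y. y \<notin> cball x e \<Longrightarrow> \<phi> y = 0" "\<And>y. \<bar>\<phi> y\<bar> \<le> C" 
  shows "\<bar>integral\<^sup>L (lebesgue_on U) (\<lambda>y. w y * \<phi> y)\<bar> \<le> C * (2 * \<eta> * ((2 * e) ^ CARD('n)) powr (1 - 1 / p))"
proof -
  have C: "0 \<le> C" using \<phi>(2)[of x] by linarith
  have wm: "w \<in> borel_measurable (lebesgue_on K)" by (rule Lp_loc_measurable[OF w K(2)])
  have wp: "integrable (lebesgue_on K) (\<lambda>x. \<bar>w x\<bar> powr p)" by (rule Lp_loc_integrable_powr[OF w K])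
  have m: "measure lebesgue (cball x e) \<le> (2 * e) ^ CARD('n)" "0 < (2 * e) ^ CARD('n)"
    using measure_cball_le[OF e(1)] e(1) by auto
  note L = integral_abs_le_Lp[OF p wm wp \<eta> K(1) compact_cball e(2) m]
  have "integral\<^sup>L (lebesgue_on U) (\<lambda>y. w y * \<phi> y) = integral\<^sup>L lebesgue (\<lambda>y. (indicator (cball x e) y * w y) * \<phi> y)"
    by (rule lebesgue_on_integral_eq(1)[OF U _ \<phi>(1)]) (use e(2) K(2) in auto)
  also have "\<bar>\<dots>\<bar> \<le> integral\<^sup>L lebesgue (\<lambda>y. C * (indicator (cball x e) y * \<bar>w y\<bar>))"
  proof (cases "integrable lebesgue (\<lambda>y. (indicator (cball x e) y * w y) * \<phi> y)")
    case True
    have "\<bar>integral\<^sup>L lebesgue (\<lambda>y. (indicator (cball x e) y * w y) * \<phi> y)\<bar>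
       \<le> integral\<^sup>L lebesgue (\<lambda>y. \<bar>(indicator (cball x e) y * w y) * \<phi> y\<bar>)" by (rule integral_abs_bound)
    also have "\<dots> \<le> integral\<^sup>L lebesgue (\<lambda>y. C * (indicator (cball x e) y * \<bar>w y\<bar>))"
    proof (rule integral_mono)
      fix y
      show "\<bar>(indicator (cball x e) y * w y) * \<phi> y\<bar> \<le> C * (indicator (cball x e) y * \<bar>w y\<bar>)"
        using mult_right_mono[OF \<phi>(2)[of y], of "\<bar>w y\<bar>"] by (auto simp: indicator_def abs_mult mult.commute)
    qed (use True L(1) in \<open>auto intro!: integrable_mult_right\<close>)
    finally show ?thesis .
  next
    case False
    then show ?thesis using C by (simp add: not_integrable_integral_eq)
  qed
  also have "\<dots> = C * integral\<^sup>L lebesgue (\<lambda>y. indicator (cball x e) y * \<bar>w y\<bar>)" by simp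
  also have "\<dots> \<le> C * (2 * \<eta> * ((2 * e) ^ CARD('n)) powr (1 - 1 / p))"
    by (rule mult_left_mono[OF L(2) C])
  finally show ?thesis .
qed

lemma lebesgue_on_integral_eq_integral_cbox:
  fixes g \<phi> :: "real^'n::finite \<Rightarrow> real"
  assumes U: "open U" and B: "cbox a b \<subseteq> U" and off: "\<And>x. x \<notin> cbox a b \<Longrightarrow> \<phi> x = 0"
    and c: "continuous_on (cbox a b) g" "continuous_on (cbox a b) \<phi>"
  shows "integral\<^sup>L (lebesgue_on U) (\<lambda>x. g x * \<phi> x) = integral (cbox a b) (\<lambda>x. g x * \<phi> x)"
proof -
  have BL: "cbox a b \<inter> space lebesgue \<in> sets lebesgue" by simp
  have "integral\<^sup>L (lebesgue_on U) (\<lambda>x. g x * \<phi> x) = integral\<^sup>L lebesgue (\<lambda>x. (indicator (cbox a b) x * g x) * \<phi> x)"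
    by (rule lebesgue_on_integral_eq(1)[OF U B off])
  also have "\<dots> = integral\<^sup>L (lebesgue_on (cbox a b)) (\<lambda>x. g x * \<phi> x)"
    by (subst integral_restrict_space[OF BL]) (simp add: mult.assoc)
  also have "\<dots> = integral (cbox a b) (\<lambda>x. g x * \<phi> x)"
    by (rule lebesgue_integral_eq_integral) (auto intro!: continuous_imp_integrable continuous_intros c)
  finally show ?thesis .
qed

text \<open>A kernel concentrated near \<open>x\<close> whose mass does not depend on the scale \<open>e\<close>. Next to it, \<open>kern'\<close> is its
  derivative with respect to \<open>e\<close>, and \<open>kern_field\<close> consists of the components of the vector field
  \<open>((y - x) / e) * kern x e y\<close>. The divergence of this field is \<open>- kern'\<close>, as the mass is only transported when
  the scale changes.\<close>

definition kern :: "real^'n \<Rightarrow> real \<Rightarrow> real^'n::finite \<Rightarrow> real" where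
  "kern x e y = bump e (y - x) / e ^ CARD('n)"

definition kern' :: "real^'n \<Rightarrow> real \<Rightarrow> real^'n::finite \<Rightarrow> real" where
  "kern' x e y = - (real CARD('n) / e ^ (CARD('n) + 1)) * expinv 0 (1 - (norm (y - x))\<^sup>2 / e\<^sup>2)
     + (2 * (norm (y - x))\<^sup>2 / e ^ (CARD('n) + 3)) * expinv 2 (1 - (norm (y - x))\<^sup>2 / e\<^sup>2)"

definition kern_field :: "real^'n \<Rightarrow> real \<Rightarrow> 'n \<Rightarrow> real^'n::finite \<Rightarrow> real" where
  "kern_field x e i y = (y $ i - x $ i) * bump e (y - x) / e ^ (CARD('n) + 1)"

lemma expinv_0_has_derivative: "(expinv 0 has_real_derivative expinv 2 x) (at x)"
  using expinv_has_derivative[of 0 x] by (simp add: numeral_2_eq_2)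

lemma kern_has_derivative:
  assumes "e > 0"
  shows "((\<lambda>e. kern x e y) has_real_derivative kern' x e y) (at e)"
proof -
  let ?n = "CARD('a)"
  let ?a = "1 - (norm (y - x))\<^sup>2 / e\<^sup>2"
  have 1: "((\<lambda>e. 1 - (norm (y - x))\<^sup>2 / e\<^sup>2) has_real_derivative 2 * (norm (y - x))\<^sup>2 / e ^ 3) (at e)"
    using assms by (auto intro!: derivative_eq_intros simp: field_simps power2_eq_square power3_eq_cube)
  have "((\<lambda>e. bump e (y - x)) has_real_derivative
      (expinv 2 ?a * (2 * (norm (y - x))\<^sup>2 / e ^ 3))) (at e)"
    unfolding bump_def using DERIV_chain2[OF expinv_0_has_derivative 1] by (simp add: mult.commute)
  moreover have "((\<lambda>e. e ^ ?n) has_real_derivative real ?n * e ^ (?n - 1)) (at e)"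
    using DERIV_pow[of ?n e UNIV] by simp
  ultimately have "((\<lambda>e. bump e (y - x) / e ^ ?n) has_real_derivative
     ((expinv 2 ?a * (2 * (norm (y - x))\<^sup>2 / e ^ 3)) * e ^ ?n - bump e (y - x) * (real ?n * e ^ (?n - 1))) / (e ^ ?n * e ^ ?n)) (at e)"
    by (rule DERIV_divide) (use assms in auto)
  also have "((expinv 2 ?a * (2 * (norm (y - x))\<^sup>2 / e ^ 3)) * e ^ ?n - bump e (y - x) * (real ?n * e ^ (?n - 1))) / (e ^ ?n * e ^ ?n)
     = kern' x e y"
  proof -
    have n: "e ^ ?n = e * e ^ (?n - 1)"
      by (metis One_nat_def Suc_pred power_Suc zero_less_card_finite)
    define k where "k = e ^ (?n - 1)"
    have "k > 0" using assms by (simp add: k_def)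
    then show ?thesis
      unfolding kern'_def bump_def power_add n k_def[symmetric] using assms
      by (simp add: field_simps power3_eq_cube)
  qed
  finally show ?thesis by (simp add: kern_def[abs_def])
qed

lemma partial_deriv_kern_field:
  fixes x :: "real^'n::finite"
  assumes "e > 0"
  shows "partial_deriv i (kern_field x e i) y =
    (expinv 0 (1 - (norm (y - x))\<^sup>2 / e\<^sup>2) - 2 * ((y - x) $ i)\<^sup>2 / e\<^sup>2 * expinv 2 (1 - (norm (y - x))\<^sup>2 / e\<^sup>2)) / e ^ (CARD('n) + 1)"
proof -
  let ?a = "\<lambda>y. 1 - (1 / e\<^sup>2) * ((y - x) \<bullet> (y - x))"
  have 1: "(?a has_derivative (\<lambda>h. - (2 * (h \<bullet> (y - x)) / e\<^sup>2))) (at y)"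
  proof -
    have "((\<lambda>y. (y - x) \<bullet> (y - x)) has_derivative (\<lambda>h. 2 * (h \<bullet> (y - x)))) (at y)"
      by (auto intro!: derivative_eq_intros simp: inner_commute)
    from has_derivative_diff[OF has_derivative_const has_derivative_mult_right[OF this, of "1 / e\<^sup>2"]]
    show ?thesis by simp
  qed
  have 2: "((\<lambda>y. expinv 0 (?a y)) has_derivative (\<lambda>h. - (2 * (h \<bullet> (y - x)) / e\<^sup>2) * expinv 2 (?a y))) (at y)"
    using DERIV_compose_FDERIV[OF expinv_0_has_derivative 1] by (simp add: mult.commute)
  have 3: "((\<lambda>y. y $ i - x $ i) has_derivative (\<lambda>h. h $ i)) (at y)"
    by (auto intro!: derivative_eq_intros bounded_linear_imp_has_derivative bounded_linear_vec_nth)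
  have "((\<lambda>y. (1 / e ^ (CARD('n) + 1)) * ((y $ i - x $ i) * expinv 0 (?a y))) has_derivative
     (\<lambda>h. (1 / e ^ (CARD('n) + 1)) * ((y $ i - x $ i) * (- (2 * (h \<bullet> (y - x)) / e\<^sup>2) * expinv 2 (?a y)) + h $ i * expinv 0 (?a y)))) (at y)"
    by (intro has_derivative_mult_right has_derivative_mult 2 3)
  also have "(\<lambda>y. (1 / e ^ (CARD('n) + 1)) * ((y $ i - x $ i) * expinv 0 (?a y))) = kern_field x e i"
    by (simp add: kern_field_def fun_eq_iff bump_def power2_norm_eq_inner)
  finally have D: "(kern_field x e i has_derivative
     (\<lambda>h. (1 / e ^ (CARD('n) + 1)) * ((y $ i - x $ i) * (- (2 * (h \<bullet> (y - x)) / e\<^sup>2) * expinv 2 (?a y)) + h $ i * expinv 0 (?a y)))) (at y)" .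
  have alg: "(1 / N) * (z * (- (2 * z / c) * E2) + 1 * E0) = (E0 - 2 * z\<^sup>2 / c * E2) / N" for N z c E0 E2 :: real
    by (simp add: power2_eq_square)
  have a: "?a y = 1 - (norm (y - x))\<^sup>2 / e\<^sup>2" by (simp add: power2_norm_eq_inner)
  show ?thesis
    unfolding partial_deriv_eqI[OF D] a
    using alg[of "e ^ (CARD('n) + 1)" "(y - x) $ i" "e\<^sup>2"] by (simp add: inner_axis')
qed

lemma sum_partial_deriv_kern_field:
  fixes x :: "real^'n::finite"
  assumes "e > 0"
  shows "(\<Sum>i\<in>UNIV. partial_deriv i (kern_field x e i) y) = - kern' x e y"
proof -
  let ?E0 = "expinv 0 (1 - (norm (y - x))\<^sup>2 / e\<^sup>2)" and ?E2 = "expinv 2 (1 - (norm (y - x))\<^sup>2 / e\<^sup>2)"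
  have "(\<Sum>i\<in>UNIV. partial_deriv i (kern_field x e i) y) =
      (\<Sum>i\<in>(UNIV::'n set). ?E0 / e ^ (CARD('n) + 1) - ((y - x) $ i)\<^sup>2 * (2 / e\<^sup>2 * ?E2 / e ^ (CARD('n) + 1)))"
    by (intro sum.cong refl, subst partial_deriv_kern_field[OF assms]) (simp add: diff_divide_distrib)
  also have "\<dots> = real CARD('n) * (?E0 / e ^ (CARD('n) + 1)) - (\<Sum>i\<in>UNIV. ((y - x) $ i)\<^sup>2) * (2 / e\<^sup>2 * ?E2 / e ^ (CARD('n) + 1))"
    unfolding sum_subtractf sum_distrib_right[symmetric] by simp
  also have "(\<Sum>i\<in>UNIV. ((y - x) $ i)\<^sup>2) = (norm (y - x))\<^sup>2"
    unfolding power2_norm_eq_inner inner_vec_def by (simp add: power2_eq_square)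
  also have "real CARD('n) * (?E0 / e ^ (CARD('n) + 1)) - (norm (y - x))\<^sup>2 * (2 / e\<^sup>2 * ?E2 / e ^ (CARD('n) + 1)) = - kern' x e y"
    using assms by (simp add: kern'_def power_add power2_eq_square power3_eq_cube ac_simps)
  finally show ?thesis .
qed

lemma smooth_shift_bump: "smooth (\<lambda>y. bump e (y - x))"
proof -
  have "smooth (\<lambda>y. 1 - (1 / e\<^sup>2) * (norm (y - x))\<^sup>2)"
    by (intro smooth_intros smooth_norm_sq)
  from smooth_expinv[OF this, of 0] show ?thesis by (simp add: bump_def)
qed

lemma smooth_kern_field: "smooth (kern_field x e i)"
proof -
  have "smooth (\<lambda>y. (1 / e ^ (CARD('a) + 1)) * ((y $ i - x $ i) * bump e (y - x)))"
    by (intro smooth_mult smooth_diff smooth_nth smooth_const smooth_shift_bump)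
  then show ?thesis by (simp add: kern_field_def[abs_def])
qed

lemma kern_field_eq_0: "e > 0 \<Longrightarrow> y \<notin> cball x e \<Longrightarrow> kern_field x e i y = 0"
  using bump_eq_0[of e "y - x"] by (simp add: kern_field_def dist_norm norm_minus_commute)

lemma kern_field_bound:
  fixes x :: "real^'n::finite"
  assumes "e > 0" shows "\<bar>kern_field x e i y\<bar> \<le> 1 / e ^ CARD('n)"
proof (cases "y \<in> cball x e")
  case True
  have "\<bar>y $ i - x $ i\<bar> \<le> e"
    using True component_le_norm_cart[of "y - x" i] by (simp add: dist_norm norm_minus_commute)
  then have "\<bar>(y $ i - x $ i) * bump e (y - x)\<bar> \<le> e * 1"
    unfolding abs_mult using bump_nonneg[of e "y - x"] bump_le_1[of e "y - x"] assms
    by (intro mult_mono) auto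
  then have "\<bar>(y $ i - x $ i) * bump e (y - x)\<bar> / e ^ (CARD('n) + 1) \<le> e / e ^ (CARD('n) + 1)"
    using assms by (intro divide_right_mono) auto
  then have "\<bar>kern_field x e i y\<bar> \<le> e / e ^ (CARD('n) + 1)"
    unfolding kern_field_def abs_divide using assms by simp
  then show ?thesis using assms by simp
next
  case False
  then show ?thesis using assms kern_field_eq_0[OF assms False] by simp
qed

lemma kern_nonneg: "e > 0 \<Longrightarrow> 0 \<le> kern x e y"
  by (simp add: kern_def bump_nonneg)

lemma kern_eq_0: "e > 0 \<Longrightarrow> y \<notin> cball x e \<Longrightarrow> kern x e y = 0"
  using bump_eq_0[of e "y - x"] by (simp add: kern_def dist_norm norm_minus_commute)

lemma continuous_on_kern: "continuous_on T (kern x e)"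
  unfolding kern_def[abs_def] divide_inverse
  by (intro continuous_intros smooth_continuous[OF smooth_shift_bump])

lemma integral_kern:
  fixes x :: "real^'n::finite"
  assumes "e > 0" "cball x e \<subseteq> cbox a b"
  shows "integral (cbox a b) (kern x e) = integral\<^sup>L lborel (bump 1 :: real^'n \<Rightarrow> real)"
proof -
  have off: "kern x e y = 0" if "y \<notin> cbox a b" for y
    using that assms by (intro kern_eq_0) auto
  have "integral (cbox a b) (kern x e) = integral\<^sup>L lborel (kern x e)"
    by (rule lborel_integral_eq_integral_cbox[OF continuous_on_kern off, symmetric])
  also have "\<dots> = integral\<^sup>L lborel (\<lambda>y. bump e (y - x)) / e ^ CARD('n)"
    by (simp add: kern_def[abs_def])
  also have "integral\<^sup>L lborel (\<lambda>y. bump e (y - x)) = integral\<^sup>L lborel (\<lambda>y. bump e (x - y))"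
  proof -
    have "bump e (y - x) = bump e (x - y)" for y
      unfolding bump_def by (simp only: norm_minus_commute)
    then show ?thesis by (simp only:)
  qed
  also have "\<dots> = integral\<^sup>L lborel (bump e :: real^'n \<Rightarrow> real)"
    by (intro lborel_integral_reflect_shift borel_measurable_continuous_onI continuous_on_bump)
  finally show ?thesis using assms(1) by (simp add: integral_bump_scale[OF assms(1)])
qed

lemma continuous_expinv: "continuous_on T (expinv m)"
  using expinv_has_derivative DERIV_isCont continuous_at_imp_continuous_on by blast

text \<open>The derivative of the kernel with respect to the scale is a divergence, and the definition of weak derivatives
  moves that divergence onto \<open>u\<close>.\<close>

lemma kern_average_has_derivative:
  fixes u :: "real^'n::finite \<Rightarrow> real"
  assumes U: "open U" and c: "continuous_on U u"
    and B: "cbox a b \<subseteq> U" and e: "e > 0" "cball x e \<subseteq> cbox a b"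
    and w: "\<And>i. is_weak_partial U i u (w i)"
  shows "((\<lambda>e. integral (cbox a b) (\<lambda>y. u y * kern x e y)) has_real_derivative
     (\<Sum>i\<in>UNIV. integral\<^sup>L (lebesgue_on U) (\<lambda>y. w i y * kern_field x e i y))) (at e)"
proof -
  have cB: "continuous_on (cbox a b) u" using c B continuous_on_subset by blast
  have "((\<lambda>e. integral (cbox a b) (\<lambda>y. u y * kern x e y)) has_real_derivative
     integral (cbox a b) (\<lambda>y. u y * kern' x e y)) (at e within {0<..})"
  proof (rule leibniz_rule_field_derivative)
    fix e y :: "real" and z :: "real^'n" assume "e \<in> {0<..}"
    then show "((\<lambda>e. u z * kern x e z) has_real_derivative u z * kern' x e z) (at e within {0<..})"
      by (intro DERIV_cmult has_field_derivative_at_within[OF kern_has_derivative]) auto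
  next
    fix e :: real
    show "(\<lambda>y. u y * kern x e y) integrable_on cbox a b"
      by (intro integrable_continuous continuous_intros cB continuous_on_kern)
  next
    show "continuous_on ({0<..} \<times> cbox a b) (\<lambda>(e, y). u y * kern' x e y)"
      unfolding kern'_def split_beta
      by (intro continuous_intros continuous_on_compose2[OF cB] continuous_on_compose2[OF continuous_expinv[of UNIV]]) auto
  qed (use e in auto)
  then have D: "((\<lambda>e. integral (cbox a b) (\<lambda>y. u y * kern x e y)) has_real_derivative
     integral (cbox a b) (\<lambda>y. u y * kern' x e y)) (at e)"
    using e(1) by (simp add: at_within_open[of e "{0<..}"])
  have pc: "continuous_on T (partial_deriv i (kern_field x e i))" for i T
    by (intro smooth_continuous smooth_partial_deriv smooth_kern_field)
  have off: "partial_deriv i (kern_field x e i) y = 0" if "y \<notin> cbox a b" for i y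
  proof -
    have "grad (kern_field x e i) y = 0"
      by (rule grad_eq_0_off_support[of "- cball x e"])
         (use that e kern_field_eq_0[OF e(1)] in \<open>auto simp: open_Compl\<close>)
    then show ?thesis by (metis grad_def vec_lambda_beta zero_index)
  qed
  have "integral (cbox a b) (\<lambda>y. u y * kern' x e y)
     = integral (cbox a b) (\<lambda>y. \<Sum>i\<in>UNIV. - (u y * partial_deriv i (kern_field x e i) y))"
  proof (rule arg_cong[where f = "integral (cbox a b)"], rule ext)
    fix y
    have "kern' x e y = - (\<Sum>i\<in>UNIV. partial_deriv i (kern_field x e i) y)"
      using sum_partial_deriv_kern_field[OF e(1), of x y] by simp
    then show "u y * kern' x e y = (\<Sum>i\<in>UNIV. - (u y * partial_deriv i (kern_field x e i) y))"
      by (simp add: sum_negf sum_distrib_left)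
  qed
  also have "\<dots> = (\<Sum>i\<in>UNIV. - integral (cbox a b) (\<lambda>y. u y * partial_deriv i (kern_field x e i) y))"
    by (subst integral_sum) (auto intro!: integrable_continuous continuous_intros cB pc)
  also have "\<dots> = (\<Sum>i\<in>UNIV. integral\<^sup>L (lebesgue_on U) (\<lambda>y. w i y * kern_field x e i y))"
  proof (rule sum.cong[OF refl])
    fix i
    have T: "kern_field x e i \<in> test_functions U"
      by (rule test_functionsI[OF smooth_kern_field compact_cball]) (use e B kern_field_eq_0[OF e(1)] in auto)
    have "integral (cbox a b) (\<lambda>y. u y * partial_deriv i (kern_field x e i) y)
        = integral\<^sup>L (lebesgue_on U) (\<lambda>y. u y * partial_deriv i (kern_field x e i) y)"
      by (rule lebesgue_on_integral_eq_integral_cbox[OF U B off cB pc, symmetric])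
    also have "\<dots> = - integral\<^sup>L (lebesgue_on U) (\<lambda>y. w i y * kern_field x e i y)"
      using w[of i] T unfolding is_weak_partial_def by blast
    finally show "- integral (cbox a b) (\<lambda>y. u y * partial_deriv i (kern_field x e i) y)
       = integral\<^sup>L (lebesgue_on U) (\<lambda>y. w i y * kern_field x e i y)" by simp
  qed
  finally show ?thesis using D by simp
qed

lemma kern_average_near:
  fixes u :: "real^'n::finite \<Rightarrow> real"
  assumes cB: "continuous_on (cbox a b) u" and e: "e > 0" "cball x e \<subseteq> cbox a b"
    and osc: "\<And>y. y \<in> cball x e \<Longrightarrow> \<bar>u y - u x\<bar> \<le> d"
  shows "\<bar>integral (cbox a b) (\<lambda>y. u y * kern x e y) - u x * integral\<^sup>L lborel (bump 1 :: real^'n \<Rightarrow> real)\<bar>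
     \<le> d * integral\<^sup>L lborel (bump 1 :: real^'n \<Rightarrow> real)"
proof -
  let ?c = "integral\<^sup>L lborel (bump 1 :: real^'n \<Rightarrow> real)"
  have int: "(\<lambda>y. u y * kern x e y) integrable_on cbox a b" "(\<lambda>y. u x * kern x e y) integrable_on cbox a b"
    "(\<lambda>y. d * kern x e y) integrable_on cbox a b"
    by (intro integrable_continuous continuous_intros cB continuous_on_kern)+
  have "integral (cbox a b) (\<lambda>y. u y * kern x e y) - u x * ?c
     = integral (cbox a b) (\<lambda>y. u y * kern x e y) - integral (cbox a b) (\<lambda>y. u x * kern x e y)"
    by (simp add: integral_kern[OF e])
  also have "\<dots> = integral (cbox a b) (\<lambda>y. u y * kern x e y - u x * kern x e y)"
    by (rule Henstock_Kurzweil_Integration.integral_diff[symmetric, OF int(1,2)])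
  also have "\<bar>\<dots>\<bar> \<le> integral (cbox a b) (\<lambda>y. d * kern x e y)"
    unfolding real_norm_def[symmetric]
  proof (rule Henstock_Kurzweil_Integration.integral_norm_bound_integral)
    show "(\<lambda>y. u y * kern x e y - u x * kern x e y) integrable_on cbox a b"
      by (rule integrable_diff[OF int(1,2)])
    fix y
    show "norm (u y * kern x e y - u x * kern x e y) \<le> d * kern x e y"
    proof (cases "y \<in> cball x e")
      case True
      then show ?thesis using mult_right_mono[OF osc[OF True] kern_nonneg[OF e(1), of x y]] kern_nonneg[OF e(1), of x y]
        by (simp add: left_diff_distrib[symmetric] abs_mult)
    next
      case False then show ?thesis using kern_eq_0[OF e(1) False] by simp
    qed
  qed (rule int)
  also have "\<dots> = d * ?c" by (simp add: integral_kern[OF e])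
  finally show ?thesis .
qed

text \<open>Let \<open>M e\<close> be the average of \<open>u\<close> against the kernel at scale \<open>e\<close>. As \<open>e\<close> tends to \<open>0\<close>, it tends to \<open>u x\<close>
  times the mass of the kernel; at \<open>e = r\<close> it is controlled by the \<open>L\<^sup>p\<close> norm of \<open>u\<close>. In between, Hoelder's
  inequality bounds \<open>M'\<close> by a multiple of \<open>e\<^sup>-\<^sup>\<beta>\<close>, which is integrable at \<open>0\<close> because \<open>p > CARD('n)\<close> means
  \<open>\<beta> < 1\<close>. The number \<open>\<eta>\<close> dominates all the \<open>L\<^sup>p\<close> norms involved.\<close>

lemma morrey_pointwise:
  fixes u :: "real^'n::finite \<Rightarrow> real"
  assumes U: "open U" and c: "continuous_on U u" and u: "u \<in> Lp_loc p U"
    and p: "p > real CARD('n)"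
    and w: "\<And>i. is_weak_partial U i u (w i)" "\<And>i. w i \<in> Lp_loc p U"
    and K: "compact K" "K \<subseteq> U" and r: "r > 0" "cball x (real CARD('n) * r) \<subseteq> K"
    and \<eta>: "\<eta> > 0" "integral\<^sup>L (lebesgue_on K) (\<lambda>x. \<bar>u x\<bar> powr p) \<le> \<eta> powr p"
      "\<And>i. integral\<^sup>L (lebesgue_on K) (\<lambda>x. \<bar>w i x\<bar> powr p) \<le> \<eta> powr p"
  defines "\<beta> \<equiv> real CARD('n) / p"
  shows "integral\<^sup>L lborel (bump 1 :: real^'n \<Rightarrow> real) * \<bar>u x\<bar> \<le>
    (2 * 2 ^ CARD('n) * r powr (- \<beta>) + real CARD('n) * 2 * 2 ^ CARD('n) * r powr (1 - \<beta>) / (1 - \<beta>)) * \<eta>"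
proof -
  let ?n = "CARD('n)"
  let ?c = "integral\<^sup>L lborel (bump 1 :: real^'n \<Rightarrow> real)"
  have n1: "1 \<le> real ?n" using zero_less_card_finite[where 'a='n] by linarith
  then have p1: "p \<ge> 1" and p0: "p > 0" using p by linarith+
  have \<beta>: "0 < \<beta>" "\<beta> < 1" using p p0 n1 by (auto simp: \<beta>_def)
  have c0: "?c > 0" by (rule integral_bump_pos) simp
  define a where "a = x - (\<chi> i. r)"
  define b where "b = x + (\<chi> i. r)"
  have ball_box: "cball x e \<subseteq> cbox a b" if "e \<le> r" for e
    using cball_subset_cbox_cart[of x r] that subset_cball[OF that] unfolding a_def b_def by blast
  have box_K: "cbox a b \<subseteq> K"
    using cbox_subset_cball_cart[of r "real ?n * r" x] r(2) unfolding a_def b_def by blast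
  have box_U: "cbox a b \<subseteq> U" using box_K K(2) by blast
  have cB: "continuous_on (cbox a b) u" using c box_U continuous_on_subset by blast
  have ball_K: "cball x e \<subseteq> K" if "e \<le> r" for e using ball_box[OF that] box_K by blast
  define M where "M e = integral (cbox a b) (\<lambda>y. u y * kern x e y)" for e
  define M' where "M' e = (\<Sum>i\<in>UNIV. integral\<^sup>L (lebesgue_on U) (\<lambda>y. w i y * kern_field x e i y))" for e
  have M': "(M has_real_derivative M' e) (at e)" if "0 < e" "e \<le> r" for e
    unfolding M_def[abs_def] M'_def
    by (rule kern_average_has_derivative[OF U c box_U that(1) ball_box[OF that(2)] w(1)])
  have kbound: "1 / e ^ ?n * (2 * \<eta> * ((2 * e) ^ ?n) powr (1 - 1 / p)) \<le> 2 * 2 ^ ?n * \<eta> * e powr (- \<beta>)" if e: "e > 0" for e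
  proof -
    have "((2 * e) ^ ?n) powr (1 - 1 / p) = (2 * e) powr (real ?n - \<beta>)"
    proof -
      have "(2 * e) ^ ?n = (2 * e) powr real ?n" using e by (subst powr_realpow) auto
      then show ?thesis by (simp add: powr_powr \<beta>_def right_diff_distrib)
    qed
    also have "\<dots> = 2 powr (real ?n - \<beta>) * (e ^ ?n * e powr (- \<beta>))"
      using e by (simp add: powr_mult powr_realpow[symmetric] powr_add[symmetric])
    also have "\<dots> \<le> 2 ^ ?n * (e ^ ?n * e powr (- \<beta>))"
      using e \<beta> powr_mono[of "real ?n - \<beta>" "real ?n" 2] by (intro mult_right_mono) (auto simp: powr_realpow)
    finally have "2 * \<eta> * ((2 * e) ^ ?n) powr (1 - 1 / p) \<le> 2 * \<eta> * (2 ^ ?n * (e ^ ?n * e powr (- \<beta>)))"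
      using \<eta>(1) by (intro mult_left_mono) auto
    then have "1 / e ^ ?n * (2 * \<eta> * ((2 * e) ^ ?n) powr (1 - 1 / p)) \<le> 1 / e ^ ?n * (2 * \<eta> * (2 ^ ?n * (e ^ ?n * e powr (- \<beta>))))"
      by (rule mult_left_mono) (use e in simp)
    also have "\<dots> = 2 * 2 ^ ?n * \<eta> * e powr (- \<beta>)" using e by simp
    finally show ?thesis .
  qed
  define D where "D = real ?n * (2 * 2 ^ ?n * \<eta>)"
  have M'_bound: "\<bar>M' e\<bar> \<le> D * e powr (- \<beta>)" if e: "0 < e" "e \<le> r" for e
  proof -
    have "\<bar>M' e\<bar> \<le> (\<Sum>i\<in>UNIV. \<bar>integral\<^sup>L (lebesgue_on U) (\<lambda>y. w i y * kern_field x e i y)\<bar>)"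
      unfolding M'_def by (rule sum_abs)
    also have "\<dots> \<le> (\<Sum>i\<in>(UNIV::'n set). 2 * 2 ^ ?n * \<eta> * e powr (- \<beta>))"
    proof (rule sum_mono)
      fix i
      have "\<bar>integral\<^sup>L (lebesgue_on U) (\<lambda>y. w i y * kern_field x e i y)\<bar>
          \<le> 1 / e ^ ?n * (2 * \<eta> * ((2 * e) ^ ?n) powr (1 - 1 / p))"
        by (rule integral_mult_kernel_le[OF U p1 w(2) K \<eta>(1) \<eta>(3) e(1) ball_K[OF e(2)]
            kern_field_eq_0[OF e(1)] kern_field_bound[OF e(1)]])
      then show "\<bar>integral\<^sup>L (lebesgue_on U) (\<lambda>y. w i y * kern_field x e i y)\<bar> \<le> 2 * 2 ^ ?n * \<eta> * e powr (- \<beta>)"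
        using kbound[OF e(1)] by linarith
    qed
    finally show ?thesis by (simp add: D_def)
  qed
  have Mr: "\<bar>M r\<bar> \<le> 2 * 2 ^ ?n * \<eta> * r powr (- \<beta>)"
  proof -
    have "M r = integral\<^sup>L (lebesgue_on U) (\<lambda>y. u y * kern x r y)"
      unfolding M_def
      by (rule lebesgue_on_integral_eq_integral_cbox[OF U box_U _ cB continuous_on_kern, symmetric])
         (use kern_eq_0[OF r(1), of _ x] ball_box[of r] in blast)
    also have "\<bar>\<dots>\<bar> \<le> 1 / r ^ ?n * (2 * \<eta> * ((2 * r) ^ ?n) powr (1 - 1 / p))"
    proof (rule integral_mult_kernel_le[OF U p1 u K \<eta>(1,2) r(1) ball_K[OF order_refl] kern_eq_0[OF r(1)]])
      show "\<bar>kern x r y\<bar> \<le> 1 / r ^ ?n" for y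
        using r(1) bump_nonneg[of r "y - x"] bump_le_1[of r "y - x"]
        by (simp add: kern_def divide_right_mono)
    qed
    finally show ?thesis using kbound[OF r(1)] by linarith
  qed
  (* an antiderivative of the bound on the derivative of M *)
  define g where "g e = D * (e powr (1 - \<beta>) / (1 - \<beta>))" for e
  have g': "(g has_real_derivative D * e powr (- \<beta>)) (at e)" if "e > 0" for e
  proof -
    have "((\<lambda>e. e powr (1 - \<beta>)) has_real_derivative (1 - \<beta>) * e powr (1 - \<beta> - 1)) (at e)"
      by (rule has_real_derivative_powr[OF that])
    from DERIV_cmult[OF DERIV_cdivide[OF this, of "1 - \<beta>"], of D]
    show ?thesis using \<beta>(2) by (simp add: g_def[abs_def])
  qed
  have M_small: "\<bar>M e\<bar> \<le> \<bar>M r\<bar> + g r" if e: "0 < e" "e \<le> r" for e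
  proof -
    have 1: "M r - g r \<le> M e - g e"
    proof (rule DERIV_nonpos_imp_nonincreasing[OF e(2)])
      fix t assume "e \<le> t" "t \<le> r"
      then have t: "0 < t" "t \<le> r" using e by auto
      have "((\<lambda>t. M t - g t) has_real_derivative M' t - D * t powr (- \<beta>)) (at t)"
        by (intro DERIV_diff M' g' t)
      then show "\<exists>y. ((\<lambda>t. M t - g t) has_real_derivative y) (at t) \<and> y \<le> 0"
        using M'_bound[OF t] by (intro exI conjI) (assumption, linarith)
    qed
    have 2: "- M r - g r \<le> - M e - g e"
    proof (rule DERIV_nonpos_imp_nonincreasing[OF e(2)])
      fix t assume "e \<le> t" "t \<le> r"
      then have t: "0 < t" "t \<le> r" using e by auto
      have "((\<lambda>t. - M t - g t) has_real_derivative - M' t - D * t powr (- \<beta>)) (at t)"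
        by (intro DERIV_diff DERIV_minus M' g' t)
      then show "\<exists>y. ((\<lambda>t. - M t - g t) has_real_derivative y) (at t) \<and> y \<le> 0"
        using M'_bound[OF t] by (intro exI conjI) (assumption, linarith)
    qed
    have "0 \<le> g e" using \<beta> \<eta>(1) by (auto simp: g_def D_def)
    then show ?thesis using 1 2 by linarith
  qed
  have "?c * \<bar>u x\<bar> \<le> \<bar>M r\<bar> + g r + d" if d: "d > 0" for d
  proof -
    have "x \<in> cbox a b" using ball_box[of r] r(1) by auto
    moreover have "d / ?c > 0" using d c0 by simp
    ultimately obtain s where s: "s > 0" "\<And>y. y \<in> cbox a b \<Longrightarrow> dist y x < s \<Longrightarrow> dist (u y) (u x) < d / ?c"
      using cB unfolding continuous_on_iff by blast
    define e where "e = min r (s / 2)"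
    have e: "0 < e" "e \<le> r" "e < s" using r(1) s(1) by (auto simp: e_def)
    have "\<bar>M e - u x * ?c\<bar> \<le> d / ?c * ?c"
      unfolding M_def
    proof (rule kern_average_near[OF cB e(1) ball_box[OF e(2)]])
      fix y assume y: "y \<in> cball x e"
      then have "dist y x < s" using e(3) by (simp add: dist_commute)
      from s(2)[OF _ this] show "\<bar>u y - u x\<bar> \<le> d / ?c"
        using ball_box[OF e(2)] y by (force simp: dist_real_def)
    qed
    then have "\<bar>u x * ?c\<bar> \<le> \<bar>M e\<bar> + d" using c0 by simp
    then show ?thesis using M_small[OF e(1,2)] c0 by (simp add: abs_mult mult.commute)
  qed
  then have "?c * \<bar>u x\<bar> \<le> \<bar>M r\<bar> + g r" by (rule field_le_epsilon)
  also have "\<dots> \<le> 2 * 2 ^ ?n * \<eta> * r powr (- \<beta>) + g r" using Mr by simp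
  also have "\<dots> = (2 * 2 ^ ?n * r powr (- \<beta>) + real ?n * 2 * 2 ^ ?n * r powr (1 - \<beta>) / (1 - \<beta>)) * \<eta>"
    by (simp add: g_def D_def algebra_simps)
  finally show ?thesis .
qed

lemma Lp_norm_on_powr:
  assumes "p > 0"
  shows "integral\<^sup>L (lebesgue_on K) (\<lambda>x. \<bar>u x\<bar> powr p) = Lp_norm_on p K u powr p"
proof -
  have "0 \<le> integral\<^sup>L (lebesgue_on K) (\<lambda>x. \<bar>u x\<bar> powr p)" by simp
  then show ?thesis using assms by (simp add: Lp_norm_on_def powr_powr)
qed

text \<open>The constant and the compact set depend on \<open>S\<close> but not on \<open>u\<close>; hence convergence to \<open>0\<close> in the local Sobolev
  topology implies locally uniform convergence of continuous representatives.\<close>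

theorem morrey_sup_bound:
  fixes U :: "(real^'n::finite) set"
  assumes U: "open U" and p: "p > real CARD('n)" and S: "compact S" "S \<subseteq> U"
  obtains C K where "compact K" "K \<subseteq> U" "C \<ge> 0"
    "\<And>u x. continuous_on U u \<Longrightarrow> u \<in> W1p_loc p U \<Longrightarrow> x \<in> S \<Longrightarrow> \<bar>u x\<bar> \<le> C * W1p_norm_on p U K u"
proof -
  let ?c = "integral\<^sup>L lborel (bump 1 :: real^'n \<Rightarrow> real)"
  have c0: "?c > 0" by (rule integral_bump_pos) simp
  obtain \<delta> K where \<delta>: "\<delta> > 0" and K: "compact K" "K \<subseteq> U" "\<And>x y. x \<in> S \<Longrightarrow> dist x y \<le> \<delta> \<Longrightarrow> y \<in> K"
    using compact_neighbourhood[OF U S] by metis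
  have n1: "1 \<le> real CARD('n)" using zero_less_card_finite[where 'a='n] by linarith
  define r where "r = \<delta> / real CARD('n)"
  have r: "r > 0" "real CARD('n) * r = \<delta>" using \<delta> n1 by (auto simp: r_def)
  have p0: "p > 0" using p n1 by linarith
  define \<beta> where "\<beta> = real CARD('n) / p"
  have \<beta>: "\<beta> < 1" using p p0 by (simp add: \<beta>_def)
  define C where "C = 2 * 2 ^ CARD('n) * r powr (- \<beta>) + real CARD('n) * 2 * 2 ^ CARD('n) * r powr (1 - \<beta>) / (1 - \<beta>)"
  have C: "C \<ge> 0" using \<beta> by (auto simp: C_def)
  show ?thesis
  proof
    show "compact K" "K \<subseteq> U" by (fact K)+
    show "C / ?c \<ge> 0" using C c0 by simp
    fix u x assume u: "continuous_on U u" "u \<in> W1p_loc p U" and x: "x \<in> S"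
    let ?N = "W1p_norm_on p U K u"
    have nonneg: "0 \<le> Lp_norm_on p K v" for v :: "real^'n \<Rightarrow> real" by (simp add: Lp_norm_on_def)
    have le: "Lp_norm_on p K u \<le> ?N" "Lp_norm_on p K (weak_partial U i u) \<le> ?N" for i
      using nonneg sum_nonneg_leq_bound[of UNIV "\<lambda>k. Lp_norm_on p K (weak_partial U k u)" _ i]
        member_le_sum[of i UNIV "\<lambda>k. Lp_norm_on p K (weak_partial U k u)"]
        sum_nonneg[of UNIV "\<lambda>k. Lp_norm_on p K (weak_partial U k u)"]
      by (auto simp: W1p_norm_on_def add_increasing add_increasing2)
    have "?c * \<bar>u x\<bar> \<le> C * ?N + d" if d: "d > 0" for d
    proof -
      (* strictly positive even if the norm is 0, and too large by at most d after multiplication with C *)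
      define \<eta> where "\<eta> = ?N + d / (C + 1)"
      have N0: "0 \<le> ?N" using le(1) nonneg[of u] by linarith
      have \<eta>: "\<eta> > 0" "?N \<le> \<eta>" using N0 d C by (auto simp: \<eta>_def add_nonneg_pos)
      have bnd: "integral\<^sup>L (lebesgue_on K) (\<lambda>x. \<bar>v x\<bar> powr p) \<le> \<eta> powr p" if "Lp_norm_on p K v \<le> ?N" for v :: "real^'n \<Rightarrow> real"
        unfolding Lp_norm_on_powr[OF p0] using that \<eta> nonneg[of v] p0 by (intro powr_mono2) auto
      have "?c * \<bar>u x\<bar> \<le> C * \<eta>"
        unfolding C_def \<beta>_def
      proof (rule morrey_pointwise[OF U u(1) _ p weak_partial_in_Lp_loc[OF U u(2)] K(1,2) r(1)])
        show "u \<in> Lp_loc p U" using u(2) by (simp add: W1p_loc_def)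
        show "cball x (real CARD('n) * r) \<subseteq> K" using K(3)[OF x] r(2) by auto
      qed (use \<eta>(1) bnd le in auto)
      also have "\<dots> \<le> C * ?N + d"
      proof -
        have "C * (d / (C + 1)) \<le> d" using C d by (simp add: field_simps)
        then show ?thesis by (simp add: \<eta>_def distrib_left)
      qed
      finally show ?thesis .
    qed
    then have "?c * \<bar>u x\<bar> \<le> C * ?N" by (rule field_le_epsilon)
    then show "\<bar>u x\<bar> \<le> C / ?c * ?N" using c0 by (simp add: field_simps)
  qed
qed

section \<open>Limit measures\<close>

text \<open>Morrey's inequality makes the diffusion coefficients uniformly small on the support of a test function \<open>f\<close>.
  Against any probability measure, the second-order part of the generator thus contributes at most \<open>\<epsilon> l\<close>, which
  tends to \<open>0\<close>. The first-order part is a bounded continuous function, to which weak convergence applies.\<close>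

theorem limit_measure_drift_stationary:
  fixes U :: "(real^'n::finite) set"
  assumes U: "open U" and V: "continuous_on U V" and p: "p > real CARD('n)"
    and A: "\<A> \<subseteq> diffusion_class T p U" and lim: "limit_measure p U V \<A> \<mu>"
  shows "drift_stationary U V \<mu>"
  unfolding drift_stationary_iff
proof (intro conjI ballI)
  show "\<mu> \<in> borel_prob_on U" using lim by (simp add: limit_measure_def)
  fix f assume f: "f \<in> test_functions U"
  obtain B \<mu>s where B: "\<And>l. B l \<in> \<A>" "W1p_loc_tends_to_zero p U B sequentially"
    and \<mu>s: "\<And>l. stationary_measure U V (B l) (\<mu>s l)" and wk: "weak_star_conv U \<mu>s \<mu>"
    using lim unfolding limit_measure_def by blast
  let ?S = "closure {x. f x \<noteq> 0}"
  have S: "compact ?S" "?S \<subseteq> U" and sm: "smooth f"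
    using f by (auto simp: test_functions_def smooth_def)
  have foff: "f x = 0" if "x \<in> - ?S" for x
    using that subsetD[OF closure_subset, of x "{x. f x \<noteq> 0}"] by auto
  have p1_off: "partial_deriv i g x = 0" if "x \<in> - ?S" "\<And>y. y \<in> - ?S \<Longrightarrow> g y = 0" for g i x
    using grad_eq_0_off_support[of "- ?S" x g] that by (simp add: open_Compl grad_def vec_eq_iff)
  have d1: "partial_deriv i f x = 0" if "x \<in> - ?S" for i x by (rule p1_off[OF that foff])
  have d2: "partial_deriv i (partial_deriv j f) x = 0" if "x \<in> - ?S" for i j x by (rule p1_off[OF that d1])
  obtain C K where K: "compact K" "K \<subseteq> U" "C \<ge> 0"
    and C: "\<And>u x. continuous_on U u \<Longrightarrow> u \<in> W1p_loc p U \<Longrightarrow> x \<in> ?S \<Longrightarrow> \<bar>u x\<bar> \<le> C * W1p_norm_on p U K u"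
    using morrey_sup_bound[OF U p S] by metis
  have d2c: "continuous_on T (partial_deriv i (partial_deriv j f))" for T i j
    by (intro smooth_continuous smooth_partial_deriv sm)
  have "\<exists>h. \<forall>x. \<bar>partial_deriv i (partial_deriv j f) x\<bar> \<le> h" for i j
  proof -
    obtain h where "\<And>x. x \<in> ?S \<Longrightarrow> \<bar>partial_deriv i (partial_deriv j f) x\<bar> \<le> h"
      using compact_imp_bounded[OF compact_continuous_image[OF d2c S(1)]] by (fastforce simp: bounded_iff)
    then have "\<bar>partial_deriv i (partial_deriv j f) x\<bar> \<le> max h 0" for x
      using d2[of x i j] by (cases "x \<in> ?S") (auto simp: le_max_iff_disj)
    then show ?thesis by blast
  qed
  then obtain h where h: "\<And>i j x. \<bar>partial_deriv i (partial_deriv j f) x\<bar> \<le> h i j" by metis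
  have h0: "0 \<le> h i j" for i j using h[of i j 0] by linarith
  let ?g = "\<lambda>x. V x \<bullet> grad f x"
  let ?a = "\<lambda>l x. \<Sum>i\<in>UNIV. \<Sum>j\<in>UNIV. B l x $ i $ j * partial_deriv i (partial_deriv j f) x"
  have gen: "generator (B l) V f = (\<lambda>x. ?a l x + ?g x)" for l
    by (simp add: generator_def fun_eq_iff inner_vec_def grad_def)
  have gc: "continuous_on U ?g" by (intro continuous_intros V smooth_grad_continuous sm)
  have goff: "?g x = 0" if "x \<in> U" "x \<notin> ?S" for x
    using d1[of x] that by (simp add: inner_vec_def grad_def)
  have Bc: "continuous_on U (\<lambda>x. B l x $ i $ j)" "(\<lambda>x. B l x $ i $ j) \<in> W1p_loc p U" for l i j
    using B(1)[of l] A unfolding diffusion_class_def by (auto intro!: continuous_intros)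
  have ac: "continuous_on U (?a l)" for l by (intro continuous_intros Bc d2c)
  have aoff: "?a l x = 0" if "x \<in> U" "x \<notin> ?S" for l x
    using d2[of x] that by simp
  define \<epsilon> where "\<epsilon> l = (\<Sum>i\<in>UNIV. \<Sum>j\<in>UNIV. C * W1p_norm_on p U K (\<lambda>x. B l x $ i $ j) * h i j)" for l
  have "\<epsilon> \<longlonglongrightarrow> (\<Sum>i\<in>(UNIV::'n set). \<Sum>j\<in>(UNIV::'n set). C * 0 * h i j)"
    unfolding \<epsilon>_def using B(2) K(1,2) unfolding W1p_loc_tends_to_zero_def
    by (intro tendsto_sum tendsto_mult tendsto_const) auto
  then have \<epsilon>0: "\<epsilon> \<longlonglongrightarrow> 0" by simp
  have est: "norm (integral\<^sup>L (\<mu>s l) ?g) \<le> \<epsilon> l" for l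
  proof -
    have bp: "\<mu>s l \<in> borel_prob_on U" and st: "integral\<^sup>L (\<mu>s l) (generator (B l) V f) = 0"
      using \<mu>s[of l] f by (auto simp: stationary_measure_def)
    interpret prob_space "\<mu>s l" using bp by (simp add: borel_prob_on_def)
    have sp: "space (\<mu>s l) = U" by (rule borel_prob_on_space[OF bp])
    have ig: "integrable (\<mu>s l) ?g" by (rule integrable_continuous_compact_support[OF bp U gc S goff])
    have ia: "integrable (\<mu>s l) (?a l)" by (rule integrable_continuous_compact_support[OF bp U ac S aoff])
    have "integral\<^sup>L (\<mu>s l) (?a l) + integral\<^sup>L (\<mu>s l) ?g = 0"
      using st ia ig unfolding gen by simp
    then have "\<bar>integral\<^sup>L (\<mu>s l) ?g\<bar> = \<bar>integral\<^sup>L (\<mu>s l) (?a l)\<bar>" by linarith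
    also have "\<dots> \<le> integral\<^sup>L (\<mu>s l) (\<lambda>x. \<bar>?a l x\<bar>)" by (rule integral_abs_bound)
    also have "\<dots> \<le> integral\<^sup>L (\<mu>s l) (\<lambda>x. \<epsilon> l)"
    proof (rule integral_mono)
      fix x assume "x \<in> space (\<mu>s l)"
      then have xU: "x \<in> U" by (simp add: sp)
      have term_le: "\<bar>B l x $ i $ j * partial_deriv i (partial_deriv j f) x\<bar> \<le> C * W1p_norm_on p U K (\<lambda>x. B l x $ i $ j) * h i j" if "x \<in> ?S" for i j
        unfolding abs_mult by (rule mult_mono[OF C[OF Bc that] h]) (use C[OF Bc[of l i j] that] in \<open>auto intro: order_trans[OF abs_ge_zero]\<close>)
      show "\<bar>?a l x\<bar> \<le> \<epsilon> l"
      proof (cases "x \<in> ?S")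
        case True
        have "\<bar>?a l x\<bar> \<le> (\<Sum>i\<in>UNIV. \<bar>\<Sum>j\<in>UNIV. B l x $ i $ j * partial_deriv i (partial_deriv j f) x\<bar>)" by (rule sum_abs)
        also have "\<dots> \<le> \<epsilon> l"
          unfolding \<epsilon>_def by (intro sum_mono order_trans[OF sum_abs] term_le True)
        finally show ?thesis .
      next
        case False
        have "0 \<le> W1p_norm_on p U K u" for u by (auto simp: W1p_norm_on_def Lp_norm_on_def intro!: add_nonneg_nonneg sum_nonneg)
        then have "0 \<le> \<epsilon> l" unfolding \<epsilon>_def using K(3) h0 by (intro sum_nonneg mult_nonneg_nonneg) auto
        then show ?thesis using aoff[OF xU False] by simp
      qed
    qed (use ia in auto)
    finally show ?thesis by (simp add: prob_space)
  qed
  have "bounded (?g ` U)"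
  proof -
    have "bounded (?g ` ?S)"
      by (intro compact_imp_bounded compact_continuous_image continuous_on_subset[OF gc S(2)] S(1))
    then have "bounded (insert 0 (?g ` ?S))" by simp
    then show ?thesis by (rule bounded_subset) (use goff in auto)
  qed
  then have "(\<lambda>l. integral\<^sup>L (\<mu>s l) ?g) \<longlonglongrightarrow> integral\<^sup>L \<mu> ?g"
    using wk gc unfolding weak_star_conv_def by blast
  moreover have "(\<lambda>l. integral\<^sup>L (\<mu>s l) ?g) \<longlonglongrightarrow> 0"
    by (rule Lim_null_comparison[OF _ \<epsilon>0]) (simp add: est del: real_norm_def)
  ultimately show "integral\<^sup>L \<mu> ?g = 0" by (rule LIMSEQ_unique)
qed

section \<open>Lipschitz functions\<close>

text \<open>The mean value inequality gives Lipschitz bounds on small balls; compactness of \<open>X\<close> patches them together.\<close>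

lemma Ck_1_lipschitz_on_compact:
  fixes f :: "real^'n::finite \<Rightarrow> real"
  assumes U: "open U" and f: "Ck_on 1 U f" and X: "compact X" "X \<subseteq> U"
  obtains L where "L-lipschitz_on X f"
proof -
  have diff: "(f has_derivative (\<lambda>h. h \<bullet> grad f x)) (at x)" if "x \<in> U" for x
    using f that by (intro has_derivative_grad) simp
  have gc: "continuous_on U (grad f)"
    unfolding grad_def[abs_def] using f by (intro continuous_on_vec_lambda) simp
  have "local_lipschitz {0::real} U (\<lambda>_. f)"
  proof (rule local_lipschitzI)
    fix t :: real and x assume "x \<in> U"
    then obtain u where u: "u > 0" "cball x u \<subseteq> U" using U open_contains_cball by blast
    have "bounded (grad f ` cball x u)"
      by (rule compact_imp_bounded[OF compact_continuous_image[OF continuous_on_subset[OF gc u(2)] compact_cball]])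
    then obtain B where B: "\<And>y. y \<in> cball x u \<Longrightarrow> norm (grad f y) \<le> B"
      unfolding bounded_iff by blast
    have "(max B 0)-lipschitz_on (cball x u) f"
    proof (rule bounded_derivative_imp_lipschitz)
      fix y assume y: "y \<in> cball x u"
      show "(f has_derivative (\<lambda>h. h \<bullet> grad f y)) (at y within cball x u)"
        using diff u(2) y by (blast intro: has_derivative_at_withinI)
      show "onorm (\<lambda>h. h \<bullet> grad f y) \<le> max B 0"
      proof (rule onorm_le)
        fix h
        have "norm (h \<bullet> grad f y) \<le> norm h * norm (grad f y)" by (simp add: Cauchy_Schwarz_ineq2)
        also have "\<dots> \<le> norm h * max B 0" using B[OF y] by (intro mult_left_mono) auto
        finally show "norm (h \<bullet> grad f y) \<le> max B 0 * norm h" by (simp add: mult.commute)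
      qed
    qed auto
    then have "(max B 0)-lipschitz_on (cball x u \<inter> U) f" by (rule lipschitz_on_subset) auto
    then show "\<exists>u>0. \<exists>L. \<forall>t\<in>cball t u \<inter> {0}. L-lipschitz_on (cball x u \<inter> U) f"
      using u(1) by blast
  qed
  then have "local_lipschitz {0::real} X (\<lambda>_. f)"
    by (rule local_lipschitz_subset) (use X in auto)
  from local_lipschitz_compact_implies_lipschitz[OF this X(1), of thesis]
  show ?thesis using that by (auto intro: continuous_intros)
qed

lemma C1_field_lipschitz_on_compact:
  fixes V :: "real^'n::finite \<Rightarrow> real^'n"
  assumes U: "open U" and V: "C1_field U V" and X: "compact X" "X \<subseteq> U"
  obtains L where "L-lipschitz_on X V"
proof -
  have "\<exists>L. L-lipschitz_on X (\<lambda>x. V x $ i)" for i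
    using Ck_1_lipschitz_on_compact[OF U _ X] V unfolding C1_field_def by metis
  then obtain L where L: "\<And>i. (L i)-lipschitz_on X (\<lambda>x. V x $ i)" by metis
  have "(\<Sum>i\<in>UNIV. L i)-lipschitz_on X V"
  proof (rule lipschitz_onI)
    fix x y assume xy: "x \<in> X" "y \<in> X"
    have "dist (V x) (V y) \<le> (\<Sum>i\<in>UNIV. \<bar>(V x - V y) $ i\<bar>)"
      unfolding dist_norm by (rule norm_le_l1_cart)
    also have "\<dots> \<le> (\<Sum>i\<in>UNIV. L i * dist x y)"
      using lipschitz_onD[OF L xy] by (intro sum_mono) (simp add: dist_real_def)
    finally show "dist (V x) (V y) \<le> (\<Sum>i\<in>UNIV. L i) * dist x y" by (simp add: sum_distrib_right)
  qed (use lipschitz_on_nonneg[OF L] in \<open>auto intro: sum_nonneg\<close>)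
  then show ?thesis by (rule that)
qed

text \<open>For a pair of points on different sides of the boundary of \<open>X\<close>, one uses that points of \<open>S\<close> have distance at
  least \<open>\<delta>\<close> from the complement of \<open>X\<close>: a bound \<open>M\<close> of the function is then at most \<open>M / \<delta>\<close> times the
  distance.\<close>

lemma lipschitz_extend_by_zero:
  fixes f :: "real^'n::finite \<Rightarrow> real"
  assumes f: "L-lipschitz_on X f" and S: "compact S" "S \<subseteq> interior X"
    and off: "\<And>x. x \<in> X \<Longrightarrow> x \<notin> S \<Longrightarrow> f x = 0"
  obtains L' where "L'-lipschitz_on UNIV (\<lambda>x. if x \<in> X then f x else 0)"
proof -
  obtain \<delta> K where \<delta>: "\<delta> > 0" and K: "K \<subseteq> interior X" "\<And>x y. x \<in> S \<Longrightarrow> dist x y \<le> \<delta> \<Longrightarrow> y \<in> K"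
    using compact_neighbourhood[OF open_interior S] by metis
  have SX: "S \<subseteq> X" using S(2) interior_subset by blast
  have "continuous_on S f" using lipschitz_on_continuous_on[OF f] SX continuous_on_subset by blast
  then obtain M where M: "\<And>x. x \<in> S \<Longrightarrow> \<bar>f x\<bar> \<le> M"
    using compact_imp_bounded[OF compact_continuous_image[OF _ S(1)]] by (fastforce simp: bounded_iff)
  let ?L = "max L (\<bar>M\<bar> / \<delta>)"
  let ?F = "\<lambda>x. if x \<in> X then f x else 0"
  have L0: "0 \<le> ?L" using lipschitz_on_nonneg[OF f] by simp
  have far: "\<bar>f x\<bar> \<le> ?L * dist x y" if "x \<in> X" "y \<notin> X" for x y
  proof (cases "x \<in> S")
    case True
    have "\<delta> < dist x y" using K(2)[OF True, of y] K(1) interior_subset[of X] that(2) by force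
    then have "\<bar>M\<bar> * \<delta> \<le> \<bar>M\<bar> * dist x y" by (intro mult_left_mono) auto
    then have "\<bar>M\<bar> \<le> \<bar>M\<bar> / \<delta> * dist x y" using \<delta> by (simp add: pos_le_divide_eq)
    also have "\<dots> \<le> ?L * dist x y" by (intro mult_right_mono) auto
    finally show ?thesis using M[OF True] by linarith
  next
    case False then show ?thesis using off[OF that(1)] L0 by simp
  qed
  have "?L-lipschitz_on UNIV ?F"
  proof (rule lipschitz_onI[OF _ L0])
    fix x y
    consider "x \<in> X" "y \<in> X" | "x \<in> X" "y \<notin> X" | "x \<notin> X" "y \<in> X" | "x \<notin> X" "y \<notin> X" by blast
    then show "dist (?F x) (?F y) \<le> ?L * dist x y"
    proof cases
      case 1
      have "dist (f x) (f y) \<le> L * dist x y" by (rule lipschitz_onD[OF f 1])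
      also have "\<dots> \<le> ?L * dist x y" by (intro mult_right_mono) auto
      finally show ?thesis using 1 by simp
    next
      case 2 then show ?thesis using far[of x y] by (simp add: dist_real_def)
    next
      case 3 then show ?thesis using far[of y x] by (simp add: dist_real_def dist_commute)
    next
      case 4 then show ?thesis using L0 by simp
    qed
  qed
  then show ?thesis by (rule that)
qed

text \<open>A Lipschitz function takes values on a curve and on its tangent line that differ by \<open>o(s)\<close>. So derivatives along
  orbits and derivatives in the direction of the vector field are the same thing for such functions.\<close>

lemma directional_derivative_of_curve:
  fixes u :: "real^'n::finite \<Rightarrow> real" and c :: "real \<Rightarrow> real^'n"
  assumes u: "L-lipschitz_on X u" and x: "x \<in> interior X"
    and c: "c 0 = x" "(c has_vector_derivative v) (at 0)"
    and D: "((\<lambda>s. u (c s)) has_real_derivative d) (at 0)"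
  shows "((\<lambda>s. u (x + s *\<^sub>R v)) has_real_derivative d) (at 0)"
proof -
  have lin: "((\<lambda>s. x + s *\<^sub>R v) \<longlongrightarrow> x) (at 0)" by (auto intro!: tendsto_eq_intros)
  have "isCont c 0" using c(2) has_vector_derivative_continuous by blast
  then have "(c \<longlongrightarrow> x) (at 0)" using c(1) by (simp add: isCont_def)
  then have ev: "\<forall>\<^sub>F s in at 0. c s \<in> interior X" "\<forall>\<^sub>F s in at 0. x + s *\<^sub>R v \<in> interior X"
    using topological_tendstoD[OF _ open_interior x] lin by blast+
  have L0: "0 \<le> L" by (rule lipschitz_on_nonneg[OF u])
  have q: "((\<lambda>s. norm (c s - c 0 - s *\<^sub>R v) / \<bar>s\<bar>) \<longlongrightarrow> 0) (at 0)"
    using c(2) unfolding has_vector_derivative_def has_derivative_at by simp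
  have "((\<lambda>s. (u (c s) - u (x + s *\<^sub>R v)) / s) \<longlongrightarrow> 0) (at 0)"
  proof (rule Lim_null_comparison)
    show "((\<lambda>s. L * (norm (c s - c 0 - s *\<^sub>R v) / \<bar>s\<bar>)) \<longlongrightarrow> 0) (at 0)"
      using tendsto_mult[OF tendsto_const q, of L] by simp
    show "\<forall>\<^sub>F s in at 0. norm ((u (c s) - u (x + s *\<^sub>R v)) / s) \<le> L * (norm (c s - c 0 - s *\<^sub>R v) / \<bar>s\<bar>)"
      using ev
    proof eventually_elim
      case (elim s)
      have "\<bar>u (c s) - u (x + s *\<^sub>R v)\<bar> \<le> L * norm (c s - (x + s *\<^sub>R v))"
        using lipschitz_onD[OF u, of "c s" "x + s *\<^sub>R v"] elim interior_subset[of X]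
        by (auto simp: dist_norm subset_iff)
      then have "\<bar>u (c s) - u (x + s *\<^sub>R v)\<bar> / \<bar>s\<bar> \<le> L * norm (c s - (x + s *\<^sub>R v)) / \<bar>s\<bar>"
        by (intro divide_right_mono) auto
      then show ?case by (simp add: c(1) diff_diff_eq)
    qed
  qed
  moreover have "((\<lambda>s. (u (c s) - u x) / s) \<longlongrightarrow> d) (at 0)"
    using D by (simp add: DERIV_def c(1))
  ultimately have "((\<lambda>s. (u (c s) - u x) / s - (u (c s) - u (x + s *\<^sub>R v)) / s) \<longlongrightarrow> d - 0) (at 0)"
    by (intro tendsto_diff)
  then show ?thesis by (simp add: DERIV_def diff_divide_distrib[symmetric])
qed

section \<open>Integrals along the orbits of a local flow\<close>

lemma local_flow_cases:
  assumes "local_flow U V I \<phi>" "\<xi> \<in> U"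
  shows "is_interval (I \<xi>)" "0 \<in> I \<xi>" "\<phi> 0 \<xi> = \<xi>" "solves_ode_in U V (\<lambda>t. \<phi> t \<xi>) (I \<xi>)"
    and "\<And>J x t. is_interval J \<Longrightarrow> 0 \<in> J \<Longrightarrow> x 0 = \<xi> \<Longrightarrow> solves_ode_in U V x J \<Longrightarrow> t \<in> J \<Longrightarrow> t \<in> I \<xi> \<and> x t = \<phi> t \<xi>"
  using assms unfolding local_flow_def by blast+

lemma flow_interval_open:
  assumes fl: "local_flow U V I \<phi>" and \<xi>: "\<xi> \<in> U"
  shows "open (I \<xi>)"
proof -
  have "open {(t, \<xi>). \<xi> \<in> U \<and> t \<in> I \<xi>}" using fl by (simp add: local_flow_def)
  then have "open ((\<lambda>t. (t, \<xi>)) -` {(t, \<xi>). \<xi> \<in> U \<and> t \<in> I \<xi>})"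
    by (intro open_vimage continuous_intros)
  also have "(\<lambda>t. (t, \<xi>)) -` {(t, \<xi>). \<xi> \<in> U \<and> t \<in> I \<xi>} = I \<xi>" using \<xi> by auto
  finally show ?thesis .
qed

lemma flow_in:
  assumes "local_flow U V I \<phi>" "\<xi> \<in> U" "t \<in> I \<xi>"
  shows "\<phi> t \<xi> \<in> U"
  using local_flow_cases(4)[OF assms(1,2)] assms(3) by (simp add: solves_ode_in_def)

lemma flow_derivative:
  assumes fl: "local_flow U V I \<phi>" and \<xi>: "\<xi> \<in> U" and t: "t \<in> I \<xi>"
  shows "((\<lambda>t. \<phi> t \<xi>) has_vector_derivative V (\<phi> t \<xi>)) (at t)"
proof -
  have "((\<lambda>t. \<phi> t \<xi>) has_vector_derivative V (\<phi> t \<xi>)) (at t within I \<xi>)"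
    using local_flow_cases(4)[OF fl \<xi>] t unfolding solves_ode_in_def by blast
  then show ?thesis unfolding at_within_open[OF t flow_interval_open[OF fl \<xi>]] .
qed

lemma flow_continuous:
  assumes "local_flow U V I \<phi>" and "continuous_on T f" "continuous_on T g"
    and "\<And>z. z \<in> T \<Longrightarrow> g z \<in> U \<and> f z \<in> I (g z)"
  shows "continuous_on T (\<lambda>z. \<phi> (f z) (g z))"
proof -
  have "continuous_on {(t, \<xi>). \<xi> \<in> U \<and> t \<in> I \<xi>} (\<lambda>(t, \<xi>). \<phi> t \<xi>)"
    using assms(1) by (simp add: local_flow_def)
  from continuous_on_compose2[OF this continuous_on_Pair[OF assms(2,3)]] show ?thesis
    using assms(4) by auto
qed

lemma flow_add:
  assumes fl: "local_flow U V I \<phi>" and \<xi>: "\<xi> \<in> U" and s: "s \<in> I \<xi>" and st: "s + t \<in> I \<xi>"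
  shows "t \<in> I (\<phi> s \<xi>)" "\<phi> t (\<phi> s \<xi>) = \<phi> (s + t) \<xi>"
proof -
  let ?J = "{t. s + t \<in> I \<xi>}"
  have "is_interval ?J"
    unfolding is_interval_1
  proof (intro ballI allI impI)
    fix a b t assume "a \<in> ?J" "b \<in> ?J" "a \<le> t \<and> t \<le> b"
    then have "s + a \<in> I \<xi>" "s + b \<in> I \<xi>" "s + a \<le> s + t" "s + t \<le> s + b" by auto
    then show "t \<in> ?J" using local_flow_cases(1)[OF fl \<xi>] unfolding is_interval_1 by blast
  qed
  moreover have "solves_ode_in U V (\<lambda>t. \<phi> (s + t) \<xi>) ?J"
    unfolding solves_ode_in_def
  proof (intro ballI conjI)
    fix t assume "t \<in> ?J"
    then have t: "s + t \<in> I \<xi>" by simp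
    show "\<phi> (s + t) \<xi> \<in> U" by (rule flow_in[OF fl \<xi> t])
    have 1: "((\<lambda>t. s + t) has_vector_derivative 1) (at t)"
      by (auto intro!: derivative_eq_intros)
    have "(((\<lambda>t. \<phi> t \<xi>) \<circ> (\<lambda>t. s + t)) has_vector_derivative 1 *\<^sub>R V (\<phi> (s + t) \<xi>)) (at t)"
      by (rule vector_diff_chain_at[OF 1 flow_derivative[OF fl \<xi> t]])
    then show "((\<lambda>t. \<phi> (s + t) \<xi>) has_vector_derivative V (\<phi> (s + t) \<xi>)) (at t within ?J)"
      by (simp add: o_def has_vector_derivative_at_within)
  qed
  ultimately show "t \<in> I (\<phi> s \<xi>)" "\<phi> t (\<phi> s \<xi>) = \<phi> (s + t) \<xi>"
    using local_flow_cases(5)[OF fl flow_in[OF fl \<xi> s], of ?J "\<lambda>t. \<phi> (s + t) \<xi>" t] s st by auto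
qed

text \<open>Gronwall's argument: \<open>exp (- 2 * L * t)\<close> times the squared distance of the two orbits is nonincreasing.\<close>

lemma flow_gronwall:
  assumes fl: "local_flow U V I \<phi>" and \<xi>: "\<xi> \<in> U" "{0..T} \<subseteq> I \<xi>" and \<zeta>: "\<zeta> \<in> U" "{0..T} \<subseteq> I \<zeta>"
    and Y: "L-lipschitz_on Y V" "\<And>t. t \<in> {0..T} \<Longrightarrow> \<phi> t \<xi> \<in> Y \<and> \<phi> t \<zeta> \<in> Y"
    and t: "t \<in> {0..T}"
  shows "dist (\<phi> t \<xi>) (\<phi> t \<zeta>) \<le> exp (L * t) * dist \<xi> \<zeta>"
proof -
  define d where "d t = \<phi> t \<xi> - \<phi> t \<zeta>" for t
  define q where "q t = exp (- (2 * L * t)) * (d t \<bullet> d t)" for t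
  have q': "(q has_real_derivative exp (- (2 * L * s)) * (2 * (d s \<bullet> (V (\<phi> s \<xi>) - V (\<phi> s \<zeta>))) - 2 * L * (d s \<bullet> d s))) (at s)"
    if s: "s \<in> {0..T}" for s
  proof -
    have "(d has_vector_derivative V (\<phi> s \<xi>) - V (\<phi> s \<zeta>)) (at s)"
      unfolding d_def
      by (intro has_vector_derivative_diff flow_derivative[OF fl]) (use s \<xi> \<zeta> in auto)
    then have "((\<lambda>s. d s \<bullet> d s) has_real_derivative 2 * (d s \<bullet> (V (\<phi> s \<xi>) - V (\<phi> s \<zeta>)))) (at s)"
      unfolding has_vector_derivative_def has_field_derivative_def
      by (auto intro!: derivative_eq_intros simp: fun_eq_iff inner_commute algebra_simps)
    moreover have "((\<lambda>s. exp (- (2 * L * s))) has_real_derivative - (2 * L) * exp (- (2 * L * s))) (at s)"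
      by (auto intro!: derivative_eq_intros)
    ultimately show ?thesis
      unfolding q_def by (auto intro!: derivative_eq_intros simp: algebra_simps)
  qed
  have "q t \<le> q 0"
  proof (rule DERIV_nonpos_imp_nonincreasing[where f = q and a = 0 and b = t])
    show "0 \<le> t" using t by simp
    fix s assume "0 \<le> s" "s \<le> t"
    then have s: "s \<in> {0..T}" using t by auto
    have "d s \<bullet> (V (\<phi> s \<xi>) - V (\<phi> s \<zeta>)) \<le> norm (d s) * norm (V (\<phi> s \<xi>) - V (\<phi> s \<zeta>))"
      by (rule norm_cauchy_schwarz)
    also have "\<dots> \<le> norm (d s) * (L * norm (d s))"
      using lipschitz_onD[OF Y(1), of "\<phi> s \<xi>" "\<phi> s \<zeta>"] Y(2)[OF s]
      by (intro mult_left_mono) (auto simp: d_def dist_norm)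
    also have "\<dots> = L * (d s \<bullet> d s)" by (simp add: dot_square_norm power2_eq_square)
    finally have "2 * (d s \<bullet> (V (\<phi> s \<xi>) - V (\<phi> s \<zeta>))) - 2 * L * (d s \<bullet> d s) \<le> 0" by simp
    then show "\<exists>y. (q has_real_derivative y) (at s) \<and> y \<le> 0"
      using q'[OF s] by (intro exI conjI) (assumption, simp add: mult_nonneg_nonpos)
  qed
  then have "exp (- (2 * L * t)) * (d t \<bullet> d t) \<le> d 0 \<bullet> d 0" by (simp add: q_def)
  then have "exp (2 * L * t) * (exp (- (2 * L * t)) * (d t \<bullet> d t)) \<le> exp (2 * L * t) * (d 0 \<bullet> d 0)"
    by (rule mult_left_mono) simp
  then have "d t \<bullet> d t \<le> exp (2 * L * t) * (d 0 \<bullet> d 0)"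
    by (simp add: mult.assoc[symmetric] exp_minus_inverse)
  also have "exp (2 * L * t) = exp (L * t) ^ 2" by (simp add: exp_double[symmetric] mult.assoc)
  finally have "(norm (d t))\<^sup>2 \<le> (exp (L * t) * norm (d 0))\<^sup>2"
    by (simp add: dot_square_norm power_mult_distrib)
  then have "norm (d t) \<le> exp (L * t) * norm (d 0)" by (rule power2_le_imp_le) simp
  then show ?thesis
    using local_flow_cases(3)[OF fl \<xi>(1)] local_flow_cases(3)[OF fl \<zeta>(1)] by (simp add: d_def dist_norm)
qed

definition orbit_integral :: "(real \<Rightarrow> real^'n \<Rightarrow> real^'n) \<Rightarrow> (real^'n::finite \<Rightarrow> real) \<Rightarrow> real \<Rightarrow> real^'n \<Rightarrow> real" where
  "orbit_integral \<phi> \<theta> T x = integral {0..T} (\<lambda>s. \<theta> (\<phi> s x))"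

lemma orbit_continuous:
  assumes fl: "local_flow U V I \<phi>" and x: "x \<in> U" "J \<subseteq> I x" and \<theta>: "continuous_on UNIV \<theta>"
  shows "continuous_on J (\<lambda>s. \<theta> (\<phi> s x))"
  by (rule continuous_on_compose2[OF \<theta> flow_continuous[OF fl continuous_on_id continuous_on_const]])
     (use x in auto)

lemma orbit_integral_lipschitz:
  fixes \<theta> :: "real^'n::finite \<Rightarrow> real"
  assumes fl: "local_flow U V I \<phi>"
    and lip: "\<And>Y. compact Y \<Longrightarrow> Y \<subseteq> U \<Longrightarrow> \<exists>L. L-lipschitz_on Y V"
    and X: "compact X" "X \<subseteq> U" "\<And>x. x \<in> X \<Longrightarrow> {0..T} \<subseteq> I x" and T: "T \<ge> 0"
    and \<theta>: "M-lipschitz_on UNIV \<theta>"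
  obtains L where "L-lipschitz_on X (orbit_integral \<phi> \<theta> T)"
proof -
  let ?Y = "(\<lambda>z. \<phi> (fst z) (snd z)) ` ({0..T} \<times> X)"
  have "continuous_on ({0..T} \<times> X) (\<lambda>z. \<phi> (fst z) (snd z))"
    by (intro flow_continuous[OF fl] continuous_intros) (use X(2) subsetD[OF X(3)] in force)
  then have Y: "compact ?Y" by (intro compact_continuous_image compact_Times X(1)) auto
  have YU: "?Y \<subseteq> U" using flow_in[OF fl] X by fastforce
  obtain L where L: "L-lipschitz_on ?Y V" using lip[OF Y YU] by blast
  have L0: "0 \<le> L" by (rule lipschitz_on_nonneg[OF L])
  have M0: "0 \<le> M" by (rule lipschitz_on_nonneg[OF \<theta>])
  have cont: "continuous_on {0..T} (\<lambda>s. \<theta> (\<phi> s x))" if "x \<in> X" for x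
    using orbit_continuous[OF fl _ X(3)[OF that] lipschitz_on_continuous_on[OF \<theta>]] that X(2) by blast
  have "(M * exp (L * T) * T)-lipschitz_on X (orbit_integral \<phi> \<theta> T)"
  proof (rule lipschitz_onI)
    fix x y assume x: "x \<in> X" and y: "y \<in> X"
    have "orbit_integral \<phi> \<theta> T x - orbit_integral \<phi> \<theta> T y = integral {0..T} (\<lambda>s. \<theta> (\<phi> s x) - \<theta> (\<phi> s y))"
      unfolding orbit_integral_def
      by (rule Henstock_Kurzweil_Integration.integral_diff[symmetric]) (intro integrable_continuous_real cont x y)+
    also have "norm \<dots> \<le> M * (exp (L * T) * dist x y) * (T - 0)"
    proof (rule integral_bound[OF T])
      show "continuous_on {0..T} (\<lambda>s. \<theta> (\<phi> s x) - \<theta> (\<phi> s y))"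
        by (intro continuous_intros cont x y)
      fix s assume s: "s \<in> {0..T}"
      have "dist (\<phi> s x) (\<phi> s y) \<le> exp (L * s) * dist x y"
        by (rule flow_gronwall[OF fl _ X(3)[OF x] _ X(3)[OF y] L]) (use x y s X(2) in force)+
      also have "\<dots> \<le> exp (L * T) * dist x y"
        using s L0 by (intro mult_right_mono) (auto intro: mult_left_mono)
      finally have "M * dist (\<phi> s x) (\<phi> s y) \<le> M * (exp (L * T) * dist x y)" by (intro mult_left_mono M0)
      then show "norm (\<theta> (\<phi> s x) - \<theta> (\<phi> s y)) \<le> M * (exp (L * T) * dist x y)"
        using lipschitz_onD[OF \<theta>, of "\<phi> s x" "\<phi> s y"] by (simp add: dist_real_def)
    qed
    finally show "dist (orbit_integral \<phi> \<theta> T x) (orbit_integral \<phi> \<theta> T y) \<le> M * exp (L * T) * T * dist x y"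
      by (simp add: dist_real_def ac_simps)
  qed (use M0 T in simp)
  then show ?thesis by (rule that)
qed

text \<open>By the flow property, the value at \<open>\<phi> s x\<close> is the integral of \<open>\<theta>\<close> along the orbit of \<open>x\<close> over the time
  interval from \<open>s\<close> to \<open>T + s\<close>, and its derivative is the difference of the end values. Integrating along orbits
  thus produces functions with a continuous derivative along \<open>V\<close>, without differentiating the flow with respect to
  the initial point.\<close>

lemma orbit_integral_derivative:
  fixes \<theta> :: "real^'n::finite \<Rightarrow> real"
  assumes fl: "local_flow U V I \<phi>"
    and X: "X \<subseteq> U" "{0..T} \<subseteq> I x" and T: "T \<ge> 0"
    and \<theta>: "continuous_on UNIV \<theta>" and L: "L-lipschitz_on X (orbit_integral \<phi> \<theta> T)"
    and x: "x \<in> interior X"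
  shows "((\<lambda>s. orbit_integral \<phi> \<theta> T (x + s *\<^sub>R V x)) has_real_derivative \<theta> (\<phi> T x) - \<theta> x) (at 0)"
proof -
  have xU: "x \<in> U" using x X(1) interior_subset by blast
  have op: "open (I x)" by (rule flow_interval_open[OF fl xU])
  obtain d1 d2 where d12: "d1 > 0" "ball 0 d1 \<subseteq> I x" "d2 > 0" "ball T d2 \<subseteq> I x"
    using op X(2) T unfolding open_contains_ball by (metis atLeastAtMost_iff order_refl subsetD)
  (* the orbit exists a little longer than over [0, T], in both time directions *)
  define d where "d = min d1 d2 / 2"
  have d: "d > 0" using d12 by (simp add: d_def)
  have sub: "{- d..T + d} \<subseteq> I x"
  proof
    fix t assume t: "t \<in> {- d..T + d}"
    consider "t < 0" | "t \<in> {0..T}" | "t > T" by fastforce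
    then show "t \<in> I x"
    proof cases
      case 1 then have "t \<in> ball 0 d1" using t d12 by (auto simp: d_def dist_real_def)
      then show ?thesis using d12(2) by blast
    next
      case 2 then show ?thesis using X(2) by blast
    next
      case 3 then have "t \<in> ball T d2" using t d12 by (auto simp: d_def dist_real_def)
      then show ?thesis using d12(4) by blast
    qed
  qed
  let ?g = "\<lambda>s. \<theta> (\<phi> s x)"
  define G where "G t = integral {- d..t} ?g" for t
  have gc: "continuous_on {- d..T + d} ?g" by (rule orbit_continuous[OF fl xU sub \<theta>])
  have G': "(G has_real_derivative ?g t) (at t)" if "- d < t" "t < T + d" for t
  proof -
    have "(G has_real_derivative ?g t) (at t within {- d..T + d})"
      unfolding G_def[abs_def] by (rule integral_has_real_derivative[OF gc]) (use that in auto)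
    then show ?thesis using that by (simp add: at_within_Icc_at)
  qed
  have Gd: "((\<lambda>s. G (T + s) - G s) has_real_derivative ?g T - ?g 0) (at 0)"
  proof (rule DERIV_diff)
    have "(G has_real_derivative ?g (0 + T)) (at (0 + T))" using G'[of T] d T by simp
    then show "((\<lambda>s. G (T + s)) has_real_derivative ?g T) (at 0)"
      unfolding DERIV_shift by (simp add: add.commute)
    show "(G has_real_derivative ?g 0) (at 0)" using G'[of 0] d T by simp
  qed
  have eq: "orbit_integral \<phi> \<theta> T (\<phi> s x) = G (T + s) - G s" if s: "\<bar>s\<bar> < d" for s
  proof -
    have "orbit_integral \<phi> \<theta> T (\<phi> s x) = integral {0..T} (\<lambda>r. ?g (s + r))"
      unfolding orbit_integral_def
    proof (rule integral_cong)
      fix r assume "r \<in> {0..T}"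
      then have "s \<in> I x" "s + r \<in> I x" using s T sub by (auto intro!: subsetD[OF sub])
      from flow_add(2)[OF fl xU this] show "\<theta> (\<phi> r (\<phi> s x)) = \<theta> (\<phi> (s + r) x)" by simp
    qed
    also have "\<dots> = integral {s..T + s} ?g"
    proof -
      have int: "?g integrable_on {s..T + s}"
        by (intro integrable_continuous_real continuous_on_subset[OF gc]) (use s in auto)
      then have "(?g has_integral integral {s..T + s} ?g) (cbox s (T + s))" by (simp add: integrable_integral)
      then have "((\<lambda>r. ?g (r + s)) has_integral integral {s..T + s} ?g) (cbox (s - s) (T + s - s))"
        by (rule has_integral_shift_cbox[where f = ?g and a = s and b = "T + s" and c = s])
      then show ?thesis by (simp add: add.commute integral_unique)
    qed
    also have "\<dots> = G (T + s) - G s"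
    proof -
      have "?g integrable_on {- d..T + s}"
        by (intro integrable_continuous_real continuous_on_subset[OF gc]) (use s in auto)
      from Henstock_Kurzweil_Integration.integral_combine[OF _ _ this, of s]
      have "integral {- d..s} ?g + integral {s..T + s} ?g = integral {- d..T + s} ?g"
        using s T by simp
      then show ?thesis by (simp add: G_def)
    qed
    finally show ?thesis .
  qed
  have "\<forall>\<^sub>F s in nhds 0. \<bar>s\<bar> < d"
    using eventually_nhds_in_open[of "ball 0 d" "0::real"] d by (auto simp: dist_real_def elim: eventually_mono)
  then have ev: "\<forall>\<^sub>F s in nhds 0. G (T + s) - G s = orbit_integral \<phi> \<theta> T (\<phi> s x)"
    by eventually_elim (simp add: eq)
  have "((\<lambda>s. orbit_integral \<phi> \<theta> T (\<phi> s x)) has_real_derivative ?g T - ?g 0) (at 0)"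
    using Gd DERIV_cong_ev[OF refl ev refl] by simp
  moreover have "\<phi> 0 x = x" by (rule local_flow_cases(3)[OF fl xU])
  moreover have "((\<lambda>s. \<phi> s x) has_vector_derivative V x) (at 0)"
    using flow_derivative[OF fl xU local_flow_cases(2)[OF fl xU]] \<open>\<phi> 0 x = x\<close> by simp
  ultimately show ?thesis
    using directional_derivative_of_curve[OF L x, of "\<lambda>s. \<phi> s x" "V x" "?g T - ?g 0"] by simp
qed

section \<open>The LaSalle principle\<close>

lemma nonneg_integral_zero_AE:
  fixes w :: "real^'n::finite \<Rightarrow> real"
  assumes U: "open U" and \<mu>: "\<mu> \<in> borel_prob_on U" and w: "continuous_on U w"
    and nn: "\<And>x. x \<in> U \<Longrightarrow> 0 \<le> w x" and S: "compact S" "S \<subseteq> U" "\<And>x. x \<in> U \<Longrightarrow> x \<notin> S \<Longrightarrow> w x = 0"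
    and int: "integral\<^sup>L \<mu> w = 0"
  shows "AE x in \<mu>. w x = 0"
proof -
  have "integrable \<mu> w" by (rule integrable_continuous_compact_support[OF \<mu> U w S])
  moreover have "AE x in \<mu>. 0 \<le> w x" using nn borel_prob_on_space[OF \<mu>] by (intro AE_I2) auto
  ultimately show ?thesis using int integral_nonneg_eq_0_iff_AE by blast
qed

lemma zero_on_measure_support:
  fixes w :: "real^'n::finite \<Rightarrow> real"
  assumes U: "open U" and \<mu>: "\<mu> \<in> borel_prob_on U" and w: "continuous_on U w"
    and AE: "AE x in \<mu>. w x = 0" and x: "x \<in> measure_support U \<mu>"
  shows "w x = 0"
proof (rule ccontr)
  assume "w x \<noteq> 0"
  let ?N = "{y \<in> U. w y \<noteq> 0}"
  have xU: "x \<in> U" using x by (simp add: measure_support_def)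
  have "?N = U \<inter> w -` (- {0})" by auto
  then have N: "open ?N" using continuous_open_preimage[OF w U, of "- {0}"] by (simp add: open_Compl)
  then have "measure \<mu> (?N \<inter> U) > 0"
    using x xU \<open>w x \<noteq> 0\<close> unfolding measure_support_def by blast
  moreover have "?N \<inter> U = ?N" by auto
  moreover have "?N \<in> null_sets \<mu>"
  proof (subst AE_iff_null_sets)
    show "?N \<in> sets \<mu>" using borel_prob_on_sets[OF \<mu> U] N by auto
    show "AE x in \<mu>. x \<notin> ?N" using AE by eventually_elim simp
  qed
  ultimately show False by (simp add: measure_def null_setsD1)
qed

lemma has_derivative_max_0_sq:
  "((\<lambda>t::real. (max 0 t)\<^sup>2) has_real_derivative 2 * max 0 t) (at t)"
proof -
  consider "t < 0" | "t > 0" | "t = 0" by linarith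
  then show ?thesis
  proof cases
    case 1
    have "((\<lambda>t::real. 0) has_real_derivative 0) (at t)" by simp
    then have "((\<lambda>t::real. (max 0 t)\<^sup>2) has_real_derivative 0) (at t)"
      by (rule has_field_derivative_transform_within_open[of _ _ _ "{..<0}"]) (use 1 in auto)
    then show ?thesis using 1 by simp
  next
    case 2
    have "((\<lambda>t::real. t\<^sup>2) has_real_derivative 2 * t) (at t)"
      by (auto intro!: derivative_eq_intros)
    then have "((\<lambda>t::real. (max 0 t)\<^sup>2) has_real_derivative 2 * t) (at t)"
      by (rule has_field_derivative_transform_within_open[of _ _ _ "{0<..}"]) (use 2 in auto)
    then show ?thesis using 2 by simp
  next
    case 3
    have "((\<lambda>h::real. ((max 0 (0 + h))\<^sup>2 - (max 0 0)\<^sup>2) / h) \<longlongrightarrow> 0) (at 0)"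
    proof (rule Lim_null_comparison)
      show "\<forall>\<^sub>F h::real in at 0. norm (((max 0 (0 + h))\<^sup>2 - (max 0 0)\<^sup>2) / h) \<le> \<bar>h\<bar>"
        by (auto simp: eventually_at_filter max_def abs_mult power2_eq_square)
      show "((\<lambda>h::real. \<bar>h\<bar>) \<longlongrightarrow> 0) (at 0)" by (intro tendsto_eq_intros) auto
    qed
    then show ?thesis using 3 by (simp add: DERIV_def)
  qed
qed

lemma lipschitz_on_mult_compact:
  fixes f g :: "'a::metric_space \<Rightarrow> real"
  assumes X: "compact X" and f: "L-lipschitz_on X f" and g: "M-lipschitz_on X g"
  obtains C where "C-lipschitz_on X (\<lambda>x. f x * g x)"
proof -
  have "bounded (f ` X)" "bounded (g ` X)"
    using X lipschitz_on_continuous_on[OF f] lipschitz_on_continuous_on[OF g]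
    by (auto intro!: compact_imp_bounded compact_continuous_image)
  then obtain a b where ab: "\<And>x. x \<in> X \<Longrightarrow> \<bar>f x\<bar> \<le> a" "\<And>x. x \<in> X \<Longrightarrow> \<bar>g x\<bar> \<le> b"
    unfolding bounded_iff by (metis image_eqI real_norm_def)
  have "(\<bar>a\<bar> * M + \<bar>b\<bar> * L)-lipschitz_on X (\<lambda>x. f x * g x)"
  proof (rule lipschitz_onI)
    show "0 \<le> \<bar>a\<bar> * M + \<bar>b\<bar> * L" using lipschitz_on_nonneg[OF f] lipschitz_on_nonneg[OF g] by simp
    fix x y assume xy: "x \<in> X" "y \<in> X"
    have "f x * g x - f y * g y = f x * (g x - g y) + g y * (f x - f y)" by (simp add: algebra_simps)
    then have "\<bar>f x * g x - f y * g y\<bar> \<le> \<bar>f x\<bar> * \<bar>g x - g y\<bar> + \<bar>g y\<bar> * \<bar>f x - f y\<bar>"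
      by (metis abs_mult abs_triangle_ineq)
    also have "\<dots> \<le> \<bar>a\<bar> * (M * dist x y) + \<bar>b\<bar> * (L * dist x y)"
      using lipschitz_onD[OF f xy] lipschitz_onD[OF g xy] ab(1)[OF xy(1)] ab(2)[OF xy(2)]
      by (intro add_mono mult_mono) (auto simp: dist_real_def)
    finally show "dist (f x * g x) (f y * g y) \<le> (\<bar>a\<bar> * M + \<bar>b\<bar> * L) * dist x y"
      by (simp add: dist_real_def algebra_simps)
  qed
  then show ?thesis by (rule that)
qed

lemma lipschitz_on_max_0:
  fixes f :: "'a::metric_space \<Rightarrow> real"
  assumes "L-lipschitz_on X f" shows "L-lipschitz_on X (\<lambda>x. max 0 (f x))"
proof (rule lipschitz_onI)
  fix x y assume "x \<in> X" "y \<in> X"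
  then have "\<bar>f x - f y\<bar> \<le> L * dist x y" using lipschitz_onD[OF assms] by (simp add: dist_real_def)
  moreover have "\<bar>max 0 (f x) - max 0 (f y)\<bar> \<le> \<bar>f x - f y\<bar>" by (simp add: max_def)
  ultimately show "dist (max 0 (f x)) (max 0 (f y)) \<le> L * dist x y" by (simp add: dist_real_def)
qed (rule lipschitz_on_nonneg[OF assms])

lemma lipschitz_on_max_0_sq:
  fixes f :: "'a::metric_space \<Rightarrow> real"
  assumes "compact X" "L-lipschitz_on X f"
  obtains C where "C-lipschitz_on X (\<lambda>x. (max 0 (f x))\<^sup>2)"
proof -
  obtain C where "C-lipschitz_on X (\<lambda>x. max 0 (f x) * max 0 (f x))"
    by (rule lipschitz_on_mult_compact[OF assms(1) lipschitz_on_max_0[OF assms(2)] lipschitz_on_max_0[OF assms(2)]])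
  then show ?thesis using that by (simp add: power2_eq_square)
qed

lemma eventually_along_line:
  fixes y v :: "real^'n::finite"
  assumes "open T" "y \<in> T"
  shows "\<forall>\<^sub>F s in nhds 0. y + s *\<^sub>R v \<in> T"
proof -
  have "((\<lambda>s. y + s *\<^sub>R v) \<longlongrightarrow> y + 0 *\<^sub>R v) (nhds 0)"
    by (intro tendsto_intros filterlim_ident)
  then show ?thesis using assms by (intro topological_tendstoD) auto
qed

lemma directional_derivative_transform:
  fixes f g :: "real^'n::finite \<Rightarrow> real"
  assumes "open T" "y \<in> T" "\<And>x. x \<in> T \<Longrightarrow> f x = g x"
    and "((\<lambda>s. g (y + s *\<^sub>R v)) has_real_derivative d) (at 0)"
  shows "((\<lambda>s. f (y + s *\<^sub>R v)) has_real_derivative d) (at 0)"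
proof -
  have "\<forall>\<^sub>F s in nhds 0. f (y + s *\<^sub>R v) = g (y + s *\<^sub>R v)"
    using eventually_along_line[OF assms(1,2)] by (rule eventually_mono) (rule assms(3))
  from DERIV_cong_ev[OF refl this refl] show ?thesis using assms(4) by simp
qed

text \<open>Choose \<open>c\<close> strictly between \<open>U\<^sub>0 x0\<close> and the supremum of \<open>U\<^sub>0\<close>. Since \<open>U\<^sub>0\<close> is a compact function,
  \<open>(max 0 (c - U\<^sub>0))\<^sup>2\<close> has compact support in \<open>U\<close>. Its derivative along \<open>V\<close> is \<open>- 2 * max 0 (c - U\<^sub>0)\<close> times
  \<open>V \<bullet> grad U\<^sub>0\<close>; it has a constant sign and integral \<open>0\<close>, so it vanishes on the support of the measure. At
  \<open>x0\<close> the first factor is not \<open>0\<close>.\<close>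

theorem lasalle:
  fixes U\<^sub>0 :: "real^'n::finite \<Rightarrow> real"
  assumes U: "open U" and V: "continuous_on U V" and st: "drift_stationary U V \<mu>"
    and cf: "compact_function U U\<^sub>0" and C1: "Ck_on 1 U U\<^sub>0"
    and sign: "(\<forall>x\<in>U. V x \<bullet> grad U\<^sub>0 x \<le> 0) \<or> (\<forall>x\<in>U. V x \<bullet> grad U\<^sub>0 x \<ge> 0)"
    and x0: "x0 \<in> measure_support U \<mu>"
  shows "V x0 \<bullet> grad U\<^sub>0 x0 = 0"
proof -
  note \<mu> = drift_stationaryD(1)[OF st]
  have x0U: "x0 \<in> U" using x0 by (simp add: measure_support_def)
  have U0c: "continuous_on U U\<^sub>0" using cf by (simp add: compact_function_def)
  have gc: "continuous_on U (grad U\<^sub>0)"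
    unfolding grad_def[abs_def] using C1 by (intro continuous_on_vec_lambda) simp
  define \<rho> where "\<rho> = (SUP x\<in>U. ereal (U\<^sub>0 x))"
  have \<rho>: "\<And>x. x \<in> U \<Longrightarrow> ereal (U\<^sub>0 x) < \<rho>"
    "\<And>c. c < \<rho> \<Longrightarrow> \<exists>K. compact K \<and> K \<subseteq> U \<and> (\<forall>x\<in>U - K. c < ereal (U\<^sub>0 x))"
    using cf unfolding compact_function_def Let_def \<rho>_def[symmetric] by blast+
  obtain c where c: "U\<^sub>0 x0 < c" "ereal c < \<rho>" using ereal_dense2[OF \<rho>(1)[OF x0U]] by auto
  obtain K where K: "compact K" "K \<subseteq> U" "\<And>x. x \<in> U \<Longrightarrow> x \<notin> K \<Longrightarrow> c < U\<^sub>0 x"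
    using \<rho>(2)[OF c(2)] by auto
  define S where "S = {x \<in> K. U\<^sub>0 x \<le> c}"
  have S: "compact S"
  proof -
    have "closed (K \<inter> U\<^sub>0 -` {..c})"
      by (rule continuous_closed_preimage[OF continuous_on_subset[OF U0c K(2)] compact_imp_closed[OF K(1)] closed_atMost])
    moreover have "S = K \<inter> (K \<inter> U\<^sub>0 -` {..c})" by (auto simp: S_def)
    ultimately show ?thesis using compact_Int_closed[OF K(1)] by metis
  qed
  have SU: "S \<subseteq> U" using K(2) by (auto simp: S_def)
  have offS: "c < U\<^sub>0 x" if "x \<in> U" "x \<notin> S" for x using that K(3)[of x] by (auto simp: S_def)
  obtain X where X: "compact X" "X \<subseteq> U" and SX: "S \<subseteq> interior X"
    using compact_neighbourhood[OF U S SU] by metis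
  obtain L where "L-lipschitz_on X U\<^sub>0" by (rule Ck_1_lipschitz_on_compact[OF U C1 X(1,2)])
  then have "(0 + L)-lipschitz_on X (\<lambda>x. c - U\<^sub>0 x)" by (intro lipschitz_on_diff lipschitz_on_constant)
  then obtain M where M: "M-lipschitz_on X (\<lambda>x. (max 0 (c - U\<^sub>0 x))\<^sup>2)"
    using lipschitz_on_max_0_sq[OF X(1)] by metis
  let ?f = "\<lambda>x. (max 0 (c - U\<^sub>0 x))\<^sup>2"
  let ?F = "\<lambda>x. if x \<in> X then ?f x else 0"
  let ?w = "\<lambda>x. 2 * max 0 (c - U\<^sub>0 x) * (- (V x \<bullet> grad U\<^sub>0 x))"
  have foff: "?f x = 0" if "x \<in> U" "x \<notin> S" for x using offS[OF that] by simp
  obtain M' where M': "M'-lipschitz_on UNIV ?F"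
    by (rule lipschitz_extend_by_zero[OF M S SX]) (use foff X(2) in auto)
  have wc: "continuous_on U ?w" by (intro continuous_intros U0c V gc)
  have woff: "?w x = 0" if "x \<in> U" "x \<notin> S" for x using offS[OF that] by simp
  have int: "integral\<^sup>L \<mu> ?w = 0"
  proof (rule integral_directional_derivative_eq_0[OF U V st M' S SU _ _ wc])
    show "?F x = 0" if "x \<notin> S" for x using that foff X(2) by auto
    fix y assume y: "y \<in> U"
    show "((\<lambda>s. ?F (y + s *\<^sub>R V y)) has_real_derivative ?w y) (at 0)"
    proof (rule directional_derivative_transform[OF U y])
      show "?F x = ?f x" if "x \<in> U" for x
        using foff[OF that] SX interior_subset[of X] by auto
      have "U\<^sub>0 differentiable (at y)" using C1 y by simp
      then have "((\<lambda>s. U\<^sub>0 (y + s *\<^sub>R V y)) has_real_derivative V y \<bullet> grad U\<^sub>0 y) (at 0)"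
        by (rule has_derivative_along)
      then have "((\<lambda>s. c - U\<^sub>0 (y + s *\<^sub>R V y)) has_real_derivative 0 - V y \<bullet> grad U\<^sub>0 y) (at 0)"
        by (intro DERIV_diff DERIV_const)
      from DERIV_chain2[OF has_derivative_max_0_sq this]
      show "((\<lambda>s. ?f (y + s *\<^sub>R V y)) has_real_derivative ?w y) (at 0)" by simp
    qed
  qed
  have "AE x in \<mu>. ?w x = 0"
    using sign
  proof
    assume le: "\<forall>x\<in>U. V x \<bullet> grad U\<^sub>0 x \<le> 0"
    show ?thesis
      by (rule nonneg_integral_zero_AE[OF U \<mu> wc _ S SU woff int])
         (use le in \<open>auto intro: mult_nonpos_nonneg\<close>)
  next
    assume ge: "\<forall>x\<in>U. V x \<bullet> grad U\<^sub>0 x \<ge> 0"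
    have "AE x in \<mu>. - ?w x = 0"
      by (rule nonneg_integral_zero_AE[OF U \<mu> continuous_on_minus[OF wc] _ S SU])
         (use ge woff int in \<open>auto intro!: mult_nonneg_nonneg\<close>)
    then show ?thesis by simp
  qed
  then have "?w x0 = 0" by (rule zero_on_measure_support[OF U \<mu> wc _ x0])
  then show ?thesis using c(1) by simp
qed

section \<open>Invariance under a flow\<close>

text \<open>The function to test with is the integral of \<open>\<theta>\<close> along orbits up to time \<open>T\<close>. It vanishes off the compact
  set \<open>S\<close> of all points whose orbits meet \<open>K\<close> by then, and its derivative along \<open>V\<close> is \<open>\<theta> \<circ> \<phi> T - \<theta>\<close>.\<close>

lemma flow_integral_invariant:
  fixes \<theta> :: "real^'n::finite \<Rightarrow> real"
  assumes U: "open U" and V: "continuous_on U V"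
    and lip: "\<And>Y. compact Y \<Longrightarrow> Y \<subseteq> U \<Longrightarrow> \<exists>L. L-lipschitz_on Y V"
    and fl: "local_flow U V I \<phi>" and flow: "is_flow U I"
    and st: "drift_stationary U V \<mu>"
    and \<theta>: "M-lipschitz_on UNIV \<theta>" and K: "compact K" "K \<subseteq> U" "\<And>x. x \<notin> K \<Longrightarrow> \<theta> x = 0"
    and T: "T \<ge> 0"
  shows "integral\<^sup>L \<mu> (\<lambda>x. \<theta> (\<phi> T x)) = integral\<^sup>L \<mu> \<theta>"
proof -
  note \<mu> = drift_stationaryD(1)[OF st]
  have I: "I x = UNIV" if "x \<in> U" for x using flow that by (simp add: is_flow_def)
  have \<theta>c: "continuous_on A \<theta>" for A using lipschitz_on_continuous_on[OF \<theta>] continuous_on_subset by blast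
  have flow_back: "\<phi> (- s) (\<phi> s x) = x" if "x \<in> U" for s x
    using flow_add(2)[OF fl that, of s "- s"] I[OF that] local_flow_cases(3)[OF fl that] by simp
  define S where "S = (\<lambda>z. \<phi> (- fst z) (snd z)) ` ({0..T} \<times> K)"
  have "continuous_on ({0..T} \<times> K) (\<lambda>z. \<phi> (- fst z) (snd z))"
    by (intro flow_continuous[OF fl] continuous_intros) (use I K(2) in auto)
  then have S: "compact S" unfolding S_def by (intro compact_continuous_image compact_Times K(1)) auto
  have SU: "S \<subseteq> U" using flow_in[OF fl] I K(2) by (force simp: S_def)
  have offK: "\<phi> s x \<notin> K" if "x \<in> U" "x \<notin> S" "s \<in> {0..T}" for s x
  proof
    assume "\<phi> s x \<in> K"
    then have "\<phi> (- s) (\<phi> s x) \<in> S" unfolding S_def using that(3) by (intro image_eqI[of _ _ "(s, \<phi> s x)"]) auto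
    then show False using flow_back[OF that(1)] that(2) by simp
  qed
  have off0: "x \<notin> K" if "x \<in> U" "x \<notin> S" for x
    using offK[OF that, of 0] T local_flow_cases(3)[OF fl that(1)] by simp
  obtain X where X: "compact X" "X \<subseteq> U" and SX: "S \<subseteq> interior X"
    using compact_neighbourhood[OF U S SU] by metis
  have XI: "{0..T} \<subseteq> I x" if "x \<in> X" for x using I that X(2) by auto
  obtain L where L: "L-lipschitz_on X (orbit_integral \<phi> \<theta> T)"
    using orbit_integral_lipschitz[OF fl lip X(1,2) XI T \<theta>] by blast
  let ?u = "orbit_integral \<phi> \<theta> T"
  let ?F = "\<lambda>x. if x \<in> X then ?u x else 0"
  let ?w = "\<lambda>x. \<theta> (\<phi> T x) - \<theta> x"
  have uoff: "?u x = 0" if "x \<in> U" "x \<notin> S" for x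
  proof -
    have "?u x = integral {0..T} (\<lambda>s. 0)"
      unfolding orbit_integral_def by (rule integral_cong) (use K(3) offK[OF that] in blast)
    then show ?thesis by simp
  qed
  obtain L' where L': "L'-lipschitz_on UNIV ?F"
    by (rule lipschitz_extend_by_zero[OF L S SX]) (use uoff X(2) in auto)
  have \<phi>c: "continuous_on U (\<phi> T)"
    using flow_continuous[OF fl continuous_on_const continuous_on_id, of U T] I by simp
  have c1: "continuous_on U (\<lambda>x. \<theta> (\<phi> T x))"
    by (rule continuous_on_compose2[OF \<theta>c[of UNIV] \<phi>c]) simp
  have wc: "continuous_on U ?w" by (intro continuous_intros c1 \<theta>c)
  have "integral\<^sup>L \<mu> ?w = 0"
  proof (rule integral_directional_derivative_eq_0[OF U V st L' S SU _ _ wc])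
    show "?F x = 0" if "x \<notin> S" for x using that uoff X(2) by auto
    fix y assume y: "y \<in> U"
    show "((\<lambda>s. ?F (y + s *\<^sub>R V y)) has_real_derivative ?w y) (at 0)"
    proof (cases "y \<in> S")
      case True
      then have yX: "y \<in> interior X" using SX by blast
      show ?thesis
      proof (rule directional_derivative_transform[OF open_interior yX])
        show "?F x = ?u x" if "x \<in> interior X" for x using that interior_subset[of X] by auto
        show "((\<lambda>s. ?u (y + s *\<^sub>R V y)) has_real_derivative ?w y) (at 0)"
          by (rule orbit_integral_derivative[OF fl X(2) _ T \<theta>c L yX]) (use I[OF y] in simp)
      qed
    next
      case False
      have op: "open (U - S)" by (intro open_Diff U compact_imp_closed S)
      have w0: "?w y = 0" using K(3) offK[OF y False, of T] off0[OF y False] T by simp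
      show ?thesis
        unfolding w0
        by (rule directional_derivative_transform[OF op, of _ _ "\<lambda>x. 0"]) (use y False uoff in auto)
    qed
  qed
  moreover have "integrable \<mu> (\<lambda>x. \<theta> (\<phi> T x))"
    by (rule integrable_continuous_compact_support[OF \<mu> U c1 S SU]) (use K(3) offK T in auto)
  moreover have "integrable \<mu> \<theta>"
    by (rule integrable_continuous_compact_support[OF \<mu> U \<theta>c K(1,2)]) (use K(3) in auto)
  ultimately show ?thesis by simp
qed

text \<open>The indicator of a compact set is a limit of Lipschitz cutoffs, so the measure and its image under \<open>\<phi> T\<close> agree
  on compact sets, and by inner regularity on Borel sets. Negative times follow by inverting the flow map.\<close>

theorem flow_invariant_measure:
  fixes V :: "real^'n::finite \<Rightarrow> real^'n"
  assumes U: "open U" and V: "continuous_on U V"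
    and lip: "\<And>Y. compact Y \<Longrightarrow> Y \<subseteq> U \<Longrightarrow> \<exists>L. L-lipschitz_on Y V"
    and fl: "local_flow U V I \<phi>" and flow: "is_flow U I"
    and st: "drift_stationary U V \<mu>"
  shows "invariant_measure U \<phi> \<mu>"
proof -
  note \<mu> = drift_stationaryD(1)[OF st]
  interpret prob_space \<mu> using \<mu> by (simp add: borel_prob_on_def)
  have sp: "space \<mu> = U" by (rule borel_prob_on_space[OF \<mu>])
  have I: "I x = UNIV" if "x \<in> U" for x using flow that by (simp add: is_flow_def)
  have inU: "\<phi> t x \<in> U" if "x \<in> U" for t x using flow_in[OF fl that] I[OF that] by simp
  have flow_back: "\<phi> (- s) (\<phi> s x) = x" if "x \<in> U" for s x
    using flow_add(2)[OF fl that, of s "- s"] I[OF that] local_flow_cases(3)[OF fl that] by simp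
  have \<phi>c: "continuous_on U (\<phi> t)" for t
    using flow_continuous[OF fl continuous_on_const continuous_on_id, of U t] I by simp
  have \<phi>m: "\<phi> t \<in> measurable \<mu> borel" for t by (rule borel_prob_on_measurable[OF \<mu> \<phi>c])
  have idm: "(\<lambda>x. x) \<in> measurable \<mu> borel" by (rule borel_prob_on_measurable[OF \<mu> continuous_on_id])
  have compact_case: "measure \<mu> (\<phi> T -` C \<inter> U) = measure \<mu> C" if T: "T \<ge> 0" and C: "compact C" "C \<subseteq> U" for T C
  proof (cases "C = {}")
    case False
    obtain \<delta> K where \<delta>: "\<delta> > 0" and K: "compact K" "K \<subseteq> U" "\<And>x y. x \<in> C \<Longrightarrow> dist x y \<le> \<delta> \<Longrightarrow> y \<in> K"
      using compact_neighbourhood[OF U C] by metis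
    (* a slope of at least 1 / \<delta> makes every cutoff vanish off K *)
    define \<theta> where "\<theta> k x = max 0 (1 - (1 / \<delta> + real k) * infdist x C)" for k x
    have kpos: "1 / \<delta> + real k > 0" for k using \<delta> by (simp add: add_pos_nonneg)
    have \<theta>l: "(1 / \<delta> + real k)-lipschitz_on UNIV (\<theta> k)" for k
      unfolding \<theta>_def
    proof (rule lipschitz_on_max_0, rule lipschitz_onI)
      fix x y
      have "\<bar>infdist x C - infdist y C\<bar> \<le> dist x y" by (rule infdist_triangle_abs)
      then have "(1 / \<delta> + real k) * \<bar>infdist x C - infdist y C\<bar> \<le> (1 / \<delta> + real k) * dist x y"
        using kpos[of k] by (intro mult_left_mono) auto
      then show "dist (1 - (1 / \<delta> + real k) * infdist x C) (1 - (1 / \<delta> + real k) * infdist y C) \<le> (1 / \<delta> + real k) * dist x y"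
        using kpos[of k] by (simp add: dist_real_def abs_mult right_diff_distrib[symmetric] abs_minus_commute)
    qed (use kpos[of k] in simp)
    have \<theta>off: "\<theta> k x = 0" if "x \<notin> K" for k x
    proof -
      obtain y where y: "y \<in> C" "infdist x C = dist x y"
        using infdist_attains_inf[OF compact_imp_closed[OF C(1)] False] by blast
      have "\<delta> < infdist x C" using K(3)[OF y(1), of x] that y(2) by (force simp: dist_commute)
      then have "1 \<le> (1 / \<delta>) * infdist x C" using \<delta> by (simp add: field_simps)
      also have "\<dots> \<le> (1 / \<delta> + real k) * infdist x C" by (intro mult_right_mono) (auto simp: infdist_nonneg)
      finally show ?thesis by (simp add: \<theta>_def)
    qed
    have \<theta>lim: "(\<lambda>k. \<theta> k x) \<longlonglongrightarrow> indicator C x" for x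
    proof (cases "x \<in> C")
      case True then show ?thesis by (simp add: \<theta>_def)
    next
      case False
      have "infdist x C > 0"
        using infdist_pos_not_in_closed[OF compact_imp_closed[OF C(1)] \<open>C \<noteq> {}\<close> False] .
      then obtain N where N: "1 < real N * infdist x C" using reals_Archimedean3 by blast
      have "\<theta> k x = 0" if "k \<ge> N" for k
      proof -
        have "real N * infdist x C \<le> (1 / \<delta> + real k) * infdist x C"
          using that \<delta> by (intro mult_right_mono) (auto simp: add_increasing infdist_nonneg)
        then show ?thesis using N by (simp add: \<theta>_def)
      qed
      then have "\<forall>\<^sub>F k in sequentially. \<theta> k x = 0" unfolding eventually_sequentially by blast
      then show ?thesis using False by (simp add: tendsto_eventually)
    qed
    have \<theta>b: "norm (\<theta> k x) \<le> 1" for k x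
      using kpos[of k] infdist_nonneg[of x C] by (simp add: \<theta>_def)
    have \<theta>m: "\<theta> k \<in> borel_measurable borel" for k
      by (rule borel_measurable_continuous_onI[OF lipschitz_on_continuous_on[OF \<theta>l]])
    have lim: "(\<lambda>k. integral\<^sup>L \<mu> (\<lambda>x. \<theta> k (f x))) \<longlonglongrightarrow> integral\<^sup>L \<mu> (\<lambda>x. indicator C (f x))"
      if f: "f \<in> measurable \<mu> borel" for f
    proof (rule integral_dominated_convergence[where w = "\<lambda>_. 1"])
      show "(\<lambda>x. \<theta> k (f x)) \<in> borel_measurable \<mu>" for k by (rule measurable_compose[OF f \<theta>m])
      show "(\<lambda>x. indicator C (f x)) \<in> borel_measurable \<mu>"
        by (rule measurable_compose[OF f borel_measurable_indicator]) (simp add: borel_compact C(1))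
    qed (use \<theta>lim \<theta>b in auto)
    have "integral\<^sup>L \<mu> (\<lambda>x. \<theta> k (\<phi> T x)) = integral\<^sup>L \<mu> (\<theta> k)" for k
      by (rule flow_integral_invariant[OF U V lip fl flow st \<theta>l K(1,2) \<theta>off T])
    then have "integral\<^sup>L \<mu> (\<lambda>x. indicat_real C (\<phi> T x)) = integral\<^sup>L \<mu> (\<lambda>x. indicat_real C x)"
      using LIMSEQ_unique[OF lim[OF \<phi>m[of T]]] lim[OF idm] by simp
    moreover have "integral\<^sup>L \<mu> (\<lambda>x. indicat_real C (\<phi> T x)) = measure \<mu> (\<phi> T -` C \<inter> U)"
    proof -
      have "(\<lambda>x. indicator C (\<phi> T x) :: real) = indicator (\<phi> T -` C)" by (auto simp: indicator_def fun_eq_iff)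
      then show ?thesis by (simp add: sp)
    qed
    ultimately show ?thesis using C(2) by (simp add: sp Int_absorb2)
  qed simp
  have borel_case: "measure \<mu> (\<phi> T -` B \<inter> U) = measure \<mu> B" if T: "T \<ge> 0" and B: "B \<in> sets borel" "B \<subseteq> U" for T B
  proof -
    let ?N1 = "distr \<mu> borel (\<lambda>x. x)" and ?N2 = "distr \<mu> borel (\<phi> T)"
    interpret N1: prob_space ?N1 by (rule prob_space_distr[OF idm])
    interpret N2: prob_space ?N2 by (rule prob_space_distr[OF \<phi>m])
    have e1: "emeasure ?N1 A = emeasure \<mu> A" if "A \<in> sets borel" "A \<subseteq> U" for A
      using that by (subst emeasure_distr[OF idm]) (auto simp: sp Int_absorb2)
    have e2: "emeasure ?N2 A = emeasure \<mu> (\<phi> T -` A \<inter> U)" if "A \<in> sets borel" for A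
      using that by (subst emeasure_distr[OF \<phi>m]) (auto simp: sp)
    have "emeasure ?N2 B = (SUP C\<in>{C. C \<subseteq> B \<and> compact C}. emeasure ?N2 C)"
      by (rule inner_regular) (use B N2.emeasure_space_1 in auto)
    also have "\<dots> = (SUP C\<in>{C. C \<subseteq> B \<and> compact C}. emeasure ?N1 C)"
    proof (rule SUP_cong[OF refl])
      fix C assume "C \<in> {C. C \<subseteq> B \<and> compact C}"
      then have C: "compact C" "C \<subseteq> U" using B(2) by auto
      show "emeasure ?N2 C = emeasure ?N1 C"
        using compact_case[OF T C] C by (simp add: e1 e2 borel_compact emeasure_eq_measure)
    qed
    also have "\<dots> = emeasure ?N1 B"
      by (rule inner_regular[symmetric]) (use B N1.emeasure_space_1 in auto)
    finally show ?thesis using B by (simp add: e1 e2 emeasure_eq_measure)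
  qed
  have img: "\<phi> (- t) ` B = \<phi> t -` B \<inter> U" if "B \<subseteq> U" for t B
  proof
    show "\<phi> (- t) ` B \<subseteq> \<phi> t -` B \<inter> U" using that flow_back[of _ "- t"] inU by auto
    show "\<phi> t -` B \<inter> U \<subseteq> \<phi> (- t) ` B" using flow_back[of _ t] by (force simp: image_iff)
  qed
  have "measure \<mu> (\<phi> (- t) ` B) = measure \<mu> B" if B: "B \<in> sets borel" "B \<subseteq> U" for t B
  proof (cases "t \<ge> 0")
    case True then show ?thesis using borel_case[OF True B] img[OF B(2)] by simp
  next
    case False
    let ?B = "\<phi> (- t) ` B"
    have B': "?B \<in> sets borel" "?B \<subseteq> U"
    proof -
      have "\<phi> t -` B \<inter> space \<mu> \<in> sets \<mu>" by (rule measurable_sets[OF \<phi>m B(1)])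
      then show "?B \<in> sets borel" "?B \<subseteq> U" using borel_prob_on_sets[OF \<mu> U] img[OF B(2)] sp by auto
    qed
    have "\<phi> t ` ?B = B" using flow_back[of _ "- t"] B(2) by (force simp: image_iff)
    moreover have "measure \<mu> (\<phi> (- (- t)) ` ?B) = measure \<mu> ?B"
      using borel_case[OF _ B', of "- t"] img[OF B'(2), of "- t"] False by simp
    ultimately show ?thesis by simp
  qed
  then show ?thesis using \<mu> by (simp add: invariant_measure_def)
qed

section \<open>Attractors and repellers\<close>

text \<open>Otherwise the closures of the forward images of \<open>W\<close>, minus \<open>N\<close>, would be a decreasing sequence of nonempty
  compact sets, and a common point would belong to the limit set without belonging to \<open>N\<close>.\<close>

lemma uniform_attraction:
  fixes W :: "(real^'n::finite) set"
  assumes pos: "positively_invariant U I \<phi> W" and pre: "precompact_in U W"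
    and om: "omega_limit \<phi> W \<subseteq> E" and N: "open N" "E \<subseteq> N"
  obtains T where "T > 0" "\<And>x. x \<in> W \<Longrightarrow> \<phi> T x \<in> N"
proof -
  define F where "F n = closure (\<Union>t\<in>{real n..}. \<phi> t ` W) - N" for n
  have comp: "compact (closure W)" using pre by (simp add: precompact_in_def)
  have Fc: "compact (F n)" for n
  proof -
    have "(\<Union>t\<in>{real n..}. \<phi> t ` W) \<subseteq> W"
      using pos unfolding positively_invariant_def by (meson UN_least atLeast_iff of_nat_0_le_iff order_trans)
    then have "F n \<subseteq> closure W" unfolding F_def by (meson Diff_subset closure_mono order_trans)
    moreover have "closed (F n)" unfolding F_def by (intro closed_Diff N closed_closure)
    ultimately show ?thesis using comp compact_Int_closed[of "closure W" "F n"] by (simp add: Int_absorb1)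
  qed
  have "\<exists>n. F n = {}"
  proof (rule ccontr)
    assume "\<nexists>n. F n = {}"
    then have ne: "F n \<noteq> {}" for n by blast
    have "F n \<subseteq> F m" if "m \<le> n" for m n
      unfolding F_def using that by (intro Diff_mono closure_mono UN_mono) auto
    then have "\<Inter>(range F) \<noteq> {}" by (intro compact_nest Fc ne)
    then obtain x where x: "\<And>n. x \<in> F n" by blast
    have "x \<in> omega_limit \<phi> W"
      unfolding omega_limit_def
    proof (rule INT_I)
      fix \<tau> :: real assume "\<tau> \<in> {0..}"
      obtain n where "\<tau> \<le> real n" using real_arch_simple by blast
      then have "closure (\<Union>t\<in>{real n..}. \<phi> t ` W) \<subseteq> closure (\<Union>t\<in>{\<tau>..}. \<phi> t ` W)"
        by (intro closure_mono UN_mono) auto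
      then show "x \<in> closure (\<Union>t\<in>{\<tau>..}. \<phi> t ` W)" using x[of n] unfolding F_def by blast
    qed
    then show False using om N(2) x[of 0] unfolding F_def by blast
  qed
  then obtain n where n: "F n = {}" by blast
  show ?thesis
  proof
    show "real (Suc n) > 0" by simp
    fix x assume "x \<in> W"
    then have "\<phi> (real (Suc n)) x \<in> (\<Union>t\<in>{real n..}. \<phi> t ` W)" by force
    then have "\<phi> (real (Suc n)) x \<in> closure (\<Union>t\<in>{real n..}. \<phi> t ` W)" using closure_subset by (rule rev_subsetD)
    then show "\<phi> (real (Suc n)) x \<in> N" using n unfolding F_def by blast
  qed
qed

text \<open>The number \<open>2 - infdist x E / e\<close> clamped to \<open>[0, 1]\<close>, written with two truncations at \<open>0\<close>.\<close>

definition plateau :: "(real^'n::finite) set \<Rightarrow> real \<Rightarrow> real^'n \<Rightarrow> real" where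
  "plateau E e x = max 0 (1 - max 0 (infdist x E / e - 1))"

lemma plateau_bounds: "0 \<le> plateau E e x" "plateau E e x \<le> 1"
  by (auto simp: plateau_def)

lemma plateau_eq_1: "e > 0 \<Longrightarrow> infdist x E \<le> e \<Longrightarrow> plateau E e x = 1"
  by (simp add: plateau_def)

lemma plateau_eq_0: "e > 0 \<Longrightarrow> infdist x E \<ge> 2 * e \<Longrightarrow> plateau E e x = 0"
  by (simp add: plateau_def max_def field_simps)

lemma plateau_less_1: "e > 0 \<Longrightarrow> infdist x E > e \<Longrightarrow> plateau E e x < 1"
  by (auto simp: plateau_def max_def field_simps)

lemma lipschitz_infdist: "1-lipschitz_on X (\<lambda>x. infdist x E)"
  by (rule lipschitz_onI) (auto simp: dist_real_def infdist_triangle_abs)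

lemma lipschitz_plateau:
  assumes "e > 0" shows "(1 / e)-lipschitz_on X (plateau E e)"
proof -
  have "(0 + (1 / e * 1 + 0))-lipschitz_on X (\<lambda>x. 1 - max 0 (1 / e * infdist x E - 1))"
    using assms
    by (intro lipschitz_on_diff lipschitz_on_constant lipschitz_on_max_0 lipschitz_on_cmult_real_nonneg lipschitz_infdist) simp
  then show ?thesis
    using lipschitz_on_max_0 by (simp add: plateau_def[abs_def])
qed

lemma integral_less_length:
  fixes h :: "real \<Rightarrow> real"
  assumes c: "continuous_on {0..T} h" and T: "T > 0" and h: "\<And>s. s \<in> {0..T} \<Longrightarrow> h s \<le> 1" and "h 0 < 1"
  shows "integral {0..T} h < T"
proof -
  have int: "h integrable_on {0..T}" by (rule integrable_continuous_real[OF c])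
  have "integral {0..T} (\<lambda>s. 1 - h s) = T - integral {0..T} h"
    using T int by (subst Henstock_Kurzweil_Integration.integral_diff) auto
  moreover have "0 \<le> integral {0..T} (\<lambda>s. 1 - h s)"
    by (rule Henstock_Kurzweil_Integration.integral_nonneg) (use int h in \<open>auto intro!: integrable_diff\<close>)
  moreover have "integral {0..T} (\<lambda>s. 1 - h s) \<noteq> 0"
    using integral_eq_0_iff[of 0 T "\<lambda>s. 1 - h s"] c T h assms(4)
    by (force intro!: continuous_intros)
  ultimately show ?thesis by linarith
qed

text \<open>Let \<open>\<theta> k\<close> be plateau functions that shrink to \<open>E\<close>, and let \<open>T k\<close> be a time at which all orbits from \<open>W\<close> are
  in the plateau of \<open>\<theta> k\<close>. The integral \<open>u k\<close> of \<open>\<theta> k\<close> along orbits up to time \<open>T k\<close> then increases along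
  \<open>V\<close> at the rate \<open>1 - \<theta> k \<ge> 0\<close>.
  
  The function \<open>u 0\<close> has its largest value \<open>T 0\<close> on \<open>E\<close>. On the set \<open>P\<close> of points at distance \<open>r\<close> from \<open>E\<close> it
  stays below some \<open>c < T 0\<close>, because there the integrand starts with the value \<open>0\<close>. So \<open>(max 0 (u 0 - c))\<^sup>2 * u k\<close>,
  restricted to the region inside \<open>P\<close>, has compact support. Both factors are nonnegative and nondecreasing along
  \<open>V\<close>; the derivative along \<open>V\<close> is nonnegative with integral \<open>0\<close>, hence zero almost everywhere. Inside \<open>P\<close> and
  where \<open>u 0 > c\<close>, it is positive at every point with \<open>\<theta> k < 1\<close>. The first factor localizes in a region that is
  the same for all \<open>k\<close> and all measures, and the second one detects the mass outside the \<open>k\<close>-th plateau.\<close>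

theorem attractor_neighbourhood_null:
  fixes V :: "real^'n::finite \<Rightarrow> real^'n"
  assumes U: "open U" and V: "continuous_on U V"
    and lip: "\<And>Y. compact Y \<Longrightarrow> Y \<subseteq> U \<Longrightarrow> \<exists>L. L-lipschitz_on Y V"
    and fl: "local_flow U V I \<phi>"
    and E: "compact E" "invariant_set U I \<phi> E"
    and W: "neighborhood_in U E W" "positively_invariant U I \<phi> W" "precompact_in U W" "omega_limit \<phi> W \<subseteq> E"
  obtains W\<^sub>0 where "neighborhood_in U E W\<^sub>0"
    "\<And>\<mu>. drift_stationary U V \<mu> \<Longrightarrow> W\<^sub>0 - E \<in> null_sets \<mu>"
proof (cases "E = {}")
  case True
  show ?thesis
    by (rule that[of "{}"]) (use True in \<open>auto simp: neighborhood_in_def intro!: exI[of _ "{}"]\<close>)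
next
  case False
  have Ecl: "closed E" by (rule compact_imp_closed[OF E(1)])
  obtain N where N: "open N" "E \<subseteq> N" "N \<subseteq> W" "W \<subseteq> U" using W(1) by (auto simp: neighborhood_in_def)
  have pos: "{0..} \<subseteq> I x" if "x \<in> W" for x using W(2) that by (simp add: positively_invariant_def)
  obtain r K where r: "r > 0" and K: "compact K" "K \<subseteq> N" "\<And>x y. x \<in> E \<Longrightarrow> dist x y \<le> r \<Longrightarrow> y \<in> K"
    using compact_neighbourhood[OF N(1) E(1) N(2)] by metis
  define X where "X = {x. infdist x E \<le> r}"
  define X' where "X' = {x. infdist x E < r}"
  have infc: "continuous_on A (\<lambda>x. infdist x E)" for A by (intro continuous_intros)
  have XK: "X \<subseteq> K"
  proof
    fix x assume x: "x \<in> X"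
    obtain y where "y \<in> E" "infdist x E = dist x y" using infdist_attains_inf[OF Ecl False] by blast
    then show "x \<in> K" using K(3)[of y x] x by (simp add: X_def dist_commute)
  qed
  have Xcl: "closed X" unfolding X_def by (intro closed_Collect_le infc continuous_on_const)
  have X: "compact X" using compact_Int_closed[OF K(1) Xcl] XK by (simp add: Int_absorb1)
  have XW: "X \<subseteq> W" using XK K(2) N(3) by blast
  have XU: "X \<subseteq> U" using XW N(4) by blast
  have X'op: "open X'" unfolding X'_def by (intro open_Collect_less infc continuous_on_const)
  have X'X: "X' \<subseteq> interior X" by (rule interior_maximal[OF _ X'op]) (auto simp: X_def X'_def)
  have EX': "E \<subseteq> X'" using r by (auto simp: X'_def)
  have XI: "{0..T} \<subseteq> I x" if "x \<in> X" for x T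
  proof -
    have "{0..T} \<subseteq> {0..}" by auto
    then show ?thesis using pos[of x] that XW by blast
  qed
  (* here 2 * e 0 = r, so that \<theta> 0 vanishes at distance r from E *)
  define e where "e k = r / (2 * real (Suc k))" for k
  have e: "e k > 0" "2 * e k \<le> r" for k using r by (auto simp: e_def field_simps)
  define \<theta> where "\<theta> k = plateau E (e k)" for k
  have \<theta>l: "(1 / e k)-lipschitz_on A (\<theta> k)" for k A unfolding \<theta>_def by (rule lipschitz_plateau[OF e(1)])
  have \<theta>c: "continuous_on A (\<theta> k)" for k A by (rule lipschitz_on_continuous_on[OF \<theta>l])
  have \<theta>b: "0 \<le> \<theta> k x" "\<theta> k x \<le> 1" for k x by (simp_all add: \<theta>_def plateau_bounds)
  have "\<exists>T>0. \<forall>x\<in>W. \<theta> k (\<phi> T x) = 1" for k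
  proof -
    have op: "open {x. infdist x E < e k}" by (intro open_Collect_less infc continuous_on_const)
    have sub: "E \<subseteq> {x. infdist x E < e k}" using e(1) by auto
    obtain T where "T > 0" "\<And>x. x \<in> W \<Longrightarrow> \<phi> T x \<in> {x. infdist x E < e k}"
      using uniform_attraction[OF W(2,3,4) op sub] by metis
    then show ?thesis using plateau_eq_1[OF e(1)] unfolding \<theta>_def by (metis less_imp_le mem_Collect_eq)
  qed
  then obtain T where T: "\<And>k. T k > 0" "\<And>k x. x \<in> W \<Longrightarrow> \<theta> k (\<phi> (T k) x) = 1" by metis
  define u where "u k = orbit_integral \<phi> (\<theta> k) (T k)" for k
  have "\<exists>L. L-lipschitz_on X (u k)" for k
    using orbit_integral_lipschitz[OF fl lip X XU XI less_imp_le[OF T(1)] \<theta>l] unfolding u_def by metis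
  then obtain L where L: "\<And>k. (L k)-lipschitz_on X (u k)" by metis
  have uc: "continuous_on X (u k)" for k by (rule lipschitz_on_continuous_on[OF L])
  have orbc: "continuous_on {0..T k} (\<lambda>s. \<theta> k (\<phi> s x))" if "x \<in> X" for x k
    using orbit_continuous[OF fl _ XI[OF that] \<theta>c] that XU by blast
  have u0: "0 \<le> u k x" if "x \<in> X" for k x
    unfolding u_def orbit_integral_def
    by (rule Henstock_Kurzweil_Integration.integral_nonneg[OF integrable_continuous_real[OF orbc[OF that]]]) (rule \<theta>b)
  have uE: "u k x = T k" if "x \<in> E" for k x
  proof -
    have "\<theta> k (\<phi> s x) = 1" for s
    proof -
      have "\<phi> s x \<in> E" using E(2) that unfolding invariant_set_def by blast
      then show ?thesis unfolding \<theta>_def using e(1)[of k] by (intro plateau_eq_1) auto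
    qed
    then show ?thesis unfolding u_def orbit_integral_def using T(1)[of k] by simp
  qed
  define P where "P = {x. infdist x E = r}"
  have PX: "P \<subseteq> X" by (auto simp: P_def X_def)
  have uP: "u 0 x < T 0" if "x \<in> P" for x
  proof -
    have x: "x \<in> X" using that PX by blast
    have "\<theta> 0 (\<phi> 0 x) = 0"
      using local_flow_cases(3)[OF fl, of x] x XU that e(1)[of 0] plateau_eq_0[of "e 0" x E]
      by (auto simp: \<theta>_def P_def e_def)
    then show ?thesis
      unfolding u_def orbit_integral_def by (intro integral_less_length orbc[OF x] T(1) \<theta>b) simp
  qed
  obtain c where c: "c < T 0" "\<And>x. x \<in> P \<Longrightarrow> u 0 x < c"
  proof (cases "P = {}")
    case True then show ?thesis using that[of "T 0 - 1"] by simp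
  next
    case False
    have "closed P" unfolding P_def by (intro closed_Collect_eq infc continuous_on_const)
    then have "compact P" using compact_Int_closed[OF X, of P] PX by (simp add: Int_absorb1)
    then obtain z where z: "z \<in> P" "\<And>x. x \<in> P \<Longrightarrow> u 0 x \<le> u 0 z"
      using continuous_attains_sup[OF _ False continuous_on_subset[OF uc PX]] by metis
    show ?thesis
    proof (rule that[of "(u 0 z + T 0) / 2"])
      show "(u 0 z + T 0) / 2 < T 0" using uP[OF z(1)] by simp
      show "u 0 x < (u 0 z + T 0) / 2" if "x \<in> P" for x using z(2)[OF that] uP[OF z(1)] by simp
    qed
  qed
  define W0 where "W0 = X' \<inter> (X' \<inter> u 0 -` {c<..})"
  have W0op: "open W0"
  proof -
    have "open (X' \<inter> u 0 -` {c<..})"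
      using X'X interior_subset[of X]
      by (intro continuous_open_preimage[OF continuous_on_subset[OF uc] X'op]) auto
    then show ?thesis unfolding W0_def using X'op by blast
  qed
  have EW0: "E \<subseteq> W0" using EX' uE[of _ 0] c(1) by (auto simp: W0_def)
  have W0U: "W0 \<subseteq> U" using X'X interior_subset[of X] XU by (auto simp: W0_def)
  define S where "S = X \<inter> (X \<inter> u 0 -` {c..})"
  have S: "compact S" unfolding S_def
    by (rule compact_Int_closed[OF X continuous_closed_preimage[OF uc Xcl closed_atLeast]])
  have SX': "S \<subseteq> X'"
  proof
    fix x assume x: "x \<in> S"
    then have "x \<notin> P" using c(2)[of x] by (auto simp: S_def)
    then show "x \<in> X'" using x by (auto simp: S_def X_def X'_def P_def)
  qed
  have SX: "S \<subseteq> interior X" using SX' X'X by blast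
  have SU: "S \<subseteq> U" using XU by (auto simp: S_def)
  let ?g = "\<lambda>x. max 0 (u 0 x - c)"
  let ?f = "\<lambda>k x. (?g x)\<^sup>2 * u k x"
  let ?d = "\<lambda>k x. 2 * ?g x * (1 - \<theta> 0 x) * u k x + (1 - \<theta> k x) * (?g x)\<^sup>2"
  let ?w = "\<lambda>k x. if x \<in> interior X then ?d k x else 0"
  have off: "?g x = 0" if "x \<in> X" "x \<notin> S" for x using that by (auto simp: S_def)
  have intX: "x \<in> X" if "x \<in> interior X" for x using that interior_subset by blast
  have wc: "continuous_on U (?w k)" for k
  proof -
    have "continuous_on (interior X) (?d k)"
      by (intro continuous_intros \<theta>c continuous_on_subset[OF uc interior_subset])
    then have 1: "continuous_on (interior X) (?w k)" by (rule continuous_on_eq) simp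
    have "?w k x = 0" if "x \<notin> S" for x using off[OF intX that] by simp
    then have 2: "continuous_on (U - S) (?w k)"
      by (intro continuous_on_eq[OF continuous_on_const[of "U - S" "0::real"]]) simp
    have "continuous_on (interior X \<union> (U - S)) (?w k)"
      by (rule continuous_on_open_Un[OF open_interior _ 1 2]) (intro open_Diff U compact_imp_closed S)
    then show ?thesis by (rule continuous_on_subset) (use SX in blast)
  qed
  have woff: "?w k x = 0" if "x \<notin> S" for k x using off[OF intX that] by simp
  have wnn: "0 \<le> ?w k x" for k x
    using \<theta>b u0[OF intX, of x k] by (auto intro!: add_nonneg_nonneg mult_nonneg_nonneg)
  have FL: "\<exists>M. M-lipschitz_on UNIV (\<lambda>x. if x \<in> X then ?f k x else 0)" for k
  proof -
    have "(L 0 + 0)-lipschitz_on X (\<lambda>x. u 0 x - c)" by (intro lipschitz_on_diff L lipschitz_on_constant)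
    then obtain C where C: "C-lipschitz_on X (\<lambda>x. (?g x)\<^sup>2)" using lipschitz_on_max_0_sq[OF X] by metis
    obtain C' where C': "C'-lipschitz_on X (?f k)" by (rule lipschitz_on_mult_compact[OF X C L])
    obtain M where "M-lipschitz_on UNIV (\<lambda>x. if x \<in> X then ?f k x else 0)"
      by (rule lipschitz_extend_by_zero[OF C' S SX]) (simp add: off)
    then show ?thesis by blast
  qed
  have der: "((\<lambda>s. (if y + s *\<^sub>R V y \<in> X then ?f k (y + s *\<^sub>R V y) else 0)) has_real_derivative ?w k y) (at 0)"
    if y: "y \<in> U" for y k
  proof (cases "y \<in> interior X")
    case True
    have du: "((\<lambda>s. u k (y + s *\<^sub>R V y)) has_real_derivative 1 - \<theta> k y) (at 0)" for k
    proof -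
      have "\<theta> k (\<phi> (T k) y) = 1" using T(2) XW intX[OF True] by blast
      then show ?thesis
        using orbit_integral_derivative[OF fl XU XI[OF intX[OF True]] less_imp_le[OF T(1)] \<theta>c L[unfolded u_def] True, of k]
        unfolding u_def by simp
    qed
    have "((\<lambda>s. u 0 (y + s *\<^sub>R V y) - c) has_real_derivative (1 - \<theta> 0 y) - 0) (at 0)"
      by (intro DERIV_diff du DERIV_const)
    from DERIV_mult[OF DERIV_chain2[OF has_derivative_max_0_sq this] du[of k]]
    have "((\<lambda>s. ?f k (y + s *\<^sub>R V y)) has_real_derivative ?d k y) (at 0)" by simp
    then show ?thesis
      using True directional_derivative_transform[OF open_interior True, of "\<lambda>x. if x \<in> X then ?f k x else 0" "?f k" "V y" "?d k y"] intX
      by simp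
  next
    case False
    have op: "open (U - S)" by (intro open_Diff U compact_imp_closed S)
    have "y \<in> U - S" using y False SX by blast
    then have "((\<lambda>s. (if y + s *\<^sub>R V y \<in> X then ?f k (y + s *\<^sub>R V y) else 0)) has_real_derivative 0) (at 0)"
      using directional_derivative_transform[OF op _ _ DERIV_const, of y "\<lambda>x. if x \<in> X then ?f k x else 0" 0 "V y"] off by auto
    then show ?thesis using False by simp
  qed
  have null: "W0 - E \<in> null_sets \<mu>"
    if st: "drift_stationary U V \<mu>" for \<mu>
  proof -
    note \<mu> = drift_stationaryD(1)[OF st]
    have AEk: "AE x in \<mu>. ?w k x = 0" for k
    proof (rule nonneg_integral_zero_AE[OF U \<mu> wc wnn S SU])
      obtain M where M: "M-lipschitz_on UNIV (\<lambda>x. if x \<in> X then ?f k x else 0)"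
        using FL[of k] by blast
      show "integral\<^sup>L \<mu> (?w k) = 0"
        by (rule integral_directional_derivative_eq_0[OF U V st M S SU _ der wc]) (use off in auto)
    qed (use woff in auto)
    then have "AE x in \<mu>. \<forall>k. ?w k x = 0" by (simp add: AE_all_countable)
    then have AE: "AE x in \<mu>. x \<notin> W0 - E"
    proof (rule eventually_mono, intro notI)
      fix x assume w: "\<forall>k. ?w k x = 0" and x: "x \<in> W0 - E"
      have xX: "x \<in> interior X" and g: "?g x > 0" using x X'X by (auto simp: W0_def)
      have "infdist x E > 0" using infdist_pos_not_in_closed[OF Ecl False] x by blast
      then obtain k where k: "r / infdist x E < real k" using reals_Archimedean2 by blast
      then have "r < real k * infdist x E" using \<open>infdist x E > 0\<close> by (simp add: pos_divide_less_eq)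
      also have "\<dots> \<le> 2 * real (Suc k) * infdist x E" using \<open>infdist x E > 0\<close> by (intro mult_right_mono) auto
      finally have "e k < infdist x E" by (simp add: e_def pos_divide_less_eq mult.commute)
      then have "\<theta> k x < 1" unfolding \<theta>_def by (rule plateau_less_1[OF e(1)])
      then have "0 < (1 - \<theta> k x) * (?g x)\<^sup>2" using g by (intro mult_pos_pos) auto
      moreover have "0 \<le> 2 * ?g x * (1 - \<theta> 0 x) * u k x"
        using \<theta>b u0[OF intX[OF xX]] by (intro mult_nonneg_nonneg) auto
      ultimately have "?d k x > 0" by (rule add_nonneg_pos[rotated])
      then have "?w k x > 0" using xX by simp
      then show False using w by simp
    qed
    have "W0 - E \<in> sets \<mu>"
      using borel_prob_on_sets[OF \<mu> U] W0op Ecl W0U by auto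
    then show ?thesis using AE AE_iff_null_sets by blast
  qed
  show ?thesis
    by (rule that[of W0]) (use W0op EW0 W0U null in \<open>auto simp: neighborhood_in_def\<close>)
qed

lemma solves_ode_in_reverse:
  assumes "solves_ode_in U V x J"
  shows "solves_ode_in U (\<lambda>x. - V x) (\<lambda>t. x (- t)) (uminus ` J)"
  unfolding solves_ode_in_def
proof (intro ballI conjI)
  fix t assume "t \<in> uminus ` J"
  then have t: "- t \<in> J" by auto
  show "x (- t) \<in> U" using assms t by (simp add: solves_ode_in_def)
  have 1: "(uminus has_vector_derivative - 1) (at t within uminus ` J)"
    by (auto intro!: derivative_eq_intros)
  have "(x has_vector_derivative V (x (- t))) (at (- t) within uminus ` (uminus ` J))"
    using assms t by (simp add: solves_ode_in_def image_image)
  from vector_diff_chain_within[OF 1 this]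
  show "((\<lambda>t. x (- t)) has_vector_derivative - V (x (- t))) (at t within uminus ` J)"
    by (simp add: o_def)
qed

lemma local_flow_reverse:
  assumes fl: "local_flow U V I \<phi>"
  shows "local_flow U (\<lambda>x. - V x) (\<lambda>\<xi>. uminus ` I \<xi>) (\<lambda>t. \<phi> (- t))"
  unfolding local_flow_def
proof (intro conjI ballI allI impI)
  fix \<xi> assume \<xi>: "\<xi> \<in> U"
  note c = local_flow_cases[OF fl \<xi>]
  have neg_int: "is_interval (uminus ` J)" if "is_interval J" for J :: "real set"
    using that unfolding is_interval_1 by (metis (no_types, lifting) image_iff minus_le_iff le_minus_iff minus_minus)
  show "is_interval (uminus ` I \<xi>)" by (rule neg_int[OF c(1)])
  show "0 \<in> uminus ` I \<xi>" using c(2) by force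
  show "\<phi> (- 0) \<xi> = \<xi>" using c(3) by simp
  show "solves_ode_in U (\<lambda>x. - V x) (\<lambda>t. \<phi> (- t) \<xi>) (uminus ` I \<xi>)" by (rule solves_ode_in_reverse[OF c(4)])
  fix J x assume J: "is_interval J \<and> 0 \<in> J \<and> x 0 = \<xi> \<and> solves_ode_in U (\<lambda>x. - V x) x J"
  have "solves_ode_in U V (\<lambda>t. x (- t)) (uminus ` J)"
    using solves_ode_in_reverse[of U "\<lambda>x. - V x" x J] J by simp
  then have *: "- t \<in> I \<xi> \<and> x t = \<phi> (- t) \<xi>" if "t \<in> J" for t
    using c(5)[OF neg_int, of J "\<lambda>t. x (- t)" "- t"] J that by force
  show "J \<subseteq> uminus ` I \<xi>" using * by force
  fix t assume "t \<in> J"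
  then show "x t = \<phi> (- t) \<xi>" using * by blast
next
  have m: "(\<lambda>z. (- fst z, snd z)) -` {(t, \<xi>). \<xi> \<in> U \<and> t \<in> I \<xi>} = {(t, \<xi>). \<xi> \<in> U \<and> t \<in> uminus ` I \<xi>}"
    by (auto simp: image_iff) (metis minus_minus)
  have "open {(t, \<xi>). \<xi> \<in> U \<and> t \<in> I \<xi>}" using fl by (simp add: local_flow_def)
  then have "open ((\<lambda>z. (- fst z, snd z)) -` {(t, \<xi>). \<xi> \<in> U \<and> t \<in> I \<xi>})"
    by (intro open_vimage continuous_intros)
  then show "open {(t, \<xi>). \<xi> \<in> U \<and> t \<in> uminus ` I \<xi>}" unfolding m .
  show "continuous_on {(t, \<xi>). \<xi> \<in> U \<and> t \<in> uminus ` I \<xi>} (\<lambda>(t, \<xi>). \<phi> (- t) \<xi>)"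
    unfolding split_beta
    by (intro flow_continuous[OF fl] continuous_intros) auto
qed

lemma omega_limit_reverse: "omega_limit (\<lambda>t. \<phi> (- t)) W = alpha_limit \<phi> W"
proof -
  have "(\<Union>t\<in>{\<tau>..}. \<phi> (- t) ` W) = (\<Union>t\<in>{..- \<tau>}. \<phi> t ` W)" for \<tau> :: real
  proof -
    have "{..- \<tau>} = uminus ` {\<tau>..}" by simp
    then show ?thesis by (simp only: image_image UN_simps)
  qed
  then have "omega_limit (\<lambda>t. \<phi> (- t)) W = (\<Inter>\<tau>\<in>{0..}. closure (\<Union>t\<in>{..- \<tau>}. \<phi> t ` W))"
    by (simp add: omega_limit_def)
  also have "\<dots> = (\<Inter>\<tau>\<in>uminus ` {0..}. closure (\<Union>t\<in>{..\<tau>}. \<phi> t ` W))"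
    by (simp only: image_image)
  also have "uminus ` {0..} = {..(0::real)}" by simp
  finally show ?thesis by (simp only: alpha_limit_def)
qed

text \<open>Time reversal turns a repeller into an attractor of \<open>- V\<close>, and a measure is stationary for the drift \<open>V\<close> if and
  only if it is for \<open>- V\<close>.\<close>

theorem repeller_neighbourhood_null:
  fixes V :: "real^'n::finite \<Rightarrow> real^'n"
  assumes U: "open U" and V: "continuous_on U V"
    and lip: "\<And>Y. compact Y \<Longrightarrow> Y \<subseteq> U \<Longrightarrow> \<exists>L. L-lipschitz_on Y V"
    and fl: "local_flow U V I \<phi>"
    and E: "compact E" "invariant_set U I \<phi> E"
    and W: "neighborhood_in U E W" "negatively_invariant U I \<phi> W" "precompact_in U W" "alpha_limit \<phi> W \<subseteq> E"
  obtains W\<^sub>0 where "neighborhood_in U E W\<^sub>0"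
    "\<And>\<mu>. drift_stationary U V \<mu> \<Longrightarrow> W\<^sub>0 - E \<in> null_sets \<mu>"
proof (rule attractor_neighbourhood_null[OF U continuous_on_minus[OF V] _ local_flow_reverse[OF fl] E(1) _ W(1) _ W(3)])
  show "\<exists>L. L-lipschitz_on Y (\<lambda>x. - V x)" if "compact Y" "Y \<subseteq> U" for Y
    using lip[OF that] by simp
  show "invariant_set U (\<lambda>\<xi>. uminus ` I \<xi>) (\<lambda>t. \<phi> (- t)) E"
    using E(2) by (auto simp: invariant_set_def)
  show "positively_invariant U (\<lambda>\<xi>. uminus ` I \<xi>) (\<lambda>t. \<phi> (- t)) W"
    unfolding positively_invariant_def
  proof (intro conjI ballI allI impI)
    show "W \<subseteq> U" using W(2) by (simp add: negatively_invariant_def)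
    show "{0..} \<subseteq> uminus ` I \<xi>" if "\<xi> \<in> W" for \<xi>
    proof
      fix t :: real assume "t \<in> {0..}"
      then have "- t \<in> {..0}" by simp
      then have "- t \<in> I \<xi>" using W(2) that unfolding negatively_invariant_def by blast
      then show "t \<in> uminus ` I \<xi>" by force
    qed
    show "\<phi> (- t) ` W \<subseteq> W" if "0 \<le> t" for t using W(2) that by (simp add: negatively_invariant_def)
  qed
  show "omega_limit (\<lambda>t. \<phi> (- t)) W \<subseteq> E" using W(4) by (simp add: omega_limit_reverse)
  fix W\<^sub>0 assume W0: "neighborhood_in U E W\<^sub>0"
    "\<And>\<mu>. drift_stationary U (\<lambda>x. - V x) \<mu> \<Longrightarrow> W\<^sub>0 - E \<in> null_sets \<mu>"
  show thesis
    by (rule that[OF W0(1)], rule W0(2)) (simp add: drift_stationary_iff)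
qed

theorem theoremA:
  fixes U :: "(real^'n::finite) set"
    and V :: "real^'n \<Rightarrow> real^'n"
    and I :: "real^'n \<Rightarrow> real set"
    and \<phi> :: "real \<Rightarrow> real^'n \<Rightarrow> real^'n"
    and p :: real
    and D :: "'i set"
    and le :: "'i \<Rightarrow> 'i \<Rightarrow> bool"
    and A :: "'i \<Rightarrow> real^'n \<Rightarrow> real^'n^'n"
  assumes "open U" and "connected U"
    and "continuous_on U V"
    and "local_flow U V I \<phi>"
    and "CARD('m::finite) \<ge> CARD('n)"
    and "p > real CARD('n)"
    and "null_family TYPE('m) p U D le A"
  shows "(C1_field U V \<and> is_flow U I \<longrightarrow>
            (\<forall>\<mu>. limit_measure p U V (A ` D) \<mu> \<longrightarrow> invariant_measure U \<phi> \<mu>))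
       \<and> (\<forall>U\<^sub>0. entire_weak_Lyapunov U V U\<^sub>0 \<or> entire_weak_anti_Lyapunov U V U\<^sub>0 \<longrightarrow>
            (\<forall>\<mu>. limit_measure p U V (A ` D) \<mu> \<and> compact (measure_support U \<mu>) \<longrightarrow>
               measure_support U \<mu> \<subseteq> {x \<in> U. V x \<bullet> grad U\<^sub>0 x = 0}))
       \<and> (C1_field U V \<longrightarrow>
            (\<forall>E\<^sub>0. strong_local_attractor U V I \<phi> E\<^sub>0 \<or> strong_local_repeller U V I \<phi> E\<^sub>0 \<longrightarrow>
               (\<exists>W\<^sub>0. neighborhood_in U E\<^sub>0 W\<^sub>0 \<and>
                  (\<forall>\<mu>. limit_measure p U V (A ` D) \<mu> \<longrightarrow> W\<^sub>0 - E\<^sub>0 \<in> null_sets \<mu>))))"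
proof -
  note U = assms(1) and V = assms(3) and fl = assms(4) and p = assms(6)
  have AD: "A ` D \<subseteq> diffusion_class TYPE('m) p U" using assms(7) by (auto simp: null_family_def)
  note st = limit_measure_drift_stationary[OF U V p AD]
  have lip: "\<exists>L. L-lipschitz_on Y V" if "C1_field U V" "compact Y" "Y \<subseteq> U" for Y
    using C1_field_lipschitz_on_compact[OF U that] by blast
  have a: "invariant_measure U \<phi> \<mu>" if "C1_field U V" "is_flow U I" "limit_measure p U V (A ` D) \<mu>" for \<mu>
    by (rule flow_invariant_measure[OF U V lip[OF that(1)] fl that(2) st[OF that(3)]])
  have b: "measure_support U \<mu> \<subseteq> {x \<in> U. V x \<bullet> grad U\<^sub>0 x = 0}"
    if "entire_weak_Lyapunov U V U\<^sub>0 \<or> entire_weak_anti_Lyapunov U V U\<^sub>0" "limit_measure p U V (A ` D) \<mu>" for U\<^sub>0 \<mu>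
  proof
    fix x assume x: "x \<in> measure_support U \<mu>"
    have "V x \<bullet> grad U\<^sub>0 x = 0"
      by (rule lasalle[OF U V st[OF that(2)] _ _ _ x])
         (use that(1) in \<open>auto simp: entire_weak_Lyapunov_def entire_weak_anti_Lyapunov_def\<close>)
    then show "x \<in> {x \<in> U. V x \<bullet> grad U\<^sub>0 x = 0}" using x by (simp add: measure_support_def)
  qed
  have c: "\<exists>W\<^sub>0. neighborhood_in U E\<^sub>0 W\<^sub>0 \<and> (\<forall>\<mu>. limit_measure p U V (A ` D) \<mu> \<longrightarrow> W\<^sub>0 - E\<^sub>0 \<in> null_sets \<mu>)"
    if C1: "C1_field U V" and E: "strong_local_attractor U V I \<phi> E\<^sub>0 \<or> strong_local_repeller U V I \<phi> E\<^sub>0" for E\<^sub>0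
    using E
  proof
    assume "strong_local_attractor U V I \<phi> E\<^sub>0"
    then obtain W where "compact E\<^sub>0" "invariant_set U I \<phi> E\<^sub>0" "neighborhood_in U E\<^sub>0 W"
      "positively_invariant U I \<phi> W" "precompact_in U W" "omega_limit \<phi> W \<subseteq> E\<^sub>0"
      unfolding strong_local_attractor_def by blast
    from attractor_neighbourhood_null[OF U V lip[OF C1] fl this]
    obtain W\<^sub>0 where "neighborhood_in U E\<^sub>0 W\<^sub>0" "\<And>\<mu>. drift_stationary U V \<mu> \<Longrightarrow> W\<^sub>0 - E\<^sub>0 \<in> null_sets \<mu>"
      by metis
    then show ?thesis using st by blast
  next
    assume "strong_local_repeller U V I \<phi> E\<^sub>0"
    then obtain W where "compact E\<^sub>0" "invariant_set U I \<phi> E\<^sub>0" "neighborhood_in U E\<^sub>0 W"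
      "negatively_invariant U I \<phi> W" "precompact_in U W" "alpha_limit \<phi> W \<subseteq> E\<^sub>0"
      unfolding strong_local_repeller_def by blast
    from repeller_neighbourhood_null[OF U V lip[OF C1] fl this]
    obtain W\<^sub>0 where "neighborhood_in U E\<^sub>0 W\<^sub>0" "\<And>\<mu>. drift_stationary U V \<mu> \<Longrightarrow> W\<^sub>0 - E\<^sub>0 \<in> null_sets \<mu>"
      by metis
    then show ?thesis using st by blast
  qed
  show ?thesis using a b c by blast
qed

end
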